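(* With respect to convolution product, $\mathcal M(G,\omega)=C_0(G,\omega^{-1})^*$ is a Banach algebra, i.e., $(\mu,\nu)\mapsto\mu*\nu$ is a well-defined associative operation on $\mathcal M(G,\omega)$ satisfying $\|\mu*\nu\|_\omega\le\|\mu\|_\omega\|\nu\|_\omega$. Moreover, for $\mu,\nu\in\mathcal M(G,\omega)$ and $\psi\in C_0(G,\omega^{-1})$, $$\langle\mu*\nu,\psi\rangle_\omega=\int\psi(st)\,d(\mu\times\nu)_e(s,t)=\iint\psi(st)\,d\mu(s)\,d\nu(t)=\iint\psi(st)\,d\nu(t)\,d\mu(s).$$
   Context: $G$ is a locally compact group with identity $e_G$, and $\omega:G\to(0,\infty)$ is a continuous weight: $\omega(st)\le\omega(s)\omega(t)$ for $s,t\in G$, and $\omega(e_G)=1$. $C_{00}(\cdot)$ and $C_0(\cdot)$ denote continuous functions with compact support, respectively vanishing at infinity. $C_0(G,\omega^{-1})=\{\psi:\psi/\omega\in C_0(G)\}$ with norm $\|\psi\|_{\infty,\omega^{-1}}=\|\psi/\omega\|_\infty$. Measures: for a locally compact Hausdorff space $X$, $\mathfrak S(X)$ is the $\delta$-ring of all Borel subsets of $X$ with compact closure. A complex compacted-Borel measure is a countably additive function $\mu:\mathfrak S(X)\to\mathbb C$, with total variation $|\mu|$ (finite on $\mathfrak S(X)$). $\mu$ is regular if $|\mu|(A)=\sup\{|\mu|(C):C\subseteq A,\ C\text{ compact}\}$ for all $A\in\mathfrak S(X)$. $\mathcal M(X)$ is the space of all regular complex compacted-Borel measures; $\mathcal M_r(X)$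 is the Banach space of bounded ones, with $\|\mu\|=\sup\{|\mu|(A):A\in\mathfrak S(X)\}<\infty$. Integration against a complex measure $\mu$ on a $\delta$-ring $\mathfrak S$: for each $A\in\mathfrak S$, $\mu$ restricts to an ordinary complex measure on the $\sigma$-algebra $\{B\in\mathfrak S:B\subseteq A\}$ of subsets of $A$. A function $f$ is locally $\mu$-measurable if $f|_A$ is measurable for the $|\mu|$-completion of this $\sigma$-algebra for every $A\in\mathfrak S$. $\mathcal L^1(\mu)$ consists of the locally $\mu$-measurable complex functions $f$ which vanish off a countable union $\bigcup_nA_n$ of an increasing sequence of sets in $\mathfrak S$ and satisfy $\lim_n\int_{A_n}|f|\,d|\mu|<\infty$; then $\int f\,d\mu=\lim_n\int_{A_n}f\,d\mu$. For a continuous function $h$ on $G$ and $\nu\in\mathcal M(G)$, $h\nu\in\mathcal M(G)$ is defined by $(h\nu)(A)=\int h\chi_A\,d\nu$. Define $\mathcal M(G,\omega)=\{\nu\in\mathcal M(G):\omega\nu\in\mathcal M_r(G)\}$ with norm $\|\nu\|_\omega=\|\omega\nu\|$; it is identified with the dual space $C_0(G,\omega^{-1})^*$ through the pairing $\langle\nu,\psi\rangle_\omega=\int\psi\,d\nu$. Maximal regular extension: for $\sigma\in\mathcal M(X)$, $\mathcal E_\sigma$ is the $\delta$-ring of all Borel subsets $A$ of $X$ contained in some open set $U$ with $\sup\{|\sigma|(A'):A'\in\mathfrak S(X),\ A'\subseteq U\}<\infty$; $\sigma_e(A)=\lim_C\sigma(C)$ (limit along the upward directed set of compact $C\subseteq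 A$) defines a complex measure on $\mathcal E_\sigma$ extending $\sigma$. Convolution: for $\mu,\nu\in\mathcal M(G)$, $\mu\times\nu$ is the unique element of $\mathcal M(G\times G)$ such that $\int f\,d(\mu\times\nu)=\iint f(s,t)\,d\mu(s)\,d\nu(t)$ for all $f\in C_{00}(G\times G)$. Let $p:G\times G\to G$, $p(s,t)=st$. One says $\mu*\nu$ exists if $p^{-1}(A)\in\mathcal E_{\mu\times\nu}$ for every $A\in\mathfrak S(G)$; in that case $\mu*\nu\in\mathcal M(G)$ is defined by $(\mu*\nu)(A)=(\mu\times\nu)_e(p^{-1}(A))$. ``Well-defined operation on $\mathcal M(G,\omega)$'' means that $\mu*\nu$ exists and belongs to $\mathcal M(G,\omega)$ for all $\mu,\nu\in\mathcal M(G,\omega)$. *)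

theory Defs
  imports "HOL-Analysis.Analysis"
begin

section \<open>Complex measures on delta-rings\<close>

text \<open>
  A complex measure on a delta-ring \<open>R\<close> of sets is represented by a total set function that is 0
  outside \<open>R\<close>, so that equality of measures is equality of functions.
\<close>

definition complex_measure_on :: "'a set set \<Rightarrow> ('a set \<Rightarrow> complex) \<Rightarrow> bool" where
  "complex_measure_on R \<mu> \<longleftrightarrow>
     (\<forall>A. A \<notin> R \<longrightarrow> \<mu> A = 0) \<and>
     (\<forall>F::nat \<Rightarrow> 'a set. range F \<subseteq> R \<and> disjoint_family F \<and> (\<Union>n. F n) \<in> R
        \<longrightarrow> (\<lambda>n. \<mu> (F n)) sums \<mu> (\<Union>n. F n))"

definition total_var :: "'a set set \<Rightarrow> ('a set \<Rightarrow> complex) \<Rightarrow> 'a set \<Rightarrow> ennreal" where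
  "total_var R \<mu> A =
     (SUP P\<in>{P. finite P \<and> disjoint P \<and> P \<subseteq> R \<and> \<Union>P = A}. \<Sum>B\<in>P. ennreal (norm (\<mu> B)))"

text \<open>The completed total variation measure on the sigma-algebra of the members of \<open>R\<close> inside \<open>A\<close>.\<close>

definition var_measure :: "'a set set \<Rightarrow> ('a set \<Rightarrow> complex) \<Rightarrow> 'a set \<Rightarrow> 'a measure" where
  "var_measure R \<mu> A = completion (measure_of A {B \<in> R. B \<subseteq> A} (total_var R \<mu>))"

text \<open>
  The upper variation of a real set function, i.e. the positive part of its Jordan decomposition
  (negative values are sent to 0 by \<open>ennreal\<close>); the negative part is the upper variation of the
  negated set function.
\<close>

definition upper_var :: "'a set set \<Rightarrow> ('a set \<Rightarrow> real) \<Rightarrow> 'a set \<Rightarrow> ennreal" where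
  "upper_var R \<nu> B = (SUP C\<in>{C \<in> R. C \<subseteq> B}. ennreal (\<nu> C))"

definition upper_measure :: "'a set set \<Rightarrow> ('a set \<Rightarrow> real) \<Rightarrow> 'a set \<Rightarrow> 'a measure" where
  "upper_measure R \<nu> A = completion (measure_of A {B \<in> R. B \<subseteq> A} (upper_var R \<nu>))"

text \<open>
  The integral over a single \<open>A \<in> R\<close> against the complex measure on \<open>{B \<in> R. B \<subseteq> A}\<close> obtained by
  restricting \<open>\<mu>\<close>.
\<close>

definition integral_on ::
    "'a set set \<Rightarrow> ('a set \<Rightarrow> complex) \<Rightarrow> 'a set \<Rightarrow> ('a \<Rightarrow> complex) \<Rightarrow> complex" where
  "integral_on R \<mu> A f =
     (\<integral>x. f x \<partial>upper_measure R (\<lambda>B. Re (\<mu> B)) A) - (\<integral>x. f x \<partial>upper_measure R (\<lambda>B. - Re (\<mu> B)) A)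
     + \<i> * ((\<integral>x. f x \<partial>upper_measure R (\<lambda>B. Im (\<mu> B)) A)
            - (\<integral>x. f x \<partial>upper_measure R (\<lambda>B. - Im (\<mu> B)) A))"

definition locally_measurable ::
    "'a set set \<Rightarrow> ('a set \<Rightarrow> complex) \<Rightarrow> ('a \<Rightarrow> complex) \<Rightarrow> bool" where
  "locally_measurable R \<mu> f \<longleftrightarrow> (\<forall>A\<in>R. f \<in> borel_measurable (var_measure R \<mu> A))"

definition carried_by :: "'a set set \<Rightarrow> (nat \<Rightarrow> 'a set) \<Rightarrow> ('a \<Rightarrow> complex) \<Rightarrow> bool" where
  "carried_by R A f \<longleftrightarrow> incseq A \<and> range A \<subseteq> R \<and> (\<forall>x. x \<notin> (\<Union>n. A n) \<longrightarrow> f x = 0)"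

definition L1 :: "'a set set \<Rightarrow> ('a set \<Rightarrow> complex) \<Rightarrow> ('a \<Rightarrow> complex) set" where
  "L1 R \<mu> = {f. locally_measurable R \<mu> f \<and>
     (\<exists>A. carried_by R A f \<and>
        (\<exists>c<\<infinity>. (\<lambda>n. \<integral>\<^sup>+x. ennreal (norm (f x)) \<partial>var_measure R \<mu> (A n)) \<longlonglongrightarrow> c))}"

text \<open>For \<open>f \<in> L1 R \<mu>\<close> the limit exists and is the same for every sequence carrying \<open>f\<close>.\<close>

definition dr_integral :: "'a set set \<Rightarrow> ('a set \<Rightarrow> complex) \<Rightarrow> ('a \<Rightarrow> complex) \<Rightarrow> complex" where
  "dr_integral R \<mu> f =
     (THE I. \<exists>A. carried_by R A f \<and> (\<lambda>n. integral_on R \<mu> (A n) f) \<longlonglongrightarrow> I)"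


section \<open>Regular compacted-Borel measures\<close>

text \<open>
  \<open>borel\<close> on a product type is the Borel sigma-algebra of the product topology, which may be larger
  than the product of the Borel sigma-algebras.
\<close>

definition cborel :: "'a::topological_space set set" where
  "cborel = {A \<in> sets borel. compact (closure A)}"

definition regular_measures :: "('a::topological_space set \<Rightarrow> complex) set" where
  "regular_measures = {\<mu>. complex_measure_on cborel \<mu> \<and>
     (\<forall>A\<in>cborel. total_var cborel \<mu> A
        = (SUP C\<in>{C. C \<subseteq> A \<and> compact C}. total_var cborel \<mu> C))}"

definition total_mass :: "('a::topological_space set \<Rightarrow> complex) \<Rightarrow> ennreal" where
  "total_mass \<mu> = (SUP A\<in>cborel. total_var cborel \<mu> A)"

definition bounded_regular_measures :: "('a::topological_space set \<Rightarrow> complex) set" where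
  "bounded_regular_measures = {\<mu> \<in> regular_measures. total_mass \<mu> < \<infinity>}"

definition fun_times_measure ::
    "('a::topological_space \<Rightarrow> complex) \<Rightarrow> ('a set \<Rightarrow> complex) \<Rightarrow> 'a set \<Rightarrow> complex" where
  "fun_times_measure h \<nu> A =
     (if A \<in> cborel then dr_integral cborel \<nu> (\<lambda>x. h x * indicator A x) else 0)"

subsection \<open>Maximal regular extension\<close>

definition ext_ring :: "('a::topological_space set \<Rightarrow> complex) \<Rightarrow> 'a set set" where
  "ext_ring \<sigma> = {A \<in> sets borel. \<exists>U. open U \<and> A \<subseteq> U \<and>
     (SUP A'\<in>{A' \<in> cborel. A' \<subseteq> U}. total_var cborel \<sigma> A') < \<infinity>}"

text \<open>The filter of tails of the upward directed set of compact subsets of \<open>A\<close>.\<close>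

definition compact_subsets_at_top :: "'a::topological_space set \<Rightarrow> 'a set filter" where
  "compact_subsets_at_top A =
     (INF C\<in>{C. compact C \<and> C \<subseteq> A}. principal {D. compact D \<and> C \<subseteq> D \<and> D \<subseteq> A})"

definition ext_measure :: "('a::topological_space set \<Rightarrow> complex) \<Rightarrow> 'a set \<Rightarrow> complex" where
  "ext_measure \<sigma> A = (if A \<in> ext_ring \<sigma> then Lim (compact_subsets_at_top A) \<sigma> else 0)"


section \<open>Product measure and convolution\<close>

definition C00 :: "('a::topological_space \<Rightarrow> complex) set" where
  "C00 = {f. continuous_on UNIV f \<and> compact (closure {x. f x \<noteq> 0})}"

definition prod_meas ::
    "('a::topological_space set \<Rightarrow> complex) \<Rightarrow> ('b::topological_space set \<Rightarrow> complex)
      \<Rightarrow> ('a \<times> 'b) set \<Rightarrow> complex" where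
  "prod_meas \<mu> \<nu> = (THE \<sigma>. \<sigma> \<in> regular_measures \<and>
     (\<forall>f\<in>C00. dr_integral cborel \<sigma> f
        = dr_integral cborel \<nu> (\<lambda>t. dr_integral cborel \<mu> (\<lambda>s. f (s, t)))))"

text \<open>
  The group is written additively, because the library's class of topological groups is; the class
  does not include commutativity, so \<open>s + t\<close> is the product of \<open>s\<close> and \<open>t\<close> in an arbitrary group.
\<close>

definition group_op :: "'a::group_add \<times> 'a \<Rightarrow> 'a" where
  "group_op = (\<lambda>(s, t). s + t)"

definition conv_exists ::
    "('a::topological_group_add set \<Rightarrow> complex) \<Rightarrow> ('a set \<Rightarrow> complex) \<Rightarrow> bool" where
  "conv_exists \<mu> \<nu> \<longleftrightarrow> (\<forall>A\<in>cborel. group_op -` A \<in> ext_ring (prod_meas \<mu> \<nu>))"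

definition conv ::
    "('a::topological_group_add set \<Rightarrow> complex) \<Rightarrow> ('a set \<Rightarrow> complex) \<Rightarrow> 'a set \<Rightarrow> complex" where
  "conv \<mu> \<nu> A = (if A \<in> cborel then ext_measure (prod_meas \<mu> \<nu>) (group_op -` A) else 0)"


section \<open>Weights\<close>

definition continuous_weight :: "('a::topological_group_add \<Rightarrow> real) \<Rightarrow> bool" where
  "continuous_weight \<omega> \<longleftrightarrow> continuous_on UNIV \<omega> \<and> (\<forall>s. 0 < \<omega> s) \<and>
     (\<forall>s t. \<omega> (s + t) \<le> \<omega> s * \<omega> t) \<and> \<omega> 0 = 1"

definition C0 :: "('a::topological_space \<Rightarrow> complex) set" where
  "C0 = {f. continuous_on UNIV f \<and> (\<forall>e>0. compact {x. e \<le> norm (f x)})}"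

definition C0_weighted :: "('a::topological_space \<Rightarrow> real) \<Rightarrow> ('a \<Rightarrow> complex) set" where
  "C0_weighted \<omega> = {\<psi>. (\<lambda>x. \<psi> x / of_real (\<omega> x)) \<in> C0}"

definition M_weighted :: "('a::topological_space \<Rightarrow> real) \<Rightarrow> ('a set \<Rightarrow> complex) set" where
  "M_weighted \<omega> = {\<nu> \<in> regular_measures.
     fun_times_measure (\<lambda>x. of_real (\<omega> x)) \<nu> \<in> bounded_regular_measures}"

definition norm_weighted :: "('a::topological_space \<Rightarrow> real) \<Rightarrow> ('a set \<Rightarrow> complex) \<Rightarrow> real" where
  "norm_weighted \<omega> \<nu> = enn2real (total_mass (fun_times_measure (\<lambda>x. of_real (\<omega> x)) \<nu>))"

definition pairing :: "('a::topological_space set \<Rightarrow> complex) \<Rightarrow> ('a \<Rightarrow> complex) \<Rightarrow> complex" where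
  "pairing \<nu> \<psi> = dr_integral cborel \<nu> \<psi>"


section \<open>Banach spaces of complex functions on a carrier\<close>

definition banach_space_on :: "('b \<Rightarrow> complex) set \<Rightarrow> (('b \<Rightarrow> complex) \<Rightarrow> real) \<Rightarrow> bool" where
  "banach_space_on V N \<longleftrightarrow>
     (\<lambda>_. 0) \<in> V \<and>
     (\<forall>f\<in>V. \<forall>g\<in>V. (\<lambda>x. f x + g x) \<in> V \<and> N (\<lambda>x. f x + g x) \<le> N f + N g) \<and>
     (\<forall>c. \<forall>f\<in>V. (\<lambda>x. c * f x) \<in> V \<and> N (\<lambda>x. c * f x) = norm c * N f) \<and>
     (\<forall>f\<in>V. 0 \<le> N f \<and> (N f = 0 \<longrightarrow> f = (\<lambda>_. 0))) \<and>
     (\<forall>F::nat \<Rightarrow> 'b \<Rightarrow> complex. range F \<subseteq> V \<and>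
        (\<forall>e>0. \<exists>k. \<forall>m\<ge>k. \<forall>n\<ge>k. N (\<lambda>x. F m x - F n x) < e)
        \<longrightarrow> (\<exists>f\<in>V. (\<lambda>n. N (\<lambda>x. F n x - f x)) \<longlonglongrightarrow> 0))"

definition bilinear_on ::
    "('b \<Rightarrow> complex) set \<Rightarrow> (('b \<Rightarrow> complex) \<Rightarrow> ('b \<Rightarrow> complex) \<Rightarrow> 'b \<Rightarrow> complex) \<Rightarrow> bool" where
  "bilinear_on V m \<longleftrightarrow> (\<forall>f\<in>V. \<forall>g\<in>V. \<forall>h\<in>V. \<forall>c.
     m (\<lambda>x. f x + g x) h = (\<lambda>x. m f h x + m g h x) \<and>
     m f (\<lambda>x. g x + h x) = (\<lambda>x. m f g x + m f h x) \<and>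
     m (\<lambda>x. c * f x) g = (\<lambda>x. c * m f g x) \<and>
     m f (\<lambda>x. c * g x) = (\<lambda>x. c * m f g x))"

end

theory Submission
  imports Defs
begin

text \<open>
  Every measure of \<open>M_weighted \<omega>\<close> has the form \<open>h \<cdot> M\<close> with \<open>M\<close> a finite measure on the Borel sets that
  is inner regular on compact sets, and \<open>\<integral> \<omega> |h| dM\<close> finite; total variations, integrals and the
  weighted norm are then read off the density \<open>h\<close>. Completeness is completeness of \<open>L\<^sup>1\<close> of a measure
  dominating the members of a Cauchy sequence. The product measure of two such \<open>M\<close> and \<open>N\<close> is
  \<open>E \<mapsto> \<integral> M(E\<^sub>t) dN(t)\<close>: for open \<open>E\<close> the integrand is lower semicontinuous, and inner regularity exhausts \<open>E\<close>
  up to a null set by countably many rectangles, which yields regularity and independence of the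
  order of integration without any countability assumption on the group. Submultiplicativity gives
  \<open>\<integral> \<omega>(st) |h(s) k(t)| \<le> \<parallel>h\<parallel> \<parallel>k\<parallel>\<close>, so that \<open>\<mu> * \<nu>\<close> is the image of the product
  measure under the group operation, and associativity is associativity of the operation inside an
  iterated integral.
\<close>

section \<open>Densities on rings of Borel sets\<close>

text \<open>Several obstacles shape the proof. A member of \<open>M_weighted\<close> may have
  infinite total variation and has no values on most Borel sets; multiplying by the weight makes it
  bounded, a bounded measure extends to all Borel sets, and the weight is divided out of the density
  afterwards. The Borel sigma-algebra of a product topology may exceed the product sigma-algebra, so
  a Fubini theorem for the former has to be built from open sets. The integral and the product
  measure are definite descriptions: \<open>dr_integral\<close> needs a limit that is the same for
  all carrying sequences, and \<open>prod_meas\<close> needs that a regular measure is determined by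
  its integrals over \<open>C00\<close>. Local compactness enters in the latter, through functions
  of compact support, and again when a compact set is put into an open set of compact closure to
  show that the convolution exists. Finally, membership in \<open>L1\<close> asks for a sequence of
  sets from the delta-ring off which the function vanishes. The group need not be sigma-compact; the
  sequence comes from the measures, each finite inner regular one being concentrated on countably
  many compact sets.\<close>

definition borel_ring :: "'a::topological_space set set \<Rightarrow> bool" where
  "borel_ring R \<longleftrightarrow> R \<subseteq> sets borel \<and> {} \<in> R \<and>
     (\<forall>A\<in>R. \<forall>B\<in>sets borel. B \<subseteq> A \<longrightarrow> B \<in> R) \<and> (\<forall>A\<in>R. \<forall>B\<in>R. A \<union> B \<in> R)"

text \<open>Tied to one set \<open>A\<close>, because \<open>density_on_exists\<close> yields a pair
  \<open>M\<close>, \<open>h\<close> for each member of the ring separately; only measures such as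
  \<open>meas M h\<close> come with one pair for all members. The rings in question are
  \<open>cborel\<close>, the rings \<open>ext_ring\<close> of such measures, and the Borel
  sigma-algebra itself.\<close>

definition density_on ::
    "('a::topological_space set \<Rightarrow> complex) \<Rightarrow> 'a set \<Rightarrow> 'a measure \<Rightarrow> ('a \<Rightarrow> complex) \<Rightarrow> bool" where
  "density_on \<mu> A M h \<longleftrightarrow> sets M = sets borel \<and> h \<in> borel_measurable borel \<and> set_integrable M A h \<and>
     (\<forall>B\<in>sets borel. B \<subseteq> A \<longrightarrow> \<mu> B = (LINT x:B|M. h x))"

lemma borel_ring_sets: "borel_ring R \<Longrightarrow> A \<in> R \<Longrightarrow> A \<in> sets borel"
  by (auto simp: borel_ring_def)

lemma borel_ring_subset: "borel_ring R \<Longrightarrow> A \<in> R \<Longrightarrow> B \<in> sets borel \<Longrightarrow> B \<subseteq> A \<Longrightarrow> B \<in> R"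
  by (auto simp: borel_ring_def)

lemma borel_ring_Un: "borel_ring R \<Longrightarrow> A \<in> R \<Longrightarrow> B \<in> R \<Longrightarrow> A \<union> B \<in> R"
  by (auto simp: borel_ring_def)

lemma borel_ring_Int: "borel_ring R \<Longrightarrow> A \<in> R \<Longrightarrow> B \<in> sets borel \<Longrightarrow> A \<inter> B \<in> R"
  using borel_ring_subset[of R A "A \<inter> B"] borel_ring_sets[of R A] by auto

lemma borel_ring_Diff: "borel_ring R \<Longrightarrow> A \<in> R \<Longrightarrow> B \<in> sets borel \<Longrightarrow> A - B \<in> R"
  using borel_ring_subset[of R A "A - B"] borel_ring_sets[of R A] by auto

lemma density_on_subset:
  assumes "density_on \<mu> A M h" "B \<in> sets borel" "B \<subseteq> A"
  shows "density_on \<mu> B M h"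
  using assms set_integrable_subset[of M A h B] by (auto simp: density_on_def)

text \<open>Since \<open>R\<close> contains every Borel subset of \<open>A\<close>, the trace on
  which \<open>measure_of\<close> is taken is the full Borel trace. This turns the measures behind
  \<open>var_measure\<close> and \<open>upper_measure\<close> into restrictions of ordinary Borel
  measures.\<close>

lemma measure_of_trace:
  assumes R: "borel_ring R" "A \<in> R" and N: "sets N = sets borel"
    and eq: "\<And>B. B \<in> sets borel \<Longrightarrow> B \<subseteq> A \<Longrightarrow> \<mu> B = emeasure N B"
  shows "measure_of A {B \<in> R. B \<subseteq> A} \<mu> = restrict_space N A"
proof -
  have A: "A \<in> sets borel" using R by (rule borel_ring_sets)
  have s: "{B \<in> R. B \<subseteq> A} = {B \<in> sets borel. B \<subseteq> A}"
    using R by (auto simp: borel_ring_def)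
  have s2: "{B \<in> sets borel. B \<subseteq> A} = sets (restrict_space N A)"
    using A by (auto simp: sets_restrict_space_iff N sets_restrict_space image_iff)
  have sp: "space (restrict_space N A) = A"
    using A sets_eq_imp_space_eq[OF N] by (simp add: space_restrict_space)
  have "measure_of A {B \<in> R. B \<subseteq> A} \<mu> = measure_of A (sets (restrict_space N A)) (emeasure (restrict_space N A))"
    unfolding s s2
  proof (rule measure_of_eq)
    show "sets (restrict_space N A) \<subseteq> Pow A" using s2 by auto
    fix B assume "B \<in> sigma_sets A (sets (restrict_space N A))"
    then have "B \<in> sets (restrict_space N A)" using sets.sigma_sets_eq[of "restrict_space N A"] sp by simp
    then have "B \<in> sets borel" "B \<subseteq> A" using s2 by auto
    then show "\<mu> B = emeasure (restrict_space N A) B"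
      using A N eq by (simp add: emeasure_restrict_space sets_eq_imp_space_eq[OF N])
  qed
  then show ?thesis using measure_of_of_measure[of "restrict_space N A"] sp by simp
qed

text \<open>The supremum is attained at \<open>P\<close>, the part of \<open>B\<close> where
  \<open>g\<close> is nonnegative: a competing subset can only lose, by meeting the negative part or
  by missing some of \<open>P\<close>.\<close>

lemma upper_var_density:
  fixes g :: "'a::topological_space \<Rightarrow> real"
  assumes R: "borel_ring R" "A \<in> R" and M: "sets M = sets borel" and g[measurable]: "g \<in> borel_measurable borel"
    and int: "set_integrable M A g"
    and eq: "\<And>B. B \<in> sets borel \<Longrightarrow> B \<subseteq> A \<Longrightarrow> \<nu> B = (LINT x:B|M. g x)"
    and B[measurable]: "B \<in> sets borel" and BA: "B \<subseteq> A"
  shows "upper_var R \<nu> B = emeasure (density M (\<lambda>x. ennreal (g x))) B"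
proof -
  note [measurable_cong] = M
  have A[measurable]: "A \<in> sets borel" using R by (rule borel_ring_sets)
  define P where "P = B \<inter> {x. 0 \<le> g x}"
  have P[measurable]: "P \<in> sets borel" unfolding P_def by measurable
  have PB: "P \<subseteq> B" by (auto simp: P_def)
  have intC: "set_integrable M C g" if "C \<in> sets borel" "C \<subseteq> A" for C
    using that int M by (auto intro: set_integrable_subset)
  have PR: "P \<in> R" using R P PB BA by (blast intro: borel_ring_subset)
  have nn: "emeasure (density M (\<lambda>x. ennreal (g x))) B = ennreal (\<nu> P)"
  proof -
    have "emeasure (density M (\<lambda>x. ennreal (g x))) B = (\<integral>\<^sup>+x. ennreal (g x) * indicator B x \<partial>M)"
      by (subst emeasure_density) (auto simp: M)
    also have "\<dots> = (\<integral>\<^sup>+x. ennreal (indicator P x *\<^sub>R g x) \<partial>M)"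
      by (intro nn_integral_cong) (auto simp: P_def indicator_def ennreal_neg)
    also have "\<dots> = ennreal (LINT x:P|M. g x)"
      unfolding set_lebesgue_integral_def
      using intC[of P] P PB BA by (intro nn_integral_eq_integral) (auto simp: set_integrable_def P_def indicator_def)
    finally show ?thesis using eq[of P] P PB BA by auto
  qed
  show ?thesis unfolding upper_var_def nn
  proof (intro antisym SUP_least)
    fix C assume C: "C \<in> {C \<in> R. C \<subseteq> B}"
    then have Cm: "C \<in> sets borel" "C \<subseteq> A" using R BA by (auto dest: borel_ring_sets)
    have "(LINT x:C|M. g x) \<le> (LINT x:P|M. g x)"
      unfolding set_lebesgue_integral_def
      using intC[of P] intC[OF Cm] P PB BA C
      by (intro integral_mono) (auto simp: set_integrable_def P_def indicator_def)
    then show "ennreal (\<nu> C) \<le> ennreal (\<nu> P)"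
      using eq[OF Cm] eq[of P] P PB BA by (simp add: ennreal_leI)
  next
    show "ennreal (\<nu> P) \<le> (SUP C\<in>{C \<in> R. C \<subseteq> B}. ennreal (\<nu> C))"
      by (rule SUP_upper) (use PR PB in auto)
  qed
qed

lemma integral_upper_measure:
  fixes g :: "'a::topological_space \<Rightarrow> real" and f :: "'a \<Rightarrow> complex"
  assumes R: "borel_ring R" "A \<in> R" and M: "sets M = sets borel" and g[measurable]: "g \<in> borel_measurable borel"
    and int: "set_integrable M A g"
    and eq: "\<And>B. B \<in> sets borel \<Longrightarrow> B \<subseteq> A \<Longrightarrow> \<nu> B = (LINT x:B|M. g x)"
    and f[measurable]: "f \<in> borel_measurable borel"
  shows "(\<integral>x. f x \<partial>upper_measure R \<nu> A) = (\<integral>x. max 0 (g x) *\<^sub>R (indicator A x *\<^sub>R f x) \<partial>M)"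
proof -
  note [measurable_cong] = M
  have A[measurable]: "A \<in> sets borel" using R by (rule borel_ring_sets)
  let ?N = "density M (\<lambda>x. ennreal (g x))"
  have N: "?N = density M (\<lambda>x. ennreal (max 0 (g x)))"
    by (rule density_cong) (auto simp: max_def ennreal_neg)
  have sp: "space M = UNIV" using sets_eq_imp_space_eq[OF M] by simp
  have "measure_of A {B \<in> R. B \<subseteq> A} (upper_var R \<nu>) = restrict_space ?N A"
    by (rule measure_of_trace[OF R]) (use upper_var_density[OF R M g int eq] M in auto)
  then have "(\<integral>x. f x \<partial>upper_measure R \<nu> A) = (\<integral>x. f x \<partial>restrict_space ?N A)"
    unfolding upper_measure_def by (simp add: integral_completion measurable_restrict_space1)
  also have "\<dots> = (\<integral>x. indicator A x *\<^sub>R f x \<partial>?N)"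
    by (rule integral_restrict_space) (simp add: sp M)
  also have "\<dots> = (\<integral>x. max 0 (g x) *\<^sub>R (indicator A x *\<^sub>R f x) \<partial>M)"
    unfolding N by (rule integral_density) (auto simp: M)
  finally show ?thesis .
qed

text \<open>The four upper measures in \<open>integral_on\<close> have the positive and negative
  parts of the real and imaginary part of \<open>h\<close> as densities, each dominated by the
  modulus of \<open>h\<close>; \<open>max 0 r - max 0 (- r) = r\<close> reassembles
  \<open>h\<close>.\<close>

lemma integral_on_density:
  assumes R: "borel_ring R" "A \<in> R" and d: "density_on \<mu> A M h"
    and f[measurable]: "f \<in> borel_measurable borel"
    and int: "set_integrable M A (\<lambda>x. f x * h x)"
  shows "integral_on R \<mu> A f = (LINT x:A|M. f x * h x)"
proof -
  have M[measurable_cong]: "sets M = sets borel" and h[measurable]: "h \<in> borel_measurable borel"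
    and hint: "set_integrable M A h"
    and eq: "\<And>B. B \<in> sets borel \<Longrightarrow> B \<subseteq> A \<Longrightarrow> \<mu> B = (LINT x:B|M. h x)"
    using d by (auto simp: density_on_def)
  have A[measurable]: "A \<in> sets borel" using R by (rule borel_ring_sets)
  have hB: "set_integrable M B h" if "B \<in> sets borel" "B \<subseteq> A" for B
    using that hint M by (auto intro: set_integrable_subset)
  have re: "set_integrable M B (\<lambda>x. Re (h x))" "Re (LINT x:B|M. h x) = (LINT x:B|M. Re (h x))"
     "set_integrable M B (\<lambda>x. Im (h x))" "Im (LINT x:B|M. h x) = (LINT x:B|M. Im (h x))"
    if "B \<in> sets borel" "B \<subseteq> A" for B
  proof -
    note i = hB[OF that, unfolded set_integrable_def]
    show "set_integrable M B (\<lambda>x. Re (h x))" "Re (LINT x:B|M. h x) = (LINT x:B|M. Re (h x))"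
     "set_integrable M B (\<lambda>x. Im (h x))" "Im (LINT x:B|M. h x) = (LINT x:B|M. Im (h x))"
      using integrable_Re[OF i] integrable_Im[OF i] integral_Re[OF i] integral_Im[OF i]
      by (simp_all add: set_integrable_def set_lebesgue_integral_def)
  qed
  note reA = re[OF A order_refl]
  define F where "F g x = max 0 (g x) *\<^sub>R (indicator A x *\<^sub>R f x)" for g :: "'a \<Rightarrow> real" and x
  have Fint: "integrable M (F g)" if [measurable]: "g \<in> borel_measurable borel"
    and "\<And>x. \<bar>g x\<bar> \<le> norm (h x)" for g
    using int unfolding set_integrable_def
  proof (rule Bochner_Integration.integrable_bound)
    show "F g \<in> borel_measurable M" unfolding F_def by measurable
    show "AE x in M. norm (F g x) \<le> norm (indicator A x *\<^sub>R (f x * h x))"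
    proof (rule AE_I2)
      fix x
      have "\<bar>max 0 (g x)\<bar> \<le> norm (h x)" using that(2)[of x] by (auto simp: max_def)
      then show "norm (F g x) \<le> norm (indicator A x *\<^sub>R (f x * h x))"
        by (auto simp: F_def norm_mult indicator_def mult.commute intro: mult_left_mono)
    qed
  qed
  have "integral_on R \<mu> A f =
    (\<integral>x. F (\<lambda>x. Re (h x)) x \<partial>M) - (\<integral>x. F (\<lambda>x. - Re (h x)) x \<partial>M)
    + \<i> * ((\<integral>x. F (\<lambda>x. Im (h x)) x \<partial>M) - (\<integral>x. F (\<lambda>x. - Im (h x)) x \<partial>M))"
    unfolding integral_on_def F_def
    by (intro arg_cong2[where f="(+)"] arg_cong2[where f="(-)"] arg_cong2[where f="(*)"] refl
         integral_upper_measure[OF R M])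
       (use reA re eq in \<open>auto simp: set_integrable_def set_lebesgue_integral_def\<close>)
  also have "\<dots> = (\<integral>x. (F (\<lambda>x. Re (h x)) x - F (\<lambda>x. - Re (h x)) x)
      + \<i> * (F (\<lambda>x. Im (h x)) x - F (\<lambda>x. - Im (h x)) x) \<partial>M)"
  proof -
    have i: "integrable M (F (\<lambda>x. Re (h x)))" "integrable M (F (\<lambda>x. - Re (h x)))"
      "integrable M (F (\<lambda>x. Im (h x)))" "integrable M (F (\<lambda>x. - Im (h x)))"
      by (rule Fint; simp add: abs_Re_le_cmod abs_Im_le_cmod)+
    show ?thesis
      by (subst Bochner_Integration.integral_add, use i in \<open>auto\<close>)
  qed
  also have "\<dots> = (LINT x:A|M. f x * h x)"
    unfolding set_lebesgue_integral_def
  proof (rule Bochner_Integration.integral_cong[OF refl])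
    fix x
    have *: "max 0 r - max 0 (- r) = r" for r :: real by (auto simp: max_def)
    have "(F (\<lambda>x. Re (h x)) x - F (\<lambda>x. - Re (h x)) x)
      + \<i> * (F (\<lambda>x. Im (h x)) x - F (\<lambda>x. - Im (h x)) x) =
      of_real (indicator A x) * f x * (of_real (max 0 (Re (h x)) - max 0 (- Re (h x))) +
        \<i> * of_real (max 0 (Im (h x)) - max 0 (- Im (h x))))"
      by (simp add: F_def scaleR_conv_of_real algebra_simps)
    also have "\<dots> = of_real (indicator A x) * f x * h x"
      unfolding * by (simp flip: complex_eq)
    finally show "(F (\<lambda>x. Re (h x)) x - F (\<lambda>x. - Re (h x)) x)
      + \<i> * (F (\<lambda>x. Im (h x)) x - F (\<lambda>x. - Im (h x)) x) = indicator A x *\<^sub>R (f x * h x)"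
      by (simp add: scaleR_conv_of_real)
  qed
  finally show ?thesis .
qed

section \<open>Total variation of a measure with a density\<close>

lemma density_onD:
  assumes "density_on \<mu> A M h"
  shows "sets M = sets borel" "h \<in> borel_measurable borel" "set_integrable M A h"
    "\<And>B. B \<in> sets borel \<Longrightarrow> B \<subseteq> A \<Longrightarrow> \<mu> B = (LINT x:B|M. h x)"
  using assms by (auto simp: density_on_def)

text \<open>\<open>total_var\<close> ranges over sets of sets, whereas partitions arise below as
  indexed families. Passing to the image loses nothing: two indices with the same member must carry
  the empty set, whose value is 0.\<close>

lemma sum_norm_le_total_var:
  assumes R: "borel_ring R" and fin: "finite I" and C: "\<And>i. i \<in> I \<Longrightarrow> C i \<in> R"
    and disj: "disjoint_family_on C I" and un: "(\<Union>i\<in>I. C i) = A" and null: "\<mu> {} = 0"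
  shows "(\<Sum>i\<in>I. ennreal (norm (\<mu> (C i)))) \<le> total_var R \<mu> A"
proof -
  have "(\<Sum>B\<in>C ` I. ennreal (norm (\<mu> B))) = (\<Sum>i\<in>I. ennreal (norm (\<mu> (C i))))"
  proof (subst sum.reindex_nontrivial[OF fin])
    fix i j assume ij: "i \<in> I" "j \<in> I" "i \<noteq> j" "C i = C j"
    then have "C i = {}" using disj by (auto simp: disjoint_family_on_def)
    then show "ennreal (norm (\<mu> (C i))) = 0" using null by simp
  qed (simp add: o_def)
  moreover have "(\<Sum>B\<in>C ` I. ennreal (norm (\<mu> B))) \<le> total_var R \<mu> A"
    unfolding total_var_def
  proof (rule SUP_upper)
    have "disjoint (C ` I)" using disj unfolding disjoint_def disjoint_family_on_def by (metis imageE)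
    then show "C ` I \<in> {P. finite P \<and> disjoint P \<and> P \<subseteq> R \<and> \<Union>P = A}" using fin C un by auto
  qed
  ultimately show ?thesis by simp
qed

text \<open>The conjugate phase converts an integral against a density into one against its modulus;
  it is the extremal test function both for the total variation and for the norm of a
  convolution.\<close>

lemma cnj_sgn_mult: "cnj (sgn z) * z = complex_of_real (norm z)"
proof (cases "z = 0")
  case False
  have "cnj (sgn z) * z = (z * cnj z) / of_real (norm z)"
    by (simp add: sgn_div_norm scaleR_conv_of_real field_simps)
  also have "\<dots> = of_real (norm z)"
    using False by (simp add: complex_norm_square[symmetric] power2_eq_square)
  finally show ?thesis .
qed simp

lemma measurable_cnj_sgn:
  assumes "h \<in> borel_measurable M" shows "(\<lambda>x. cnj (sgn (h x)) :: complex) \<in> borel_measurable M"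
  using borel_measurable_continuous_on[of cnj "\<lambda>x. sgn (h x)" M] assms
  by (simp add: continuous_on_cnj sgn_div_norm)

text \<open>One inequality is the triangle inequality on each piece of a partition. For the other,
  the conjugate phase of \<open>h\<close> is a pointwise limit of simple functions of modulus at
  most 1; the level sets of such a function partition \<open>A\<close>, so its integral against
  \<open>h\<close> is bounded by the variation sum of that partition.\<close>

lemma total_var_density:
  assumes R: "borel_ring R" "A \<in> R" and d: "density_on \<mu> A M h"
  shows "total_var R \<mu> A = (\<integral>\<^sup>+x\<in>A. ennreal (norm (h x)) \<partial>M)"
proof (rule antisym)
  note M[measurable_cong] = density_onD(1)[OF d] and h[measurable] = density_onD(2)[OF d]
    and hint = density_onD(3)[OF d] and eq = density_onD(4)[OF d]
  have A[measurable]: "A \<in> sets borel" using R by (rule borel_ring_sets)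
  have hB: "set_integrable M B h" if "B \<in> sets borel" "B \<subseteq> A" for B
    using that hint M by (auto intro: set_integrable_subset)
  let ?N = "density M (\<lambda>x. ennreal (norm (h x)))"
  have N: "emeasure ?N B = (\<integral>\<^sup>+x\<in>B. ennreal (norm (h x)) \<partial>M)" if "B \<in> sets borel" for B
    by (subst emeasure_density) (use that M in auto)
  show "total_var R \<mu> A \<le> (\<integral>\<^sup>+x\<in>A. ennreal (norm (h x)) \<partial>M)"
    unfolding total_var_def
  proof (rule SUP_least)
    fix P assume "P \<in> {P. finite P \<and> disjoint P \<and> P \<subseteq> R \<and> \<Union>P = A}"
    then have P: "finite P" "disjoint P" "P \<subseteq> R" "\<Union>P = A" by auto
    have "(\<Sum>B\<in>P. ennreal (norm (\<mu> B))) \<le> (\<Sum>B\<in>P. emeasure ?N B)"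
    proof (rule sum_mono)
      fix B assume "B \<in> P"
      then have B: "B \<in> sets borel" "B \<subseteq> A" using P R by (auto intro: borel_ring_sets)
      have "ennreal (norm (\<mu> B)) \<le> (\<integral>\<^sup>+x. ennreal (norm (indicator B x *\<^sub>R h x)) \<partial>M)"
        using eq[OF B] hB[OF B] unfolding set_integrable_def set_lebesgue_integral_def
        by (simp add: integral_norm_bound_ennreal del: norm_scaleR)
      also have "\<dots> = emeasure ?N B"
        unfolding N[OF B(1)] by (intro nn_integral_cong) (auto simp: indicator_def)
      finally show "ennreal (norm (\<mu> B)) \<le> emeasure ?N B" .
    qed
    also have "\<dots> = emeasure ?N (\<Union>B\<in>P. B)"
    proof (rule sum_emeasure)
      show "(\<lambda>B. B) ` P \<subseteq> sets ?N" using P(3) R(1) M by (auto simp: borel_ring_def)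
      show "disjoint_family_on (\<lambda>B. B) P"
        using P(2) unfolding disjoint_def disjoint_family_on_def by blast
    qed (fact P(1))
    finally show "(\<Sum>B\<in>P. ennreal (norm (\<mu> B))) \<le> (\<integral>\<^sup>+x\<in>A. ennreal (norm (h x)) \<partial>M)"
      using P N[OF A] by simp
  qed
  define u where "u x = cnj (sgn (h x))" for x
  have u[measurable]: "u \<in> borel_measurable borel"
    unfolding u_def by (rule measurable_cnj_sgn[OF h])
  obtain s where s: "\<And>i. simple_function borel (s i)" "\<And>x. (\<lambda>i. s i x) \<longlonglongrightarrow> u x"
    using borel_measurable_implies_sequence_metric[OF u, of 0] by auto
  \<comment> \<open>The division enforces modulus at most 1 and leaves the limit unchanged, since
    \<open>u\<close> itself has modulus at most 1.\<close>
  define t where "t i x = s i x / of_real (max 1 (norm (s i x)))" for i x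
  have t1: "norm (t i x) \<le> 1" for i x
    by (simp add: t_def norm_divide divide_le_eq_1 max_def)
  have ts: "simple_function borel (t i)" for i
    unfolding t_def by (rule simple_function_compose1[OF s(1), of "\<lambda>z. z / of_real (max 1 (norm z))"])
  have tlim: "(\<lambda>i. t i x) \<longlonglongrightarrow> u x" for x
  proof -
    have "(\<lambda>i. t i x) \<longlonglongrightarrow> u x / of_real (max 1 (norm (u x)))"
      unfolding t_def by (intro tendsto_intros s) auto
    moreover have "max 1 (norm (u x)) = 1" by (simp add: u_def norm_sgn max_def)
    ultimately show ?thesis by simp
  qed
  have [measurable]: "t i \<in> borel_measurable borel" for i
    using ts by (rule borel_measurable_simple_function)
  have le: "ennreal (norm (LINT x:A|M. t i x * h x)) \<le> total_var R \<mu> A" for i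
  proof -
    define I where "I = range (t i)"
    have I: "finite I" using ts[of i] by (simp add: I_def simple_function_def)
    define C where "C c = A \<inter> {x. t i x = c}" for c
    have C: "C c \<in> sets borel" "C c \<subseteq> A" for c
      using simple_functionD(2)[OF ts, of i "{c}"] A by (auto simp: C_def vimage_def)
    have "(LINT x:A|M. t i x * h x) = (\<integral>x. (\<Sum>c\<in>I. c * (indicator (C c) x *\<^sub>R h x)) \<partial>M)"
      unfolding set_lebesgue_integral_def
    proof (rule Bochner_Integration.integral_cong[OF refl])
      fix x
      have "(\<Sum>c\<in>I. c * (indicator (C c) x *\<^sub>R h x)) = (\<Sum>c\<in>I. if c = t i x then c * (indicator A x *\<^sub>R h x) else 0)"
        by (intro sum.cong) (auto simp: C_def indicator_def)
      also have "\<dots> = t i x * (indicator A x *\<^sub>R h x)"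
        using I by (subst sum.delta) (auto simp: I_def)
      finally show "indicator A x *\<^sub>R (t i x * h x) = (\<Sum>c\<in>I. c * (indicator (C c) x *\<^sub>R h x))" by simp
    qed
    also have "\<dots> = (\<Sum>c\<in>I. \<integral>x. c * (indicator (C c) x *\<^sub>R h x) \<partial>M)"
      using hB[OF C]
      by (intro Bochner_Integration.integral_sum integrable_mult_right) (auto simp: set_integrable_def)
    also have "\<dots> = (\<Sum>c\<in>I. c * \<mu> (C c))"
      unfolding integral_mult_right_zero eq[OF C] set_lebesgue_integral_def ..
    finally have "norm (LINT x:A|M. t i x * h x) \<le> (\<Sum>c\<in>I. norm (c * \<mu> (C c)))"
      by (simp add: norm_sum)
    also have "\<dots> \<le> (\<Sum>c\<in>I. norm (\<mu> (C c)))"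
    proof (rule sum_mono)
      fix c assume "c \<in> I"
      then have "norm c \<le> 1" using t1 by (auto simp: I_def)
      then show "norm (c * \<mu> (C c)) \<le> norm (\<mu> (C c))"
        by (simp add: norm_mult mult_left_le_one_le)
    qed
    finally have "ennreal (norm (LINT x:A|M. t i x * h x)) \<le> (\<Sum>c\<in>I. ennreal (norm (\<mu> (C c))))"
      by (simp add: sum_ennreal ennreal_leI)
    also have "\<dots> \<le> total_var R \<mu> A"
    proof (rule sum_norm_le_total_var[OF R(1) I])
      show "C c \<in> R" for c using C[of c] R by (blast intro: borel_ring_subset)
      show "(\<Union>c\<in>I. C c) = A" by (auto simp: C_def I_def)
      show "disjoint_family_on C I" by (auto simp: C_def disjoint_family_on_def)
      show "\<mu> {} = 0" using eq[of "{}"] by (simp add: set_lebesgue_integral_def)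
    qed
    finally show ?thesis .
  qed
  have int: "(\<lambda>i. LINT x:A|M. t i x * h x) \<longlonglongrightarrow> (LINT x:A|M. u x * h x)"
    unfolding set_lebesgue_integral_def
  proof (rule integral_dominated_convergence[where w="\<lambda>x. norm (indicator A x *\<^sub>R h x)"])
    show "integrable M (\<lambda>x. norm (indicator A x *\<^sub>R h x))"
      using hint unfolding set_integrable_def by (rule integrable_norm)
    show "AE x in M. norm (indicator A x *\<^sub>R (t i x * h x)) \<le> norm (indicator A x *\<^sub>R h x)" for i
      using t1[of i] by (intro AE_I2) (auto simp: indicator_def norm_mult mult_left_le_one_le)
    show "AE x in M. (\<lambda>i. indicator A x *\<^sub>R (t i x * h x)) \<longlonglongrightarrow> indicator A x *\<^sub>R (u x * h x)"
      by (intro AE_I2 tendsto_intros tlim)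
  qed measurable
  have uh: "u x * h x = of_real (norm (h x))" for x by (simp add: u_def cnj_sgn_mult)
  have "norm (LINT x:A|M. u x * h x) = (LINT x:A|M. norm (h x))"
  proof -
    have "(LINT x:A|M. u x * h x) = of_real (LINT x:A|M. norm (h x))"
      unfolding uh set_lebesgue_integral_def scaleR_conv_of_real
      by (subst integral_complex_of_real[symmetric]) (simp)
    moreover have "0 \<le> (LINT x:A|M. norm (h x))"
      unfolding set_lebesgue_integral_def by (rule Bochner_Integration.integral_nonneg) auto
    ultimately show ?thesis by simp
  qed
  then have "ennreal (LINT x:A|M. norm (h x)) = ennreal (norm (LINT x:A|M. u x * h x))" by simp
  also have "\<dots> \<le> total_var R \<mu> A"
    by (rule LIMSEQ_le_const2[OF tendsto_ennrealI[OF tendsto_norm[OF int]]]) (use le in auto)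
  also have "ennreal (LINT x:A|M. norm (h x)) = (\<integral>\<^sup>+x. ennreal (norm (indicator A x *\<^sub>R h x)) \<partial>M)"
    unfolding set_lebesgue_integral_def
    using integrable_norm[OF hint[unfolded set_integrable_def]]
    by (subst nn_integral_eq_integral) auto
  also have "\<dots> = (\<integral>\<^sup>+x\<in>A. ennreal (norm (h x)) \<partial>M)"
    by (intro nn_integral_cong) (auto simp: indicator_def)
  finally show "(\<integral>\<^sup>+x\<in>A. ennreal (norm (h x)) \<partial>M) \<le> total_var R \<mu> A" .
qed

lemma var_measure_density:
  assumes R: "borel_ring R" "A \<in> R" and d: "density_on \<mu> A M h"
  shows "var_measure R \<mu> A = completion (restrict_space (density M (\<lambda>x. ennreal (norm (h x)))) A)"
proof -
  note M[measurable_cong] = density_onD(1)[OF d] and h[measurable] = density_onD(2)[OF d]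
  have "measure_of A {B \<in> R. B \<subseteq> A} (total_var R \<mu>) = restrict_space (density M (\<lambda>x. ennreal (norm (h x)))) A"
  proof (rule measure_of_trace[OF R])
    fix B :: "'a set" assume [measurable]: "B \<in> sets borel" and BA: "B \<subseteq> A"
    have "B \<in> R" using borel_ring_subset[OF R _ BA] by simp
    then show "total_var R \<mu> B = emeasure (density M (\<lambda>x. ennreal (norm (h x)))) B"
      using total_var_density[OF R(1) _ density_on_subset[OF d _ BA]]
      by (subst emeasure_density) (auto simp: M)
  qed (simp add: M)
  then show ?thesis by (simp add: var_measure_def)
qed

lemma nn_integral_var_measure:
  assumes R: "borel_ring R" "A \<in> R" and d: "density_on \<mu> A M h"
    and f[measurable]: "f \<in> borel_measurable borel"
  shows "(\<integral>\<^sup>+x. ennreal (norm (f x)) \<partial>var_measure R \<mu> A) = (\<integral>\<^sup>+x\<in>A. ennreal (norm (f x * h x)) \<partial>M)"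
proof -
  note M[measurable_cong] = density_onD(1)[OF d] and h[measurable] = density_onD(2)[OF d]
  have A[measurable]: "A \<in> sets borel" using R by (rule borel_ring_sets)
  have sp: "space M = UNIV" using sets_eq_imp_space_eq[OF M] by simp
  show ?thesis
    unfolding var_measure_density[OF R d] nn_integral_completion
    by (subst nn_integral_restrict_space)
       (auto simp: sp M nn_integral_density ennreal_mult norm_mult mult_ac intro!: nn_integral_cong)
qed

lemma locally_measurable_borel:
  assumes "borel_ring R" "\<And>A. A \<in> R \<Longrightarrow> density_on \<mu> A (M A) (h A)" "f \<in> borel_measurable borel"
  shows "locally_measurable R \<mu> f"
  unfolding locally_measurable_def
proof
  fix A assume A: "A \<in> R"
  have "f \<in> borel_measurable (restrict_space (density (M A) (\<lambda>x. ennreal (norm (h A x)))) A)"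
    using density_onD(1)[OF assms(2)[OF A]] assms(3)
    by (intro measurable_restrict_space1) (auto cong: measurable_cong_sets)
  then show "f \<in> borel_measurable (var_measure R \<mu> A)"
    unfolding var_measure_density[OF assms(1) A assms(2)[OF A]] by (rule measurable_completion)
qed

section \<open>Integrals along carrying sequences\<close>

lemma carried_integral_tendsto:
  fixes g :: "'a::topological_space \<Rightarrow> complex"
  assumes M: "sets M = sets borel" and g: "integrable M g" and A: "incseq A" "range A \<subseteq> sets borel"
    and z: "\<And>x. x \<notin> (\<Union>n. A n) \<Longrightarrow> g x = 0"
  shows "(\<lambda>n. LINT x:A n|M. g x) \<longlonglongrightarrow> (\<integral>x. g x \<partial>M)"
proof -
  have i: "set_integrable M (\<Union>n. A n) g"
    unfolding set_integrable_def using A M g by (intro integrable_mult_indicator) auto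
  have "(\<lambda>n. LINT x:A n|M. g x) \<longlonglongrightarrow> (LINT x:(\<Union>n. A n)|M. g x)"
    by (rule set_integral_cont_up[OF _ A(1) i]) (use A M in auto)
  also have "(LINT x:(\<Union>n. A n)|M. g x) = (\<integral>x. g x \<partial>M)"
    unfolding set_lebesgue_integral_def
    by (intro Bochner_Integration.integral_cong) (use z in \<open>auto simp: indicator_def\<close>)
  finally show ?thesis .
qed

lemma set_integrable_of_integrable:
  fixes g :: "'a::topological_space \<Rightarrow> complex"
  assumes "sets M = sets borel" "integrable M g" "A \<in> sets borel"
  shows "set_integrable M A g"
  unfolding set_integrable_def using assms by (intro integrable_mult_indicator) auto

text \<open>The limit does not mention the sequence \<open>A\<close>; this is the uniqueness that
  the definite description in \<open>dr_integral\<close> requires.\<close>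

lemma carried_integral_on_tendsto:
  assumes R: "borel_ring R" and d: "\<And>A. A \<in> R \<Longrightarrow> density_on \<mu> A M h"
    and f: "f \<in> borel_measurable borel" and c: "carried_by R A f"
    and int: "integrable M (\<lambda>x. f x * h x)"
  shows "(\<lambda>n. integral_on R \<mu> (A n) f) \<longlonglongrightarrow> (\<integral>x. f x * h x \<partial>M)"
proof -
  have AR: "A n \<in> R" for n using c by (auto simp: carried_by_def)
  note M = density_onD(1)[OF d[OF AR[of 0]]]
  have "integral_on R \<mu> (A n) f = (LINT x:A n|M. f x * h x)" for n
    using M int borel_ring_sets[OF R AR]
    by (intro integral_on_density[OF R AR d[OF AR] f] set_integrable_of_integrable) auto
  then show ?thesis
    using carried_integral_tendsto[OF M int, of A] c borel_ring_sets[OF R]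
    by (auto simp: carried_by_def)
qed

text \<open>The integrals over the sets \<open>A n\<close> increase to the integral of the modulus
  of \<open>f x * h x\<close> by monotone convergence, and integrability makes that limit
  finite.\<close>

lemma L1_density:
  assumes R: "borel_ring R" and d: "\<And>A. A \<in> R \<Longrightarrow> density_on \<mu> A M h"
    and f[measurable]: "f \<in> borel_measurable borel" and c: "carried_by R A f"
    and int: "integrable M (\<lambda>x. f x * h x)"
  shows "f \<in> L1 R \<mu>"
proof -
  have AR: "A n \<in> R" for n using c by (auto simp: carried_by_def)
  note M[measurable_cong] = density_onD(1)[OF d[OF AR[of 0]]]
    and h[measurable] = density_onD(2)[OF d[OF AR[of 0]]]
  have [measurable]: "A n \<in> sets borel" for n using borel_ring_sets[OF R AR] .
  let ?c = "\<integral>\<^sup>+x. ennreal (norm (f x * h x)) \<partial>M"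
  have "(\<integral>\<^sup>+x. ennreal (norm (f x)) \<partial>var_measure R \<mu> (A n)) = (\<integral>\<^sup>+x\<in>A n. ennreal (norm (f x * h x)) \<partial>M)" for n
    by (rule nn_integral_var_measure[OF R AR d[OF AR] f])
  moreover have "(\<lambda>n. \<integral>\<^sup>+x\<in>A n. ennreal (norm (f x * h x)) \<partial>M) \<longlonglongrightarrow> ?c"
  proof (rule nn_integral_LIMSEQ)
    have inc: "incseq A" using c by (simp add: carried_by_def)
    then show "mono (\<lambda>n x. ennreal (norm (f x * h x)) * indicator (A n) x)"
      by (auto simp: mono_def le_fun_def indicator_def)
    show "(\<lambda>n. ennreal (norm (f x * h x)) * indicator (A n) x) \<longlonglongrightarrow> ennreal (norm (f x * h x))" for x
    proof (cases "x \<in> (\<Union>n. A n)")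
      case True
      then obtain k where "x \<in> A k" by auto
      then have "\<forall>n\<ge>k. x \<in> A n" using inc by (auto simp: incseq_def)
      then show ?thesis
        by (intro tendsto_eventually) (auto simp: eventually_sequentially intro!: exI[of _ k])
    next
      case False
      then show ?thesis using c by (auto simp: carried_by_def)
    qed
  qed measurable
  moreover have "?c < \<infinity>" using int by (simp add: integrable_iff_bounded)
  ultimately have "\<exists>c<\<infinity>. (\<lambda>n. \<integral>\<^sup>+x. ennreal (norm (f x)) \<partial>var_measure R \<mu> (A n)) \<longlonglongrightarrow> c"
    by (intro exI[of _ ?c]) simp
  then show ?thesis
    unfolding L1_def using locally_measurable_borel[OF R d f] c by blast
qed

lemma dr_integral_density:
  assumes R: "borel_ring R" and d: "\<And>A. A \<in> R \<Longrightarrow> density_on \<mu> A M h"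
    and f: "f \<in> borel_measurable borel" and c: "carried_by R A f"
    and int: "integrable M (\<lambda>x. f x * h x)"
  shows "dr_integral R \<mu> f = (\<integral>x. f x * h x \<partial>M)"
  unfolding dr_integral_def
proof (rule the_equality)
  show "\<exists>A. carried_by R A f \<and> (\<lambda>n. integral_on R \<mu> (A n) f) \<longlonglongrightarrow> (\<integral>x. f x * h x \<partial>M)"
    using carried_integral_on_tendsto[OF R d f c int] c by blast
  fix I assume "\<exists>A. carried_by R A f \<and> (\<lambda>n. integral_on R \<mu> (A n) f) \<longlonglongrightarrow> I"
  then show "I = (\<integral>x. f x * h x \<partial>M)"
    using carried_integral_on_tendsto[OF R d f _ int] LIMSEQ_unique by blast
qed

lemma set_integrable_bounded_mult:
  assumes d: "density_on \<mu> A M h" and A[measurable]: "A \<in> sets borel"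
    and f[measurable]: "f \<in> borel_measurable borel" and b: "\<And>x. x \<in> A \<Longrightarrow> norm (f x) \<le> c"
  shows "set_integrable M A (\<lambda>x. f x * h x)"
  unfolding set_integrable_def
proof (rule Bochner_Integration.integrable_bound)
  note M[measurable_cong] = density_onD(1)[OF d] and h[measurable] = density_onD(2)[OF d]
  show "integrable M (\<lambda>x. c *\<^sub>R (indicator A x *\<^sub>R h x))"
    using density_onD(3)[OF d] unfolding set_integrable_def by (rule integrable_scaleR_right)
  show "AE x in M. norm (indicator A x *\<^sub>R (f x * h x)) \<le> norm (c *\<^sub>R (indicator A x *\<^sub>R h x))"
  proof (rule AE_I2)
    fix x
    show "norm (indicator A x *\<^sub>R (f x * h x)) \<le> norm (c *\<^sub>R (indicator A x *\<^sub>R h x))"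
      using b[of x] by (auto simp: indicator_def norm_mult intro: mult_right_mono)
  qed
  show "(\<lambda>x. indicator A x *\<^sub>R (f x * h x)) \<in> borel_measurable M" by measurable
qed

text \<open>Here no single density serves all members of \<open>R\<close>; the carrying sets are cut down to \<open>A\<close>.\<close>

lemma dr_integral_bounded:
  assumes R: "borel_ring R" and ex: "\<And>B. B \<in> R \<Longrightarrow> \<exists>M h. density_on \<mu> B M h"
    and A: "A \<in> R" and d: "density_on \<mu> A M h"
    and f[measurable]: "f \<in> borel_measurable borel" and b: "\<And>x. x \<in> A \<Longrightarrow> norm (f x) \<le> c"
    and z: "\<And>x. x \<notin> A \<Longrightarrow> f x = 0"
  shows "dr_integral R \<mu> f = (LINT x:A|M. f x * h x)"
proof -
  note M = density_onD(1)[OF d]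
  have Am: "A \<in> sets borel" using R A by (rule borel_ring_sets)
  have fi: "set_integrable M A (\<lambda>x. f x * h x)" by (rule set_integrable_bounded_mult[OF d Am f b])
  have step: "integral_on R \<mu> B f = (LINT x:A \<inter> B|M. f x * h x)" if B: "B \<in> R" for B
  proof -
    have Bm: "B \<in> sets borel" using R B by (rule borel_ring_sets)
    have AB: "A \<inter> B \<in> R" using borel_ring_Int[OF R A Bm] .
    obtain M' h' where d': "density_on \<mu> B M' h'" using ex[OF B] by blast
    have fi': "set_integrable M' B (\<lambda>x. f x * h' x)"
      by (rule set_integrable_bounded_mult[OF d' Bm f, of "max c 0"]) (metis b z max.cobounded1 max.cobounded2 norm_zero order_trans)
    have "integral_on R \<mu> B f = (LINT x:B|M'. f x * h' x)"
      by (rule integral_on_density[OF R B d' f fi'])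
    also have "\<dots> = (LINT x:A \<inter> B|M'. f x * h' x)"
      unfolding set_lebesgue_integral_def
      by (intro Bochner_Integration.integral_cong) (use z in \<open>auto simp: indicator_def\<close>)
    \<comment> \<open>\<open>integral_on\<close> depends on the measure only, so over
      \<open>A \<inter> B\<close> it is the bridge from the density \<open>h'\<close> on
      \<open>B\<close> to the density \<open>h\<close> on \<open>A\<close>.\<close>
    also have "\<dots> = integral_on R \<mu> (A \<inter> B) f"
      using density_on_subset[OF d', of "A \<inter> B"] fi' Am Bm density_onD(1)[OF d']
      by (intro integral_on_density[OF R AB _ f, symmetric]) (auto intro: set_integrable_subset)
    also have "\<dots> = (LINT x:A \<inter> B|M. f x * h x)"
      using density_on_subset[OF d, of "A \<inter> B"] fi Am Bm M
      by (intro integral_on_density[OF R AB _ f]) (auto intro: set_integrable_subset)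
    finally show ?thesis .
  qed
  have lim: "(\<lambda>n. integral_on R \<mu> (C n) f) \<longlonglongrightarrow> (LINT x:A|M. f x * h x)" if c: "carried_by R C f" for C
  proof -
    have "(\<lambda>n. LINT x:C n|M. indicator A x *\<^sub>R (f x * h x)) \<longlonglongrightarrow> (\<integral>x. indicator A x *\<^sub>R (f x * h x) \<partial>M)"
      by (rule carried_integral_tendsto[OF M])
         (use c fi borel_ring_sets[OF R] in \<open>auto simp: carried_by_def set_integrable_def indicator_def\<close>)
    moreover have "(LINT x:C n|M. indicator A x *\<^sub>R (f x * h x)) = integral_on R \<mu> (C n) f" for n
      using c unfolding set_lebesgue_integral_def
      by (subst step) (auto simp: carried_by_def set_lebesgue_integral_def indicator_def intro!: Bochner_Integration.integral_cong)
    ultimately show ?thesis by (simp add: set_lebesgue_integral_def)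
  qed
  have c: "carried_by R (\<lambda>_. A) f" using A z by (auto simp: carried_by_def incseq_def)
  show ?thesis
    unfolding dr_integral_def
  proof (rule the_equality)
    show "\<exists>C. carried_by R C f \<and> (\<lambda>n. integral_on R \<mu> (C n) f) \<longlonglongrightarrow> (LINT x:A|M. f x * h x)"
      using lim[OF c] c by blast
    fix I assume "\<exists>C. carried_by R C f \<and> (\<lambda>n. integral_on R \<mu> (C n) f) \<longlonglongrightarrow> I"
    then show "I = (LINT x:A|M. f x * h x)" using lim LIMSEQ_unique by blast
  qed
qed

section \<open>Hahn decomposition and existence of densities\<close>

definition sigma_additive :: "'a measure \<Rightarrow> ('a set \<Rightarrow> 'b::real_normed_vector) \<Rightarrow> bool" where
  "sigma_additive M \<nu> \<longleftrightarrow> (\<forall>F::nat \<Rightarrow> 'a set. range F \<subseteq> sets M \<and> disjoint_family F \<longrightarrow>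
     (\<lambda>n. \<nu> (F n)) sums \<nu> (\<Union>n. F n))"

lemma sigma_additiveD:
  "sigma_additive M \<nu> \<Longrightarrow> (\<And>n. F n \<in> sets M) \<Longrightarrow> disjoint_family F \<Longrightarrow> (\<lambda>n. \<nu> (F n)) sums \<nu> (\<Union>n::nat. F n)"
  by (auto simp: sigma_additive_def)

lemma sigma_additive_empty:
  assumes "sigma_additive M \<nu>" shows "\<nu> {} = 0"
proof -
  have "(\<lambda>n::nat. \<nu> {}) sums \<nu> (\<Union>n::nat. {})"
    using sigma_additiveD[OF assms, of "\<lambda>_. {}"] by (simp add: disjoint_family_on_def)
  then have "summable (\<lambda>n::nat. \<nu> {})" by (rule sums_summable)
  then show ?thesis by (simp add: summable_const_iff)
qed

lemma sigma_additive_Un: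
  assumes "sigma_additive M \<nu>" "A \<in> sets M" "B \<in> sets M" "A \<inter> B = {}"
  shows "\<nu> (A \<union> B) = \<nu> A + \<nu> B"
proof -
  have "(\<lambda>n. \<nu> (binaryset A B n)) sums \<nu> (\<Union>n. binaryset A B n)"
  proof (rule sigma_additiveD[OF assms(1)])
    show "binaryset A B n \<in> sets M" for n using assms by (simp add: binaryset_def)
    show "disjoint_family (binaryset A B)"
      using assms by (simp add: disjoint_family_on_def binaryset_def Int_commute)
  qed
  moreover have "(\<lambda>n. \<nu> (binaryset A B n)) sums (\<Sum>n\<in>{0,1::nat}. \<nu> (binaryset A B n))"
    by (rule sums_finite) (auto simp: binaryset_def sigma_additive_empty[OF assms(1)])
  ultimately have "\<nu> (\<Union>n. binaryset A B n) = (\<Sum>n\<in>{0,1::nat}. \<nu> (binaryset A B n))"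
    by (rule sums_unique2)
  then show ?thesis by (simp add: UN_binaryset_eq binaryset_def)
qed

lemma sigma_additive_Diff:
  assumes "sigma_additive M \<nu>" "A \<in> sets M" "B \<in> sets M" "B \<subseteq> A"
  shows "\<nu> (A - B) = \<nu> A - \<nu> B"
  using sigma_additive_Un[OF assms(1), of B "A - B"] assms by (auto simp: Un_absorb1)

definition positive_on :: "'a measure \<Rightarrow> ('a set \<Rightarrow> real) \<Rightarrow> 'a set \<Rightarrow> bool" where
  "positive_on M \<nu> P \<longleftrightarrow> P \<in> sets M \<and> (\<forall>B\<in>sets M. B \<subseteq> P \<longrightarrow> 0 \<le> \<nu> B)"

text \<open>Greedily remove sets whose (negative) value is within a factor 2 of the infimum.\<close>

lemma positive_subset:
  assumes \<nu>: "sigma_additive M \<nu>" and A: "A \<in> sets M"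
  shows "\<exists>P\<subseteq>A. positive_on M \<nu> P \<and> \<nu> A \<le> \<nu> P"
proof -
  note \<nu>0 = sigma_additive_empty[OF \<nu>]
  \<comment> \<open>If values at most -1 occur inside \<open>C\<close>, a set with such a value is
    taken, which also covers an infimum of minus infinity. Otherwise the infimum is finite, and a
    set below half of it is taken, or the empty set if the infimum is 0.\<close>
  have "\<exists>B\<in>sets M. B \<subseteq> C \<and> \<nu> B \<le> 0 \<and> (\<nu> B \<le> -1 \<or> (\<forall>D\<in>sets M. D \<subseteq> C \<longrightarrow> 2 * \<nu> B \<le> \<nu> D))" for C
  proof (cases "\<exists>D\<in>sets M. D \<subseteq> C \<and> \<nu> D \<le> -1")
    case True
    then obtain D where "D \<in> sets M" "D \<subseteq> C" "\<nu> D \<le> -1" by blast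
    then show ?thesis by (intro bexI[of _ D]) auto
  next
    case False
    define S where "S = \<nu> ` {D\<in>sets M. D \<subseteq> C}"
    have bdd: "bdd_below S" using False by (intro bdd_belowI[of _ "-1"]) (force simp: S_def)
    have 0: "0 \<in> S" using \<nu>0 by (force simp: S_def)
    show ?thesis
    proof (cases "Inf S < 0")
      case True
      then have "Inf S < Inf S / 2" by simp
      then obtain d where "d \<in> S" "d < Inf S / 2" using 0 cInf_lessD[of S] by blast
      then obtain D where D: "D \<in> sets M" "D \<subseteq> C" "\<nu> D < Inf S / 2" by (auto simp: S_def)
      moreover have "Inf S \<le> \<nu> E" if "E \<in> sets M" "E \<subseteq> C" for E
        using bdd that by (intro cInf_lower) (auto simp: S_def)
      ultimately show ?thesis using True by (intro bexI[of _ D]) (force simp: field_simps)+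
    next
      case False
      then have "0 \<le> \<nu> E" if "E \<in> sets M" "E \<subseteq> C" for E
        using cInf_lower[of "\<nu> E" S] bdd that by (auto simp: S_def)
      then show ?thesis using \<nu>0 by (intro bexI[of _ "{}"]) auto
    qed
  qed
  then obtain b where b: "\<And>C. b C \<in> sets M" "\<And>C. b C \<subseteq> C" "\<And>C. \<nu> (b C) \<le> 0"
     "\<And>C D. \<nu> (b C) \<le> -1 \<or> (D \<in> sets M \<longrightarrow> D \<subseteq> C \<longrightarrow> 2 * \<nu> (b C) \<le> \<nu> D)"
    by metis
  define C where "C = rec_nat A (\<lambda>_ C. C - b C)"
  have C: "C 0 = A" "C (Suc n) = C n - b (C n)" for n by (simp_all add: C_def)
  define B where "B n = b (C n)" for n
  have dec: "C n \<subseteq> C m" if "m \<le> n" for m n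
    using that by (rule lift_Suc_antimono_le[of C, rotated]) (auto simp: C)
  have disj: "disjoint_family B"
    unfolding disjoint_family_on_def
  proof (intro ballI impI)
    have "B m \<inter> B n = {}" if "m < n" for m n
    proof -
      have "B n \<subseteq> C (Suc m)" using b(2)[of "C n"] dec[of "Suc m" n] that by (auto simp: B_def)
      then show ?thesis by (auto simp: C B_def)
    qed
    then show "m \<noteq> n \<Longrightarrow> B m \<inter> B n = {}" for m n by (metis Int_commute linorder_neqE_nat)
  qed
  have Bm: "B n \<in> sets M" for n by (simp add: B_def b)
  have sums: "(\<lambda>n. \<nu> (B n)) sums \<nu> (\<Union>n. B n)" by (rule sigma_additiveD[OF \<nu> Bm disj])
  have BA: "(\<Union>n. B n) \<subseteq> A" using b(2) dec[of 0] C(1) by (force simp: B_def)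
  define P where "P = A - (\<Union>n. B n)"
  have Pm: "P \<in> sets M" unfolding P_def using A Bm by auto
  have "\<nu> (\<Union>n. B n) \<le> 0"
  proof -
    have "0 \<le> - \<nu> (\<Union>n. B n)"
      by (rule sums_le[OF _ sums_zero sums_minus[OF sums]]) (auto simp: B_def b)
    then show ?thesis by simp
  qed
  then have "\<nu> A \<le> \<nu> P" unfolding P_def using sigma_additive_Diff[OF \<nu> A _ BA] Bm by auto
  moreover have "0 \<le> \<nu> D" if D: "D \<in> sets M" "D \<subseteq> P" for D
  proof -
    have PC: "P \<subseteq> C n" for n
      by (induction n) (auto simp: C P_def B_def)
    \<comment> \<open>The removed sets are disjoint, so their values form a convergent series and
      tend to 0. Eventually the alternative of a value at most -1 is excluded, and twice the value
      of \<open>B n\<close> bounds the value of \<open>D\<close> from below.\<close>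
    have lim: "(\<lambda>n. \<nu> (B n)) \<longlonglongrightarrow> 0" using sums by (rule summable_LIMSEQ_zero[OF sums_summable])
    then have "eventually (\<lambda>n. \<nu> (B n) > -1) sequentially" by (rule order_tendstoD) simp
    then have "eventually (\<lambda>n. 2 * \<nu> (B n) \<le> \<nu> D) sequentially"
    proof eventually_elim
      case (elim n)
      then show ?case using b(4)[of "C n" D] D PC[of n] by (auto simp: B_def)
    qed
    moreover have "(\<lambda>n. 2 * \<nu> (B n)) \<longlonglongrightarrow> 0" using tendsto_mult_left[OF lim, of 2] by simp
    ultimately show ?thesis by (intro tendsto_upperbound[of "\<lambda>n. 2 * \<nu> (B n)" 0 sequentially]) auto
  qed
  ultimately show ?thesis using Pm by (intro exI[of _ P]) (auto simp: positive_on_def P_def)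
qed

lemma positive_on_UN:
  assumes \<nu>: "sigma_additive M \<nu>" and P: "\<And>n::nat. positive_on M \<nu> (P n)"
  shows "positive_on M \<nu> (\<Union>n. P n)"
  unfolding positive_on_def
proof (intro conjI ballI impI)
  have Pm: "P n \<in> sets M" for n using P by (simp add: positive_on_def)
  then show "(\<Union>n. P n) \<in> sets M" by auto
  fix B assume B: "B \<in> sets M" "B \<subseteq> (\<Union>n. P n)"
  have dm: "disjointed P n \<in> sets M" for n
    using sets.range_disjointed_sets[of P M] Pm by auto
  have "(\<lambda>n. \<nu> (B \<inter> disjointed P n)) sums \<nu> (\<Union>n. B \<inter> disjointed P n)"
    using disjoint_family_disjointed[of P] dm B
    by (intro sigma_additiveD[OF \<nu>]) (auto simp: disjoint_family_on_def)
  moreover have "(\<Union>n. B \<inter> disjointed P n) = B" using B UN_disjointed_eq[of P] by blast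
  moreover have "0 \<le> \<nu> (B \<inter> disjointed P n)" for n
  proof -
    have "B \<inter> disjointed P n \<in> sets M" "B \<inter> disjointed P n \<subseteq> P n"
      using disjointed_subset[of P n] dm B by auto
    then show ?thesis using P[of n] unfolding positive_on_def by blast
  qed
  ultimately show "0 \<le> \<nu> B"
    using sums_le[OF _ sums_zero, of "\<lambda>n. \<nu> (B \<inter> disjointed P n)" "\<nu> B"] by simp
qed

lemma positive_on_mono:
  assumes \<nu>: "sigma_additive M \<nu>" and P: "positive_on M \<nu> P" and Q: "Q \<in> sets M" "Q \<subseteq> P"
  shows "\<nu> Q \<le> \<nu> P"
proof -
  have "P \<in> sets M" "0 \<le> \<nu> (P - Q)" using P Q unfolding positive_on_def by blast+
  then show ?thesis using sigma_additive_Diff[OF \<nu> _ Q] by simp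
qed

text \<open>A union \<open>Q\<close> of positive sets with values approaching the supremum
  \<open>s\<close> attains it. A set outside \<open>Q\<close> of positive value would contain a
  positive subset of at least that value, and adjoining this to \<open>Q\<close> would exceed
  \<open>s\<close>. The supremum is finite because the union of positive sets of unbounded value
  would have infinite value.\<close>

lemma Hahn_decomposition:
  assumes \<nu>: "sigma_additive M \<nu>"
  shows "\<exists>P. positive_on M \<nu> P \<and> (\<forall>B\<in>sets M. B \<inter> P = {} \<longrightarrow> \<nu> B \<le> 0)"
proof -
  define S where "S = \<nu> ` {P. positive_on M \<nu> P}"
  have S0: "0 \<in> S" using sigma_additive_empty[OF \<nu>] by (force simp: S_def positive_on_def)
  have bdd: "bdd_above S"
  proof (rule ccontr)
    assume "\<not> bdd_above S"
    then have "\<exists>P. positive_on M \<nu> P \<and> real n < \<nu> P" for n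
      unfolding bdd_above_def S_def by (force simp: not_le)
    then obtain P where P: "\<And>n. positive_on M \<nu> (P n)" "\<And>n. real n < \<nu> (P n)" by metis
    have U: "positive_on M \<nu> (\<Union>n. P n)" by (rule positive_on_UN[OF \<nu>]) (rule P(1))
    have "real n \<le> \<nu> (\<Union>n. P n)" for n
    proof -
      have "\<nu> (P n) \<le> \<nu> (\<Union>n. P n)"
        using P(1)[of n] by (intro positive_on_mono[OF \<nu> U]) (auto simp: positive_on_def)
      then show ?thesis using P(2)[of n] by simp
    qed
    then show False using reals_Archimedean2[of "\<nu> (\<Union>n. P n)"] by (meson not_le)
  qed
  define s where "s = Sup S"
  have "\<exists>P. positive_on M \<nu> P \<and> s - 1 / real (Suc n) < \<nu> P" for n
  proof -
    have "s - 1 / real (Suc n) < Sup S" unfolding s_def by simp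
    then obtain x where "x \<in> S" "s - 1 / real (Suc n) < x" using less_cSupD S0 by (metis empty_iff)
    then show ?thesis by (auto simp: S_def)
  qed
  then obtain P where P: "\<And>n. positive_on M \<nu> (P n)" "\<And>n. s - 1 / real (Suc n) < \<nu> (P n)" by metis
  define Q where "Q = (\<Union>n. P n)"
  have Q: "positive_on M \<nu> Q" unfolding Q_def by (rule positive_on_UN[OF \<nu>]) (rule P(1))
  have "s - 1 / real (Suc n) \<le> \<nu> Q" for n
  proof -
    have "\<nu> (P n) \<le> \<nu> Q"
      using P(1)[of n] by (intro positive_on_mono[OF \<nu> Q]) (auto simp: positive_on_def Q_def)
    then show ?thesis using P(2)[of n] by simp
  qed
  moreover have "(\<lambda>n. s - 1 / real (Suc n)) \<longlonglongrightarrow> s - 0"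
    by (intro tendsto_diff tendsto_const LIMSEQ_Suc[OF lim_1_over_n])
  ultimately have sQ: "s \<le> \<nu> Q" using LIMSEQ_le_const2 by fastforce
  have "\<nu> B \<le> 0" if B: "B \<in> sets M" "B \<inter> Q = {}" for B
  proof (rule ccontr)
    assume "\<not> \<nu> B \<le> 0"
    moreover obtain P' where P': "P' \<subseteq> B" "positive_on M \<nu> P'" "\<nu> B \<le> \<nu> P'"
      using positive_subset[OF \<nu> B(1)] by auto
    ultimately have pos: "0 < \<nu> P'" by simp
    have "positive_on M \<nu> (\<Union>n::nat. if n = 0 then Q else P')"
      by (rule positive_on_UN[OF \<nu>]) (use Q P' in auto)
    also have "(\<Union>n::nat. if n = 0 then Q else P') = Q \<union> P'" by (auto split: if_splits)
    finally have "\<nu> (Q \<union> P') \<le> s"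
      unfolding s_def by (intro cSup_upper bdd) (auto simp: S_def)
    moreover have "\<nu> (Q \<union> P') = \<nu> Q + \<nu> P'"
      by (rule sigma_additive_Un[OF \<nu>]) (use Q P' B in \<open>auto simp: positive_on_def\<close>)
    ultimately show False using sQ pos by simp
  qed
  with Q show ?thesis by blast
qed

section \<open>Jordan decomposition and complex densities\<close>

lemma finite_measure_of_nonneg:
  fixes \<nu> :: "'a set \<Rightarrow> real"
  assumes \<nu>: "sigma_additive M \<nu>" and nn: "\<And>B. B \<in> sets M \<Longrightarrow> 0 \<le> \<nu> B"
  shows "\<exists>N. finite_measure N \<and> sets N = sets M \<and> (\<forall>B\<in>sets M. measure N B = \<nu> B)"
proof -
  define N where "N = measure_of (space M) (sets M) (\<lambda>B. ennreal (\<nu> B))"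
  have N: "sets N = sets M" "space N = space M"
    by (simp_all add: N_def sets.sigma_sets_eq sets.space_closed space_measure_of)
  have em: "emeasure N B = ennreal (\<nu> B)" if "B \<in> sets M" for B
    unfolding N_def
  proof (rule emeasure_measure_of_sigma[OF sets.sigma_algebra_axioms _ _ that])
    show "positive (sets M) (\<lambda>B. ennreal (\<nu> B))"
      by (simp add: positive_def sigma_additive_empty[OF \<nu>])
    show "countably_additive (sets M) (\<lambda>B. ennreal (\<nu> B))"
      unfolding countably_additive_def
    proof (intro allI impI)
      fix F :: "nat \<Rightarrow> 'a set" assume F: "range F \<subseteq> sets M" "disjoint_family F"
      then have "(\<lambda>n. \<nu> (F n)) sums \<nu> (\<Union>n. F n)" by (intro sigma_additiveD[OF \<nu>]) auto
      then show "(\<Sum>i. ennreal (\<nu> (F i))) = ennreal (\<nu> (\<Union>i. F i))"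
        by (rule suminf_ennreal_eq[rotated]) (use F nn in auto)
    qed
  qed
  have "finite_measure N" by (rule finite_measureI) (simp add: N em)
  moreover have "measure N B = \<nu> B" if "B \<in> sets M" for B
    using em[OF that] nn[OF that] by (simp add: measure_def)
  ultimately show ?thesis using N by blast
qed

lemma Jordan_decomposition:
  fixes \<nu> :: "'a set \<Rightarrow> real"
  assumes \<nu>: "sigma_additive M \<nu>"
  shows "\<exists>N1 N2. finite_measure N1 \<and> finite_measure N2 \<and> sets N1 = sets M \<and> sets N2 = sets M \<and>
    (\<forall>B\<in>sets M. \<nu> B = measure N1 B - measure N2 B)"
proof -
  obtain P where P: "positive_on M \<nu> P" and neg: "\<And>B. B \<in> sets M \<Longrightarrow> B \<inter> P = {} \<Longrightarrow> \<nu> B \<le> 0"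
    using Hahn_decomposition[OF \<nu>] by blast
  have Pm: "P \<in> sets M" using P by (simp add: positive_on_def)
  have tr: "sigma_additive M (\<lambda>B. \<nu> (B \<inter> Q))" if "Q \<in> sets M" for Q
    unfolding sigma_additive_def
  proof (intro allI impI)
    fix F :: "nat \<Rightarrow> 'a set" assume "range F \<subseteq> sets M \<and> disjoint_family F"
    then have "(\<lambda>n. \<nu> (F n \<inter> Q)) sums \<nu> (\<Union>n. F n \<inter> Q)"
      using that by (intro sigma_additiveD[OF \<nu>]) (auto simp: disjoint_family_on_def)
    then show "(\<lambda>n. \<nu> (F n \<inter> Q)) sums \<nu> ((\<Union>n. F n) \<inter> Q)" by simp
  qed
  have a1: "sigma_additive M (\<lambda>B. \<nu> (B \<inter> P))" by (rule tr[OF Pm])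
  have a2: "sigma_additive M (\<lambda>B. - \<nu> (B \<inter> (space M - P)))"
    using tr[of "space M - P"] Pm unfolding sigma_additive_def by (auto intro: sums_minus)
  obtain N1 where N1: "finite_measure N1" "sets N1 = sets M" "\<forall>B\<in>sets M. measure N1 B = \<nu> (B \<inter> P)"
    using finite_measure_of_nonneg[OF a1] P Pm by (auto simp: positive_on_def)
  have neg2: "0 \<le> - \<nu> (B \<inter> (space M - P))" if "B \<in> sets M" for B
    using neg[of "B \<inter> (space M - P)"] that Pm by auto
  obtain N2 where N2: "finite_measure N2" "sets N2 = sets M"
      "\<forall>B\<in>sets M. measure N2 B = - \<nu> (B \<inter> (space M - P))"
    using finite_measure_of_nonneg[OF a2 neg2] by blast
  have "\<nu> B = measure N1 B - measure N2 B" if B: "B \<in> sets M" for B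
  proof -
    have "B = (B \<inter> P) \<union> (B \<inter> (space M - P))" using sets.sets_into_space[OF B] by auto
    then have "\<nu> B = \<nu> (B \<inter> P) + \<nu> (B \<inter> (space M - P))"
      using sigma_additive_Un[OF \<nu>, of "B \<inter> P" "B \<inter> (space M - P)"] B Pm by auto
    then show ?thesis using N1 N2 B by simp
  qed
  with N1 N2 show ?thesis by blast
qed

text \<open>A countable sum dominates each of its summands and so serves as a common reference
  measure for Radon-Nikodym derivatives.\<close>

definition series_measure :: "(nat \<Rightarrow> 'a measure) \<Rightarrow> 'a measure" where
  "series_measure N = measure_of (space (N 0)) (sets (N 0)) (\<lambda>B. \<Sum>n. emeasure (N n) B)"

lemma sets_series_measure: "sets (series_measure N) = sets (N 0)"
  by (simp add: series_measure_def sets.sigma_sets_eq sets.space_closed)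

lemma emeasure_series_measure:
  assumes N: "\<And>n. sets (N n) = sets (N 0)" and B: "B \<in> sets (N 0)"
  shows "emeasure (series_measure N) B = (\<Sum>n. emeasure (N n) B)"
  unfolding series_measure_def
proof (rule emeasure_measure_of_sigma[OF sets.sigma_algebra_axioms _ _ B])
  show "positive (sets (N 0)) (\<lambda>B. \<Sum>n. emeasure (N n) B)" by (simp add: positive_def)
  show "countably_additive (sets (N 0)) (\<lambda>B. \<Sum>n. emeasure (N n) B)"
    unfolding countably_additive_def
  proof (intro allI impI)
    fix F :: "nat \<Rightarrow> 'a set" assume F: "range F \<subseteq> sets (N 0)" "disjoint_family F"
    have "(\<Sum>i. \<Sum>n. emeasure (N n) (F i)) = (\<Sum>i. \<integral>\<^sup>+n. emeasure (N n) (F i) \<partial>count_space UNIV)"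
      by (simp add: nn_integral_count_space_nat)
    also have "\<dots> = (\<integral>\<^sup>+n. (\<Sum>i. emeasure (N n) (F i)) \<partial>count_space UNIV)"
      by (rule nn_integral_suminf[symmetric]) simp
    also have "\<dots> = (\<integral>\<^sup>+n. emeasure (N n) (\<Union>i. F i) \<partial>count_space UNIV)"
      using F N by (intro nn_integral_cong suminf_emeasure) auto
    finally show "(\<Sum>i. \<Sum>n. emeasure (N n) (F i)) = (\<Sum>n. emeasure (N n) (\<Union>i. F i))"
      by (simp add: nn_integral_count_space_nat)
  qed
qed

lemma absolutely_continuous_series_measure:
  assumes N: "\<And>n. sets (N n) = sets (N 0)"
  shows "absolutely_continuous (series_measure N) (N n)"
  unfolding absolutely_continuous_def
proof
  fix B assume "B \<in> null_sets (series_measure N)"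
  then have B: "B \<in> sets (N 0)" "emeasure (series_measure N) B = 0"
    by (auto simp: sets_series_measure)
  then have "(\<Sum>n. emeasure (N n) B) = 0" by (simp add: emeasure_series_measure[of N, OF N])
  then have "emeasure (N n) B = 0" by (simp add: suminf_eq_zero_iff)
  then show "B \<in> null_sets (N n)" using B N by auto
qed

lemma real_density_of_absolutely_continuous:
  assumes M: "finite_measure M" and N: "finite_measure N" and s: "sets N = sets M"
    and ac: "absolutely_continuous M N"
  shows "\<exists>D::'a \<Rightarrow> real. D \<in> borel_measurable M \<and> (\<forall>x. 0 \<le> D x) \<and> integrable M D \<and> N = density M (\<lambda>x. ennreal (D x))"
proof -
  interpret M: finite_measure M by fact
  interpret N: finite_measure N by fact
  obtain D where D: "D \<in> borel_measurable M" "AE x in M. RN_deriv M N x = ennreal (D x)" "\<And>x. 0 \<le> D x"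
    using M.real_RN_deriv[OF N ac s] by metis
  have eq: "N = density M (\<lambda>x. ennreal (D x))"
    using M.density_RN_deriv[OF ac s] D density_cong[of "RN_deriv M N" M "\<lambda>x. ennreal (D x)"] by simp
  have "(\<integral>\<^sup>+x. ennreal (D x) \<partial>M) = emeasure N (space M)"
    unfolding eq using D by (subst emeasure_density) (auto intro!: nn_integral_cong)
  also have "\<dots> < \<infinity>" using N.emeasure_finite by (simp add: less_top[symmetric])
  finally have "integrable M D" using D by (intro integrableI_nonneg) auto
  with D eq show ?thesis by blast
qed

lemma measure_eq_set_lebesgue_integral:
  fixes D :: "'a \<Rightarrow> real"
  assumes "D \<in> borel_measurable M" "\<And>x. 0 \<le> D x" "integrable M D" "N = density M (\<lambda>x. ennreal (D x))" "B \<in> sets M"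
  shows "measure N B = (LINT x:B|M. D x)"
proof -
  have "measure N B = (\<integral>x. indicator B x \<partial>N)" using assms by simp
  also have "\<dots> = (LINT x:B|M. D x)"
    unfolding assms(4) set_lebesgue_integral_def
    using assms(1,2,5) by (subst integral_density) (auto simp: mult.commute)
  finally show ?thesis .
qed

text \<open>The Jordan parts of the real and imaginary part are four finite measures, all absolutely
  continuous with respect to their sum; the four derivatives combine to \<open>h\<close>.\<close>

lemma complex_density_exists:
  fixes \<mu> :: "'a set \<Rightarrow> complex"
  assumes \<mu>: "sigma_additive M \<mu>"
  shows "\<exists>N h. finite_measure N \<and> sets N = sets M \<and> h \<in> borel_measurable M \<and> integrable N h \<and>
    (\<forall>B\<in>sets M. \<mu> B = (LINT x:B|N. h x))"
proof -
  have "sigma_additive M (\<lambda>B. Re (\<mu> B))" "sigma_additive M (\<lambda>B. Im (\<mu> B))"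
    using \<mu> unfolding sigma_additive_def by (auto intro: sums_Re sums_Im)
  then obtain N1 N2 N3 N4 where fin: "finite_measure N1" "finite_measure N2" "finite_measure N3" "finite_measure N4"
    and s: "sets N1 = sets M" "sets N2 = sets M" "sets N3 = sets M" "sets N4 = sets M"
    and R: "\<And>B. B \<in> sets M \<Longrightarrow> Re (\<mu> B) = measure N1 B - measure N2 B"
    and I: "\<And>B. B \<in> sets M \<Longrightarrow> Im (\<mu> B) = measure N3 B - measure N4 B"
    using Jordan_decomposition[of M "\<lambda>B. Re (\<mu> B)"] Jordan_decomposition[of M "\<lambda>B. Im (\<mu> B)"] by metis
  \<comment> \<open>The four measures are padded with null measures to the sequence that
    \<open>series_measure\<close> expects.\<close>
  define Ns where "Ns n = (if n = 0 then N1 else if n = 1 then N2 else if n = 2 then N3 else if n = 3 then N4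
     else null_measure M)" for n :: nat
  have Ns: "sets (Ns n) = sets (Ns 0)" for n by (simp add: Ns_def s)
  define N where "N = series_measure Ns"
  have sN: "sets N = sets M" by (simp add: N_def sets_series_measure Ns_def s)
  have spN: "space N = space M" using sN by (rule sets_eq_imp_space_eq)
  have "(\<Sum>n. emeasure (Ns n) (space M)) = (\<Sum>n\<in>{0,1,2,3::nat}. emeasure (Ns n) (space M))"
    by (rule suminf_finite) (auto simp: Ns_def)
  also have "\<dots> \<noteq> \<infinity>"
    using fin by (auto simp: Ns_def finite_measure.emeasure_finite)
  finally have "finite_measure N"
    using emeasure_series_measure[of Ns, OF Ns, of "space M"] by (intro finite_measureI) (simp add: N_def[symmetric] spN Ns_def s)
  note fN = this
  have "\<exists>D::'a \<Rightarrow> real. D \<in> borel_measurable M \<and> integrable N D \<and> (\<forall>B\<in>sets M. measure K B = (LINT x:B|N. D x))"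
    if K: "finite_measure K" "sets K = sets M" "K = Ns n" for K n
  proof -
    have "absolutely_continuous N K"
      unfolding N_def K(3) using Ns by (rule absolutely_continuous_series_measure)
    then obtain D where D: "D \<in> borel_measurable N" "\<And>x. 0 \<le> D x" "integrable N D" "K = density N (\<lambda>x. ennreal (D x))"
      using real_density_of_absolutely_continuous[OF fN K(1)] K sN by metis
    moreover have "D \<in> borel_measurable M" using D(1) sN by (simp cong: measurable_cong_sets)
    ultimately show ?thesis using measure_eq_set_lebesgue_integral[OF D(1,2,3,4)] sN by blast
  qed
  note ex = this
  obtain D1 where D1: "D1 \<in> borel_measurable M" "integrable N D1" "\<And>B. B \<in> sets M \<Longrightarrow> measure N1 B = (LINT x:B|N. D1 x)"
    using ex[OF fin(1) s(1), of 0] by (auto simp: Ns_def)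
  obtain D2 where D2: "D2 \<in> borel_measurable M" "integrable N D2" "\<And>B. B \<in> sets M \<Longrightarrow> measure N2 B = (LINT x:B|N. D2 x)"
    using ex[OF fin(2) s(2), of 1] by (auto simp: Ns_def)
  obtain D3 where D3: "D3 \<in> borel_measurable M" "integrable N D3" "\<And>B. B \<in> sets M \<Longrightarrow> measure N3 B = (LINT x:B|N. D3 x)"
    using ex[OF fin(3) s(3), of 2] by (auto simp: Ns_def)
  obtain D4 where D4: "D4 \<in> borel_measurable M" "integrable N D4" "\<And>B. B \<in> sets M \<Longrightarrow> measure N4 B = (LINT x:B|N. D4 x)"
    using ex[OF fin(4) s(4), of 3] by (auto simp: Ns_def)
  define h where "h x = Complex (D1 x - D2 x) (D3 x - D4 x)" for x
  have h: "h x = of_real (D1 x - D2 x) + \<i> * of_real (D3 x - D4 x)" for x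
    by (simp add: h_def complex_eq_iff)
  have hm: "h \<in> borel_measurable M"
    unfolding h[abs_def] using D1(1) D2(1) D3(1) D4(1) by measurable
  have hi: "integrable N h"
    unfolding h[abs_def] using D1(2) D2(2) D3(2) D4(2)
    by (intro Bochner_Integration.integrable_add integrable_mult_right integrable_of_real Bochner_Integration.integrable_diff)
  have "\<mu> B = (LINT x:B|N. h x)" if B: "B \<in> sets M" for B
  proof -
    have si: "integrable N (\<lambda>x. indicator B x *\<^sub>R D x)" if "integrable N D" for D :: "'a \<Rightarrow> real"
      using that B sN by (intro integrable_mult_indicator) auto
    have sh: "integrable N (\<lambda>x. indicator B x *\<^sub>R h x)"
      using hi B sN by (intro integrable_mult_indicator) auto
    have "Re (LINT x:B|N. h x) = (\<integral>x. indicator B x *\<^sub>R D1 x - indicator B x *\<^sub>R D2 x \<partial>N)"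
      unfolding set_lebesgue_integral_def integral_Re[OF sh, symmetric]
      by (intro Bochner_Integration.integral_cong) (auto simp: h_def algebra_simps)
    also have "\<dots> = Re (\<mu> B)"
      using D1 D2 si B R by (subst Bochner_Integration.integral_diff) (auto simp: set_lebesgue_integral_def)
    finally have 1: "Re (LINT x:B|N. h x) = Re (\<mu> B)" .
    have "Im (LINT x:B|N. h x) = (\<integral>x. indicator B x *\<^sub>R D3 x - indicator B x *\<^sub>R D4 x \<partial>N)"
      unfolding set_lebesgue_integral_def integral_Im[OF sh, symmetric]
      by (intro Bochner_Integration.integral_cong) (auto simp: h_def algebra_simps)
    also have "\<dots> = Im (\<mu> B)"
      using D3 D4 si B I by (subst Bochner_Integration.integral_diff) (auto simp: set_lebesgue_integral_def)
    finally show ?thesis using 1 by (simp add: complex_eq_iff)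
  qed
  with fN sN hm hi show ?thesis by blast
qed

text \<open>After intersection with a fixed member \<open>A\<close>, every countable union stays in
  the ring, so a measure on a delta-ring becomes one on the whole Borel sigma-algebra and the Hahn
  decomposition applies.\<close>

lemma sigma_additive_complex_measure:
  assumes R: "borel_ring R" "A \<in> R" and \<mu>: "complex_measure_on R \<mu>"
  shows "sigma_additive borel (\<lambda>B. \<mu> (B \<inter> A))"
  unfolding sigma_additive_def
proof (intro allI impI)
  fix F :: "nat \<Rightarrow> 'a set" assume F: "range F \<subseteq> sets borel \<and> disjoint_family F"
  have in_R: "B \<inter> A \<in> R" if "B \<in> sets borel" for B
    using borel_ring_Int[OF R that] by (simp add: Int_commute)
  have "range (\<lambda>n. F n \<inter> A) \<subseteq> R \<and> disjoint_family (\<lambda>n. F n \<inter> A) \<and> (\<Union>n. F n \<inter> A) \<in> R"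
  proof (intro conjI)
    show "range (\<lambda>n. F n \<inter> A) \<subseteq> R" using in_R F by auto
    show "disjoint_family (\<lambda>n. F n \<inter> A)" using F by (auto simp: disjoint_family_on_def)
    have "(\<Union>n. F n) \<in> sets borel" using F by auto
    from in_R[OF this] show "(\<Union>n. F n \<inter> A) \<in> R" by simp
  qed
  then have "(\<lambda>n. \<mu> (F n \<inter> A)) sums \<mu> (\<Union>n. F n \<inter> A)"
    using \<mu> unfolding complex_measure_on_def by (elim conjE allE[of _ "\<lambda>n. F n \<inter> A"]) blast
  then show "(\<lambda>n. \<mu> (F n \<inter> A)) sums \<mu> ((\<Union>n. F n) \<inter> A)" by simp
qed

lemma density_on_exists:
  assumes R: "borel_ring R" "A \<in> R" and \<mu>: "complex_measure_on R \<mu>"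
  shows "\<exists>N h. density_on \<mu> A N h"
proof -
  have A: "A \<in> sets borel" using R by (rule borel_ring_sets)
  obtain N h where *: "sets N = sets borel" "h \<in> borel_measurable borel" "integrable N h"
     "\<forall>B\<in>sets borel. \<mu> (B \<inter> A) = (LINT x:B|N. h x)"
    using complex_density_exists[OF sigma_additive_complex_measure[OF R \<mu>]] by auto
  then have "density_on \<mu> A N h"
    using A unfolding density_on_def set_integrable_def
    by (auto simp: Int_absorb2 intro!: integrable_mult_indicator)
  then show ?thesis by blast
qed

section \<open>Measures inner regular on compact sets\<close>

lemma borel_ring_cborel: "borel_ring (cborel :: 'a::t2_space set set)"
  unfolding borel_ring_def
proof (intro conjI ballI impI)
  show "cborel \<subseteq> (sets borel :: 'a set set)" by (auto simp: cborel_def)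
  show "{} \<in> (cborel :: 'a set set)" by (simp add: cborel_def)
  fix A B :: "'a set"
  show "B \<in> cborel" if "A \<in> cborel" "B \<in> sets borel" "B \<subseteq> A"
    using that closure_mono[of B A] compact_Int_closed[of "closure A" "closure B"]
    by (simp add: cborel_def Int_absorb1)
  show "A \<union> B \<in> cborel" if "A \<in> cborel" "B \<in> cborel"
    using that by (auto simp: cborel_def closure_Un)
qed

lemma compact_imp_borel: "compact (C :: 'a::t2_space set) \<Longrightarrow> C \<in> sets borel"
  by (simp add: borel_closed compact_imp_closed)

lemma compact_in_cborel: "compact (C :: 'a::t2_space set) \<Longrightarrow> C \<in> cborel"
  by (simp add: cborel_def compact_imp_borel compact_imp_closed)

text \<open>Finiteness is part of the notion. A measure of infinite total variation is still
  represented over such an \<open>M\<close>, by a density that is only locally integrable.\<close>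

definition radon :: "'a::topological_space measure \<Rightarrow> bool" where
  "radon M \<longleftrightarrow> sets M = sets borel \<and> finite_measure M \<and>
     (\<forall>B\<in>sets borel. \<forall>e>0. \<exists>C. compact C \<and> C \<subseteq> B \<and> measure M (B - C) < e)"

lemma radonD:
  assumes "radon M"
  shows "sets M = sets borel" "finite_measure M" "space M = UNIV"
  using assms sets_eq_imp_space_eq[of M borel] by (auto simp: radon_def)

lemma radonI:
  assumes "sets M = sets borel" "finite_measure M"
    and "\<And>B e. B \<in> sets borel \<Longrightarrow> 0 < e \<Longrightarrow> \<exists>C. compact C \<and> C \<subseteq> B \<and> measure M (B - C) < e"
  shows "radon M"
  using assms by (simp add: radon_def)

lemma radon_compact_approx:
  assumes "radon M" "B \<in> sets borel" "0 < e"
  shows "\<exists>C. compact C \<and> C \<subseteq> B \<and> measure M (B - C) < e"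
  using assms by (simp add: radon_def)

lemma countable_compacts_sequence:
  fixes K :: "'a::topological_space set set"
  assumes K: "countable K" "\<And>C. C \<in> K \<Longrightarrow> compact C" "\<And>C. C \<in> K \<Longrightarrow> C \<subseteq> B"
  shows "\<exists>C::nat \<Rightarrow> 'a set. incseq C \<and> (\<forall>n. compact (C n) \<and> C n \<subseteq> B) \<and> (\<Union>n. C n) = \<Union>K"
proof (intro exI conjI allI)
  \<comment> \<open>The empty set is inserted so that an enumeration exists even when
    \<open>K\<close> is empty.\<close>
  define c where "c = from_nat_into (insert {} K)"
  have rc: "range c = insert {} K" unfolding c_def using K(1) by (intro range_from_nat_into) auto
  have c: "compact (c n)" "c n \<subseteq> B" for n using K(2,3) rc by (metis compact_empty empty_subsetI insertE rangeI)+
  show "incseq (\<lambda>n. \<Union>k\<le>n. c k)" by (force simp: incseq_def)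
  show "compact (\<Union>k\<le>n. c k)" "(\<Union>k\<le>n. c k) \<subseteq> B" for n using c by auto
  have "(\<Union>n. \<Union>k\<le>n. c k) = \<Union>(range c)" by auto
  then show "(\<Union>n. \<Union>k\<le>n. c k) = \<Union>K" by (simp add: rc)
qed

text \<open>The form with a countable family and a null remainder passes to countable unions and to
  absolutely continuous measures; the epsilon form passes to complements of unions. From the family,
  finite unions and continuity from above give epsilon; conversely compacts with error 1 / (n + 1)
  are collected.\<close>

lemma inner_approx_iff:
  fixes M :: "'a::t2_space measure"
  assumes M: "sets M = sets borel" "finite_measure M" and B: "B \<in> sets borel"
  shows "(\<exists>K. countable K \<and> (\<forall>C\<in>K. compact C \<and> C \<subseteq> B) \<and> emeasure M (B - \<Union>K) = 0) \<longleftrightarrow>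
    (\<forall>e>0. \<exists>C. compact C \<and> C \<subseteq> B \<and> measure M (B - C) < e)" (is "?L \<longleftrightarrow> ?R")
proof
  interpret finite_measure M by fact
  assume ?L
  then obtain K where K0: "countable K \<and> (\<forall>C\<in>K. compact C \<and> C \<subseteq> B) \<and> emeasure M (B - \<Union>K) = 0" ..
  then have K: "countable K" "\<And>C. C \<in> K \<Longrightarrow> compact C" "\<And>C. C \<in> K \<Longrightarrow> C \<subseteq> B" "emeasure M (B - \<Union>K) = 0"
    by simp_all
  obtain C where C0: "incseq C \<and> (\<forall>n::nat. compact (C n) \<and> C n \<subseteq> B) \<and> (\<Union>n. C n) = \<Union>K"
    using countable_compacts_sequence[OF K(1-3)] ..
  then have C: "\<And>n. compact (C n)" "\<And>n. C n \<subseteq> B" and inc: "incseq C" and UC: "(\<Union>n. C n) = \<Union>K"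
    by simp_all
  have Cm: "C n \<in> sets M" for n using C(1) M by (simp add: compact_imp_borel)
  have "(\<lambda>n. measure M (B - C n)) \<longlonglongrightarrow> measure M (\<Inter>n. B - C n)"
    using Cm B inc M by (intro finite_Lim_measure_decseq) (auto simp: decseq_def incseq_def)
  also have "(\<Inter>n. B - C n) = B - (\<Union>n. C n)" by auto
  finally have lim: "(\<lambda>n. measure M (B - C n)) \<longlonglongrightarrow> 0" using K(4) UC by (simp add: measure_def)
  show ?R
  proof (intro allI impI)
    fix e :: real assume "0 < e"
    then have "eventually (\<lambda>n. measure M (B - C n) < e) sequentially" using lim by (intro order_tendstoD)
    then obtain n where "measure M (B - C n) < e" by (auto simp: eventually_sequentially)
    then show "\<exists>C. compact C \<and> C \<subseteq> B \<and> measure M (B - C) < e"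
      using C[of n] by (intro exI[of _ "C n"]) simp
  qed
next
  interpret finite_measure M by fact
  assume r: ?R
  have "\<exists>C. compact C \<and> C \<subseteq> B \<and> measure M (B - C) < 1 / real (Suc n)" for n
    by (rule r[rule_format]) simp
  then obtain C where C: "\<And>n. compact (C n)" "\<And>n. C n \<subseteq> B" "\<And>n. measure M (B - C n) < 1 / real (Suc n)"
    by metis
  have Cm: "C n \<in> sets M" for n using C(1) M by (simp add: compact_imp_borel)
  have "measure M (B - (\<Union>n. C n)) \<le> 1 / real (Suc n)" for n
  proof -
    have "measure M (B - (\<Union>n. C n)) \<le> measure M (B - C n)"
      using Cm B M by (intro finite_measure_mono) auto
    then show ?thesis using C(3)[of n] by simp
  qed
  then have "measure M (B - (\<Union>n. C n)) \<le> 0"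
    by (intro LIMSEQ_le_const[OF LIMSEQ_Suc[OF lim_1_over_n]]) auto
  then have "emeasure M (B - (\<Union>n. C n)) = 0"
    by (simp add: emeasure_eq_measure measure_le_0_iff)
  then show ?L using C by (intro exI[of _ "range C"]) auto
qed

lemma radonI_sequence:
  fixes M :: "'a::t2_space measure"
  assumes M: "sets M = sets borel" "finite_measure M"
    and C: "\<And>B. B \<in> sets borel \<Longrightarrow> \<exists>C::nat \<Rightarrow> 'a set. (\<forall>n. compact (C n) \<and> C n \<subseteq> B) \<and> emeasure M (B - (\<Union>n. C n)) = 0"
  shows "radon M"
  unfolding radon_def
proof (intro conjI M ballI)
  fix B :: "'a set" assume B: "B \<in> sets borel"
  obtain C :: "nat \<Rightarrow> 'a set" where "\<And>n. compact (C n)" "\<And>n. C n \<subseteq> B" "emeasure M (B - (\<Union>n. C n)) = 0"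
    using C[OF B] by meson
  then have "countable (range C) \<and> (\<forall>D\<in>range C. compact D \<and> D \<subseteq> B) \<and> emeasure M (B - \<Union>(range C)) = 0" by simp
  then show "\<forall>e>0. \<exists>C. compact C \<and> C \<subseteq> B \<and> measure M (B - C) < e"
    unfolding inner_approx_iff[OF M B, symmetric] by (rule exI)
qed

lemma radon_compacts:
  fixes M :: "'a::t2_space measure"
  assumes M: "radon M" and B: "B \<in> sets borel"
  obtains C :: "nat \<Rightarrow> 'a set" where "incseq C" "\<And>n. compact (C n)" "\<And>n. C n \<subseteq> B"
    "emeasure M (B - (\<Union>n. C n)) = 0"
proof -
  have "\<exists>K. countable K \<and> (\<forall>C\<in>K. compact C \<and> C \<subseteq> B) \<and> emeasure M (B - \<Union>K) = 0"
    unfolding inner_approx_iff[OF radonD(1,2)[OF M] B] using radon_compact_approx[OF M B] by simp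
  then obtain K where K0: "countable K \<and> (\<forall>C\<in>K. compact C \<and> C \<subseteq> B) \<and> emeasure M (B - \<Union>K) = 0" ..
  then have K: "countable K" "\<And>C. C \<in> K \<Longrightarrow> compact C" "\<And>C. C \<in> K \<Longrightarrow> C \<subseteq> B" "emeasure M (B - \<Union>K) = 0"
    by simp_all
  obtain C where "incseq C \<and> (\<forall>n::nat. compact (C n) \<and> C n \<subseteq> B) \<and> (\<Union>n. C n) = \<Union>K"
    using countable_compacts_sequence[OF K(1-3)] ..
  then show thesis using K(4) that[of C] by simp
qed

text \<open>The remainder left by countably many compacts is null for \<open>M\<close>, hence for
  \<open>N\<close>, which may be infinite. The family \<open>K\<close> is any one between the
  compact and the Borel subsets of \<open>B\<close>, to serve both for regularity and for suprema
  over members of \<open>cborel\<close>.\<close>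

lemma emeasure_radon_SUP:
  fixes M :: "'a::t2_space measure"
  assumes M: "radon M" and N: "sets N = sets borel" "absolutely_continuous M N" and B: "B \<in> sets borel"
    and K: "\<And>C. compact C \<Longrightarrow> C \<subseteq> B \<Longrightarrow> C \<in> K" "\<And>C. C \<in> K \<Longrightarrow> C \<in> sets borel \<and> C \<subseteq> B"
  shows "emeasure N B = (SUP C\<in>K. emeasure N C)"
proof (rule antisym)
  obtain C where C: "incseq C" "\<And>n. compact (C n)" "\<And>n. C n \<subseteq> B" "emeasure M (B - (\<Union>n. C n)) = 0"
    using radon_compacts[OF M B] by metis
  have Cm: "C n \<in> sets borel" for n using C(2) by (simp add: compact_imp_borel)
  have "B - (\<Union>n. C n) \<in> null_sets M" using C(4) B Cm radonD[OF M] by (auto intro!: null_setsI)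
  then have "B - (\<Union>n. C n) \<in> null_sets N" using N(2) by (auto simp: absolutely_continuous_def)
  then have "emeasure N ((\<Union>n. C n) \<union> (B - (\<Union>n. C n))) = emeasure N (\<Union>n. C n)"
    using Cm N by (intro emeasure_Un_null_set) auto
  also have "(\<Union>n. C n) \<union> (B - (\<Union>n. C n)) = B" using C(3) by auto
  also have "emeasure N (\<Union>n. C n) = (SUP n. emeasure N (C n))"
    using Cm N C(1) by (intro SUP_emeasure_incseq[symmetric]) auto
  also have "\<dots> \<le> (SUP C\<in>K. emeasure N C)"
  proof (rule SUP_least)
    fix n
    show "emeasure N (C n) \<le> (SUP C\<in>K. emeasure N C)"
      using K(1)[OF C(2,3)] by (rule SUP_upper)
  qed
  finally show "emeasure N B \<le> (SUP C\<in>K. emeasure N C)" .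
  show "(SUP C\<in>K. emeasure N C) \<le> emeasure N B"
    by (rule SUP_least, rule emeasure_mono) (use K B N in auto)
qed

section \<open>Measures given by a density on a reference measure\<close>

lemma density_on_UN_sums:
  assumes d: "density_on \<mu> A M h" and F: "\<And>n::nat. F n \<in> sets borel" "disjoint_family F" "(\<Union>n. F n) \<subseteq> A"
  shows "(\<lambda>n. \<mu> (F n)) sums \<mu> (\<Union>n. F n)"
proof -
  note M = density_onD(1)[OF d] and hi = density_onD(3)[OF d] and eq = density_onD(4)[OF d]
  have hB: "set_integrable M B h" if "B \<in> sets borel" "B \<subseteq> A" for B
    using that hi M by (auto intro: set_integrable_subset)
  define U where "U n = (\<Union>i<n. F i)" for n
  have U: "U n \<in> sets borel" "U n \<subseteq> A" for n using F by (auto simp: U_def)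
  have FA: "F n \<subseteq> A" for n using F by auto
  have part: "(\<Sum>i<n. \<mu> (F i)) = (LINT x:U n|M. h x)" for n
  proof (induction n)
    case 0
    show ?case by (simp add: U_def set_lebesgue_integral_def)
  next
    case (Suc n)
    have "U n \<inter> F n = {}" using F(2) unfolding U_def disjoint_family_on_def by (fastforce dest: nat_neq_iff[THEN iffD2, OF disjI1])
    then have "(LINT x:U n \<union> F n|M. h x) = (LINT x:U n|M. h x) + (LINT x:F n|M. h x)"
      by (rule set_integral_Un) (use hB U F FA in auto)
    moreover have "U (Suc n) = U n \<union> F n" by (auto simp: U_def less_Suc_eq)
    ultimately show ?case using Suc eq[OF F(1) FA] by simp
  qed
  have UU: "(\<Union>n. U n) = (\<Union>n. F n)" by (auto simp: U_def)
  have "(\<lambda>n. LINT x:U n|M. h x) \<longlonglongrightarrow> (LINT x:(\<Union>n. U n)|M. h x)"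
  proof (rule set_integral_cont_up)
    show "incseq U" unfolding incseq_def U_def by (intro allI impI UN_mono) auto
    have "(\<Union>n. F n) \<in> sets borel" using F(1) by auto
    then show "set_integrable M (\<Union>n. U n) h" unfolding UU by (rule hB) (rule F(3))
  qed (use U M in auto)
  then show ?thesis unfolding sums_def part UU using eq[of "\<Union>n. F n"] F by auto
qed

lemma complex_measure_on_density:
  assumes R: "borel_ring R" and d: "\<And>A. A \<in> R \<Longrightarrow> density_on \<mu> A M h" and z: "\<And>A. A \<notin> R \<Longrightarrow> \<mu> A = 0"
  shows "complex_measure_on R \<mu>"
  unfolding complex_measure_on_def
proof (intro conjI allI impI)
  fix F :: "nat \<Rightarrow> 'a set" assume F: "range F \<subseteq> R \<and> disjoint_family F \<and> (\<Union>n. F n) \<in> R"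
  show "(\<lambda>n. \<mu> (F n)) sums \<mu> (\<Union>n. F n)"
    by (rule density_on_UN_sums[OF d]) (use F R in \<open>auto simp: borel_ring_def\<close>)
qed (rule z)

lemma total_var_emeasure:
  assumes R: "borel_ring R" "A \<in> R" and d: "density_on \<mu> A M h" and B: "B \<in> sets borel" "B \<subseteq> A"
  shows "total_var R \<mu> B = emeasure (density M (\<lambda>x. ennreal (norm (h x)))) B"
  using total_var_density[OF R(1) borel_ring_subset[OF R B] density_on_subset[OF d B]]
    density_onD(1,2)[OF d] B by (subst emeasure_density) (auto cong: measurable_cong_sets)

text \<open>The value 0 off \<open>cborel\<close> is what \<open>complex_measure_on\<close> demands,
  so that equality of such measures is equality of functions.\<close>

definition meas :: "'a::topological_space measure \<Rightarrow> ('a \<Rightarrow> complex) \<Rightarrow> 'a set \<Rightarrow> complex" where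
  "meas M h A = (if A \<in> cborel then (LINT x:A|M. h x) else 0)"

definition locally_integrable :: "'a::topological_space measure \<Rightarrow> ('a \<Rightarrow> complex) \<Rightarrow> bool" where
  "locally_integrable M h \<longleftrightarrow> h \<in> borel_measurable borel \<and> (\<forall>A\<in>cborel. set_integrable M A h)"

lemma density_on_meas:
  fixes M :: "'a::t2_space measure"
  assumes "sets M = sets borel" "locally_integrable M h" "A \<in> cborel"
  shows "density_on (meas M h) A M h"
  using assms borel_ring_subset[OF borel_ring_cborel]
  by (auto simp: density_on_def locally_integrable_def meas_def)

lemma total_var_meas:
  fixes M :: "'a::t2_space measure"
  assumes "sets M = sets borel" "locally_integrable M h" "A \<in> cborel"
  shows "total_var cborel (meas M h) A = emeasure (density M (\<lambda>x. ennreal (norm (h x)))) A"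
  using total_var_emeasure[OF borel_ring_cborel assms(3) density_on_meas[OF assms]] assms
  by (auto simp: cborel_def)

text \<open>The variation is the measure with density \<open>norm (h x)\<close>, which is absolutely
  continuous with respect to \<open>M\<close> and therefore inherits its approximation by compact
  sets.\<close>

lemma meas_regular:
  fixes M :: "'a::t2_space measure"
  assumes M: "radon M" and h: "locally_integrable M h"
  shows "meas M h \<in> regular_measures"
  unfolding regular_measures_def
proof (intro CollectI conjI ballI)
  note sM = radonD(1)[OF M]
  show "complex_measure_on cborel (meas M h)"
    by (rule complex_measure_on_density[OF borel_ring_cborel density_on_meas[OF sM h]]) (simp_all add: meas_def)
  fix A :: "'a set" assume A: "A \<in> cborel"
  let ?N = "density M (\<lambda>x. ennreal (norm (h x)))"
  have "emeasure ?N A = (SUP C\<in>{C. C \<subseteq> A \<and> compact C}. emeasure ?N C)"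
    using h sM A
    by (intro emeasure_radon_SUP[OF M] absolutely_continuousI_density)
      (auto simp: locally_integrable_def cborel_def compact_imp_borel cong: measurable_cong_sets)
  also have "\<dots> = (SUP C\<in>{C. C \<subseteq> A \<and> compact C}. total_var cborel (meas M h) C)"
    by (intro SUP_cong refl) (simp add: total_var_meas[OF sM h] compact_in_cborel)
  finally show "total_var cborel (meas M h) A = (SUP C\<in>{C. C \<subseteq> A \<and> compact C}. total_var cborel (meas M h) C)"
    by (simp add: total_var_meas[OF sM h A])
qed

text \<open>One formula for two suprema: with \<open>U = UNIV\<close> it is
  \<open>total_mass\<close>, and for open \<open>U\<close> it is the quantity whose finiteness
  defines \<open>ext_ring\<close>.\<close>

lemma SUP_total_var_meas:
  fixes M :: "'a::t2_space measure"
  assumes M: "radon M" and h: "locally_integrable M h" and U: "U \<in> sets borel"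
  shows "(SUP A\<in>{A\<in>cborel. A \<subseteq> U}. total_var cborel (meas M h) A) = (\<integral>\<^sup>+x\<in>U. ennreal (norm (h x)) \<partial>M)"
proof -
  note sM[measurable_cong] = radonD(1)[OF M]
  have [measurable]: "h \<in> borel_measurable borel" using h by (simp add: locally_integrable_def)
  let ?N = "density M (\<lambda>x. ennreal (norm (h x)))"
  have "(SUP A\<in>{A\<in>cborel. A \<subseteq> U}. total_var cborel (meas M h) A) = (SUP A\<in>{A\<in>cborel. A \<subseteq> U}. emeasure ?N A)"
    by (intro SUP_cong refl) (simp add: total_var_meas[OF sM h])
  also have "\<dots> = emeasure ?N U"
    using U sM
    by (intro emeasure_radon_SUP[OF M, symmetric] absolutely_continuousI_density)
      (auto simp: compact_in_cborel, auto simp: cborel_def)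
  also have "\<dots> = (\<integral>\<^sup>+x\<in>U. ennreal (norm (h x)) \<partial>M)"
    using U by (subst emeasure_density) (auto simp: sM)
  finally show ?thesis .
qed

lemma total_mass_meas:
  fixes M :: "'a::t2_space measure"
  assumes M: "radon M" and h: "locally_integrable M h"
  shows "total_mass (meas M h) = (\<integral>\<^sup>+x. ennreal (norm (h x)) \<partial>M)"
  using SUP_total_var_meas[OF M h, of UNIV] by (simp add: total_mass_def)

lemma locally_integrable_of_integrable:
  "sets M = sets borel \<Longrightarrow> h \<in> borel_measurable borel \<Longrightarrow> integrable M h \<Longrightarrow> locally_integrable M h"
  by (auto simp: locally_integrable_def cborel_def set_integrable_of_integrable)

section \<open>Bounded regular measures have a density\<close>

lemma sigma_additive_sum_lessThan:
  assumes \<nu>: "sigma_additive M \<nu>" and F: "\<And>i::nat. F i \<in> sets M" "disjoint_family F"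
  shows "\<nu> (\<Union>i<n. F i) = (\<Sum>i<n. \<nu> (F i))"
proof (induction n)
  case 0
  show ?case using sigma_additive_empty[OF \<nu>] by simp
next
  case (Suc n)
  have "(\<Union>i<n. F i) \<inter> F n = {}"
    using F(2) unfolding disjoint_family_on_def by (fastforce dest: nat_neq_iff[THEN iffD2, OF disjI1])
  then have "\<nu> ((\<Union>i<n. F i) \<union> F n) = \<nu> (\<Union>i<n. F i) + \<nu> (F n)"
    using F(1) by (intro sigma_additive_Un[OF \<nu>]) auto
  moreover have "(\<Union>i<Suc n. F i) = (\<Union>i<n. F i) \<union> F n" by (auto simp: less_Suc_eq)
  ultimately show ?case using Suc by simp
qed

text \<open>Uniformity over all measurable sets allows the limit of the measures to be exchanged
  with the limit along the partial unions \<open>U k\<close>.\<close>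

lemma sigma_additive_uniform_limit:
  fixes s :: "nat \<Rightarrow> 'a set \<Rightarrow> 'b::real_normed_vector"
  assumes s: "\<And>n. sigma_additive M (s n)" and l: "uniform_limit (sets M) s l sequentially"
  shows "sigma_additive M l"
  unfolding sigma_additive_def
proof (intro allI impI)
  fix F :: "nat \<Rightarrow> 'a set" assume "range F \<subseteq> sets M \<and> disjoint_family F"
  then have F: "\<And>i. F i \<in> sets M" "disjoint_family F" by auto
  define U where "U k = (\<Union>i<k. F i)" for k :: nat
  have U: "U k \<in> sets M" "(\<Union>n. F n) \<in> sets M" for k using F by (auto simp: U_def)
  have sU: "s n (U k) = (\<Sum>i<k. s n (F i))" for n k
    unfolding U_def using s F by (rule sigma_additive_sum_lessThan)
  have lU: "l (U k) = (\<Sum>i<k. l (F i))" for k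
  proof (rule LIMSEQ_unique)
    show "(\<lambda>n. s n (U k)) \<longlonglongrightarrow> l (U k)" using tendsto_uniform_limitI[OF l U(1)] .
    show "(\<lambda>n. s n (U k)) \<longlonglongrightarrow> (\<Sum>i<k. l (F i))"
      unfolding sU by (intro tendsto_sum tendsto_uniform_limitI[OF l] F)
  qed
  have "(\<lambda>k. l (U k)) \<longlonglongrightarrow> l (\<Union>n. F n)"
  proof (rule swap_uniform_limit'[where F=sequentially])
    show "\<forall>\<^sub>F n in sequentially. ((\<lambda>k. s n (U k)) \<longlongrightarrow> s n (\<Union>n. F n)) sequentially"
    proof (rule always_eventually, rule allI)
      fix n
      have "(\<lambda>i. s n (F i)) sums s n (\<Union>n. F n)" using s F by (rule sigma_additiveD)
      then show "((\<lambda>k. s n (U k)) \<longlongrightarrow> s n (\<Union>n. F n)) sequentially" by (simp add: sums_def sU)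
    qed
    show "(\<lambda>n. s n (\<Union>n. F n)) \<longlonglongrightarrow> l (\<Union>n. F n)" using tendsto_uniform_limitI[OF l U(2)] .
    show "uniform_limit UNIV (\<lambda>n k. s n (U k)) (\<lambda>k. l (U k)) sequentially"
      using l U(1) unfolding uniform_limit_iff by (auto elim!: eventually_mono)
  qed auto
  then show "(\<lambda>n. l (F n)) sums l (\<Union>n. F n)" by (simp add: sums_def lU)
qed

lemma complex_measure_on_empty:
  "complex_measure_on R \<mu> \<Longrightarrow> borel_ring R \<Longrightarrow> \<mu> {} = 0"
  using sigma_additive_empty[OF sigma_additive_complex_measure[of R "{}" \<mu>]] by (simp add: borel_ring_def)

text \<open>A density on the larger set turns the variation into a positive measure;
  \<open>total_var_Un\<close> uses the same device for additivity.\<close>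

lemma total_var_mono:
  assumes R: "borel_ring R" "A \<in> R" and \<mu>: "complex_measure_on R \<mu>" and B: "B \<in> sets borel" "B \<subseteq> A"
  shows "total_var R \<mu> B \<le> total_var R \<mu> A"
proof -
  obtain N h where d: "density_on \<mu> A N h" using density_on_exists[OF R \<mu>] by blast
  show ?thesis
    using total_var_emeasure[OF R d B] total_var_emeasure[OF R d borel_ring_sets[OF R] order_refl] B
      borel_ring_sets[OF R] density_onD(1)[OF d] by (auto intro: emeasure_mono)
qed

lemma total_var_Un:
  assumes R: "borel_ring R" "A \<in> R" "B \<in> R" and \<mu>: "complex_measure_on R \<mu>" and AB: "A \<inter> B = {}"
  shows "total_var R \<mu> (A \<union> B) = total_var R \<mu> A + total_var R \<mu> B"
proof -
  have U: "A \<union> B \<in> R" by (rule borel_ring_Un[OF R])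
  obtain N h where d: "density_on \<mu> (A \<union> B) N h" using density_on_exists[OF R(1) U \<mu>] by blast
  note b = borel_ring_sets[OF R(1)]
  show ?thesis
    using total_var_emeasure[OF R(1) U d, of A] total_var_emeasure[OF R(1) U d, of B]
      total_var_emeasure[OF R(1) U d, of "A \<union> B"] b[OF R(2)] b[OF R(3)] AB density_onD(1)[OF d]
    by (simp add: plus_emeasure)
qed

lemma norm_le_total_var:
  assumes R: "borel_ring R" "A \<in> R" and \<mu>: "complex_measure_on R \<mu>"
  shows "ennreal (norm (\<mu> A)) \<le> total_var R \<mu> A"
  using sum_norm_le_total_var[OF R(1), of "{()}" "\<lambda>_. A" A \<mu>] R complex_measure_on_empty[OF \<mu> R(1)]
  by (simp add: disjoint_family_on_def)

text \<open>
  The restrictions of \<open>m\<close> to sets \<open>A n\<close> that almost exhaust its total mass converge uniformly, and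
  the limit extends \<open>m\<close> to all Borel sets.
\<close>

lemma bounded_regular_density:
  fixes m :: "'a::t2_space set \<Rightarrow> complex"
  assumes m: "m \<in> bounded_regular_measures"
  shows "\<exists>M h. radon M \<and> h \<in> borel_measurable borel \<and> integrable M h \<and> m = meas M h"
proof -
  have cm: "complex_measure_on cborel m" and T: "total_mass m < \<infinity>"
    and reg: "\<And>A. A \<in> cborel \<Longrightarrow> total_var cborel m A = (SUP C\<in>{C. C \<subseteq> A \<and> compact C}. total_var cborel m C)"
    using m by (auto simp: bounded_regular_measures_def regular_measures_def)
  note R = borel_ring_cborel
  define v where "v A = enn2real (total_var cborel m A)" for A
  have fin: "total_var cborel m A < \<infinity>" if "A \<in> cborel" for A
    using that T unfolding total_mass_def by (metis SUP_upper order_le_less_trans)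
  have tv: "total_var cborel m A = ennreal (v A)" if "A \<in> cborel" for A
    using fin[OF that] by (simp add: v_def less_top)
  have v_mono: "v B \<le> v A" if "A \<in> cborel" "B \<in> sets borel" "B \<subseteq> A" for A B
    using total_var_mono[OF R that(1) cm that(2,3)] fin[OF that(1)] by (simp add: v_def enn2real_mono less_top)
  have v_Un: "v (A \<union> B) = v A + v B" if "A \<in> cborel" "B \<in> cborel" "A \<inter> B = {}" for A B
    using total_var_Un[OF R that(1,2) cm that(3)] fin[OF that(1)] fin[OF that(2)]
    by (simp add: v_def enn2real_plus less_top)
  have norm_v: "norm (m A) \<le> v A" if "A \<in> cborel" for A
    using norm_le_total_var[OF R that cm] unfolding tv[OF that] by (simp add: v_def)
  define S where "S = (SUP A\<in>cborel. v A)"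
  have bdd: "bdd_above (v ` cborel)"
  proof (rule bdd_aboveI2)
    fix A :: "'a set" assume A: "A \<in> cborel"
    have "total_var cborel m A \<le> total_mass m" unfolding total_mass_def using A by (rule SUP_upper)
    then show "v A \<le> enn2real (total_mass m)" using T by (simp add: v_def enn2real_mono less_top)
  qed
  have ne: "(cborel :: 'a set set) \<noteq> {}" using R by (auto simp: borel_ring_def)
  have "\<exists>B\<in>cborel. S - 1 / real (Suc n) < v B" for n
    using less_cSUP_iff[OF ne bdd, of "S - 1 / real (Suc n)"] by (simp add: S_def)
  then obtain B where B: "\<And>n. B n \<in> cborel" "\<And>n. S - 1 / real (Suc n) < v (B n)" by metis
  define A where "A n = (\<Union>k\<le>n. B k)" for n
  have Ac: "A n \<in> cborel" for n
  proof (induction n)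
    case (Suc n)
    have "A (Suc n) = A n \<union> B (Suc n)" by (auto simp: A_def le_Suc_eq)
    then show ?case using borel_ring_Un[OF R Suc B(1)] by simp
  qed (simp add: A_def B)
  note Ab = borel_ring_sets[OF R Ac]
  have A_mono: "A j \<subseteq> A n" if "j \<le> n" for j n using that by (force simp: A_def)
  have vA: "S - 1 / real (Suc n) < v (A n)" for n
    using v_mono[OF Ac[of n] borel_ring_sets[OF R B(1)[of n]]] B(2)[of n] by (force simp: A_def)
  \<comment> \<open>All but 1 / (n + 1) of the supremum \<open>S\<close> sits in \<open>A n\<close>,
    so a set disjoint from \<open>A n\<close> can carry no more than that remainder.\<close>
  have small: "v C < 1 / real (Suc n)" if C: "C \<in> cborel" "C \<inter> A n = {}" for C n
  proof -
    have "v (C \<union> A n) \<le> S"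
      unfolding S_def using borel_ring_Un[OF R C(1) Ac] bdd by (rule cSUP_upper)
    then show ?thesis using v_Un[OF C(1) Ac C(2)] vA[of n] by simp
  qed
  define s where "s n C = m (C \<inter> A n)" for n C
  have s: "sigma_additive borel (s n)" for n
    unfolding s_def using R Ac cm by (rule sigma_additive_complex_measure)
  have IA: "C \<inter> A n \<in> cborel" if "C \<in> sets borel" for C n
    using borel_ring_Int[OF R Ac that] by (simp add: Int_commute)
  have diff: "norm (m C - m (C \<inter> A n)) < 1 / real (Suc n)" if C: "C \<in> cborel" for C n
  proof -
    have Cb: "C \<in> sets borel" using R C by (rule borel_ring_sets)
    have d: "C - A n \<in> cborel" using borel_ring_Diff[OF R C Ab] .
    have "m ((C - A n) \<inter> C \<union> (C \<inter> A n) \<inter> C) = m ((C - A n) \<inter> C) + m ((C \<inter> A n) \<inter> C)"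
      by (rule sigma_additive_Un[OF sigma_additive_complex_measure[OF R C cm], of "C - A n" "C \<inter> A n", unfolded Int_Un_distrib2])
        (use Cb Ab[of n] in auto)
    moreover have "(C - A n) \<inter> C = C - A n" "(C \<inter> A n) \<inter> C = C \<inter> A n" "(C - A n) \<union> (C \<inter> A n) = C" by auto
    ultimately have "m C - m (C \<inter> A n) = m (C - A n)" by simp
    moreover have "(C - A n) \<inter> A n = {}" by auto
    ultimately show ?thesis using norm_v[OF d] small[OF d, of n] by simp
  qed
  have close: "norm (s j C - s n C) < 1 / real (Suc n)" if "C \<in> sets borel" "n \<le> j" for C n j
    using diff[OF IA[OF that(1), of j], of n] A_mono[OF that(2)] by (simp add: s_def Int_assoc Int_absorb1)
  have "uniformly_Cauchy_on (sets borel) s"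
  proof (rule uniformly_Cauchy_onI)
    fix e :: real assume "0 < e"
    then obtain k where k: "1 / real (Suc k) < e / 2" using nat_approx_posE[of "e / 2"] by auto
    show "\<exists>k. \<forall>C\<in>sets borel. \<forall>i\<ge>k. \<forall>j\<ge>k. dist (s i C) (s j C) < e"
    proof (intro exI ballI allI impI)
      fix C i j assume C: "C \<in> sets (borel :: 'a measure)" and ij: "k \<le> i" "k \<le> j"
      have "dist (s i C) (s j C) \<le> norm (s i C - s k C) + norm (s j C - s k C)"
        using norm_triangle_ineq4[of "s i C - s k C" "s j C - s k C"] by (simp add: dist_norm)
      then show "dist (s i C) (s j C) < e" using close[OF C ij(1)] close[OF C ij(2)] k by simp
    qed
  qed
  then obtain l where l: "uniform_limit (sets borel) s l sequentially"
    unfolding uniformly_convergent_eq_Cauchy[symmetric] uniformly_convergent_on_def by blast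
  have lim: "(\<lambda>n. s n C) \<longlonglongrightarrow> l C" if "C \<in> sets borel" for C
    using tendsto_uniform_limitI[OF l that] .
  have l_eq: "l C = m C" if C: "C \<in> cborel" for C
  proof (rule LIMSEQ_unique[OF lim])
    show "C \<in> sets borel" using R C by (rule borel_ring_sets)
    have "(\<lambda>n. s n C - m C) \<longlonglongrightarrow> 0"
    proof (rule Lim_null_comparison[OF _ LIMSEQ_Suc[OF lim_1_over_n]])
      show "\<forall>\<^sub>F n in sequentially. norm (s n C - m C) \<le> 1 / real (Suc n)"
        using diff[OF C] by (intro always_eventually) (simp add: s_def norm_minus_commute less_imp_le)
    qed
    then show "(\<lambda>n. s n C) \<longlonglongrightarrow> m C" by (rule LIM_zero_cancel)
  qed
  obtain N h where N: "finite_measure N" "sets N = sets borel" and h: "h \<in> borel_measurable borel" "integrable N h"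
    and lh: "\<And>B. B \<in> sets borel \<Longrightarrow> l B = (LINT x:B|N. h x)"
    using complex_density_exists[OF sigma_additive_uniform_limit[OF s l]] by auto
  \<comment> \<open>The reference measure is the total variation of the extension \<open>l\<close>,
    and the new density is the phase of \<open>h\<close>. Regularity of \<open>m\<close> on subsets
    of \<open>A n\<close> is then a statement about \<open>M\<close>.\<close>
  define M where "M = density N (\<lambda>x. ennreal (norm (h x)))"
  have hN[measurable]: "h \<in> borel_measurable N" using h(1) N(2) by (simp cong: measurable_cong_sets)
  have M: "sets M = sets borel" "space M = UNIV"
    using N(2) sets_eq_imp_space_eq[OF N(2)] by (simp_all add: M_def)
  have sgn_h: "(\<lambda>x. sgn (h x)) \<in> borel_measurable borel"
    using h(1) by (simp add: sgn_div_norm)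
  have sgn_hN: "(\<lambda>x. sgn (h x)) \<in> borel_measurable N"
    using sgn_h N(2) by (simp cong: measurable_cong_sets)
  have hs: "norm (h x) *\<^sub>R sgn (h x) = h x" for x by (cases "h x = 0") (auto simp: sgn_div_norm)
  have "emeasure M UNIV < \<infinity>"
    using h(2) N(2) unfolding M_def by (subst emeasure_density) (auto simp: integrable_iff_bounded)
  then have finM: "finite_measure M" by (intro finite_measureI) (simp add: M)
  then interpret M: finite_measure M .
  have int: "integrable M (\<lambda>x. sgn (h x))"
    unfolding M_def using sgn_hN h(2) by (subst integrable_density) (auto simp: hs)
  have m_eq: "m = meas M (\<lambda>x. sgn (h x))"
  proof
    fix C
    show "m C = meas M (\<lambda>x. sgn (h x)) C"
    proof (cases "C \<in> cborel")
      case True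
      then have C: "C \<in> sets borel" by (rule borel_ring_sets[OF R])
      have "(LINT x:C|M. sgn (h x)) = (LINT x:C|N. h x)"
        unfolding M_def set_lebesgue_integral_def
        using sgn_hN C N(2) by (subst integral_density) (auto simp: indicator_def hs intro!: Bochner_Integration.integral_cong)
      then show ?thesis using True l_eq[OF True] lh[OF C] by (simp add: meas_def)
    next
      case False
      then show ?thesis using cm by (simp add: meas_def complex_measure_on_def)
    qed
  qed
  have br: "borel_ring (sets (borel :: 'a measure))" by (auto simp: borel_ring_def)
  have dl: "density_on l UNIV N h"
    using N(2) h lh by (auto simp: density_on_def set_integrable_def)
  have dm: "density_on m (A n) N h" for n
  proof -
    have "m B = (LINT x:B|N. h x)" if "B \<in> sets borel" "B \<subseteq> A n" for B
      using lh[OF that(1)] l_eq[OF borel_ring_subset[OF R Ac that]] by simp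
    then show ?thesis
      unfolding density_on_def using N(2) h Ab set_integrable_of_integrable[OF N(2) h(2)] by auto
  qed
  have Mm: "emeasure M C = total_var cborel m C" if "C \<in> sets borel" "C \<subseteq> A n" for C n
    unfolding M_def using total_var_emeasure[OF R Ac dm that] by simp
  define K where "K = (\<Union>n. A n)"
  have Kb: "K \<in> sets borel" using Ab by (auto simp: K_def)
  \<comment> \<open>Every \<open>s n\<close> vanishes on sets that miss all \<open>A n\<close>,
    hence so does the limit. Thus \<open>M\<close> is concentrated on \<open>K\<close>, and compact
    approximation is needed only inside some \<open>A n\<close>.\<close>
  have "total_var (sets borel) l (- K) \<le> 0"
    unfolding total_var_def
  proof (rule SUP_least)
    fix P assume P: "P \<in> {P. finite P \<and> disjoint P \<and> P \<subseteq> sets borel \<and> \<Union> P = - K}"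
    have "l B = 0" if B: "B \<in> P" for B
    proof (rule LIMSEQ_unique[OF lim])
      show "B \<in> sets borel" using P B by auto
      have "B \<inter> A n = {}" for n using P B by (force simp: K_def)
      then show "(\<lambda>n. s n B) \<longlonglongrightarrow> 0" by (simp add: s_def complex_measure_on_empty[OF cm R])
    qed
    then show "(\<Sum>B\<in>P. ennreal (norm (l B))) \<le> 0" by simp
  qed
  then have MK: "emeasure M (- K) = 0"
    unfolding M_def using total_var_emeasure[OF br _ dl, of "- K"] Kb by auto
  have "radon M"
  proof (rule radonI[OF M(1) finM])
    fix B :: "'a set" and e :: real assume Bb: "B \<in> sets borel" and e: "0 < e"
    have "(\<lambda>n. measure M (B \<inter> A n)) \<longlonglongrightarrow> measure M (\<Union>n. B \<inter> A n)"
      using Bb Ab A_mono M(1) by (intro M.finite_Lim_measure_incseq) (auto simp: incseq_def)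
    then have "eventually (\<lambda>n. measure M (\<Union>n. B \<inter> A n) - e / 2 < measure M (B \<inter> A n)) sequentially"
      using e by (intro order_tendstoD) auto
    then obtain n where n: "measure M (\<Union>n. B \<inter> A n) - e / 2 < measure M (B \<inter> A n)"
      by (auto simp: eventually_sequentially)
    have UK: "(\<Union>n. B \<inter> A n) = B \<inter> K" by (auto simp: K_def)
    have BK: "measure M B = measure M (B \<inter> K)"
    proof -
      have "measure M B = measure M (B \<inter> K \<union> (B - K))" by (rule arg_cong[where f="measure M"]) auto
      also have "\<dots> = measure M (B \<inter> K) + measure M (B - K)"
        using Bb Kb M(1) by (intro M.finite_measure_Union) auto
      finally have *: "measure M B = measure M (B \<inter> K) + measure M (B - K)" .
      have "measure M (B - K) \<le> measure M (- K)"
        using Bb Kb M(1) by (intro M.finite_measure_mono) auto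
      moreover have "measure M (- K) = 0" using MK by (simp add: measure_def)
      ultimately have "measure M (B - K) = 0" using measure_nonneg[of M "B - K"] by linarith
      with * show ?thesis by simp
    qed
    have "\<exists>C. compact C \<and> C \<subseteq> B \<inter> A n \<and> measure M (B \<inter> A n) < measure M C + e / 2"
    proof (rule ccontr)
      assume no: "\<not> ?thesis"
      \<comment> \<open>The bound is cut off at 0 to stay meaningful in \<open>ennreal\<close>. It
        forces the measure of \<open>B \<inter> A n\<close> to be 0, and that case is refuted by the
        empty compact set.\<close>
      have "total_var cborel m (B \<inter> A n) \<le> ennreal (max 0 (measure M (B \<inter> A n) - e / 2))"
        unfolding reg[OF IA[OF Bb]]
      proof (rule SUP_least)
        fix C assume C: "C \<in> {C. C \<subseteq> B \<inter> A n \<and> compact C}"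
        then have "\<not> measure M (B \<inter> A n) < measure M C + e / 2" using no by blast
        then have "measure M C \<le> measure M (B \<inter> A n) - e / 2" by simp
        moreover have "total_var cborel m C = ennreal (measure M C)"
          using Mm[of C n] C by (simp add: compact_imp_borel M.emeasure_eq_measure)
        ultimately show "total_var cborel m C \<le> ennreal (max 0 (measure M (B \<inter> A n) - e / 2))"
          by (simp add: ennreal_leI)
      qed
      moreover have "total_var cborel m (B \<inter> A n) = ennreal (measure M (B \<inter> A n))"
        using Mm[of "B \<inter> A n" n] Bb Ab by (simp add: M.emeasure_eq_measure)
      ultimately have "measure M (B \<inter> A n) \<le> max 0 (measure M (B \<inter> A n) - e / 2)"
        by simp
      then have "measure M (B \<inter> A n) \<le> 0" using e by (auto simp: max_def split: if_splits)
      moreover have "\<not> measure M (B \<inter> A n) < measure M {} + e / 2" using no compact_empty by blast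
      ultimately show False using e by simp
    qed
    then obtain C where C: "compact C" "C \<subseteq> B \<inter> A n" "measure M (B \<inter> A n) < measure M C + e / 2" by blast
    have "measure M (B - C) = measure M B - measure M C"
      using C Bb M(1) by (intro M.finite_measure_Diff) (auto simp: compact_imp_borel)
    then have "measure M (B - C) < e" using n BK UK C(3) by simp
    then show "\<exists>C. compact C \<and> C \<subseteq> B \<and> measure M (B - C) < e" using C by blast
  qed
  then show ?thesis using m_eq sgn_h int by blast
qed

section \<open>Weighted spaces of measures\<close>

lemma bounded_on_cborel:
  fixes f :: "'a::t2_space \<Rightarrow> 'b::real_normed_vector"
  assumes f: "continuous_on UNIV f" and A: "A \<in> cborel"
  shows "\<exists>c>0. \<forall>x\<in>A. norm (f x) \<le> c"
proof -
  have "compact (f ` closure A)"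
    using A f by (intro compact_continuous_image) (auto simp: cborel_def intro: continuous_on_subset)
  then obtain c where "0 < c" "\<forall>y\<in>f ` closure A. norm y \<le> c"
    using compact_imp_bounded bounded_pos by metis
  then show ?thesis using closure_subset[of A] by (intro exI[of _ c]) auto
qed

lemma carried_by_const: "A \<in> R \<Longrightarrow> (\<And>x. x \<notin> A \<Longrightarrow> f x = 0) \<Longrightarrow> carried_by R (\<lambda>_. A) f"
  by (auto simp: carried_by_def incseq_def)

text \<open>Each member exhausts a Borel set by countably many compacts up to a null set of its own.
  All these compacts together, still countably many, do so for every member at once and hence for
  the sum.\<close>

lemma radon_dominating:
  fixes N :: "nat \<Rightarrow> 'a::t2_space measure"
  assumes N: "\<And>n. radon (N n)"
  shows "\<exists>M. radon M \<and> (\<forall>n. absolutely_continuous M (N n))"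
proof -
  \<comment> \<open>The factor makes the mass of \<open>N' n\<close> at most 2 to the power -n, so
    the sum is finite; \<open>1 +\<close> avoids division by 0, and positivity of \<open>c n\<close>
    preserves null sets.\<close>
  define c where "c n = 1 / (2 ^ n * (1 + measure (N n) UNIV))" for n
  have c: "0 < c n" for n by (simp add: c_def add_pos_nonneg)
  define N' where "N' n = scale_measure (ennreal (c n)) (N n)" for n
  have sN: "sets (N' n) = sets borel" for n using radonD[OF N] by (simp add: N'_def)
  then have sN': "sets (N' n) = sets (N' 0)" for n by simp
  define M where "M = series_measure N'"
  have sM: "sets M = sets borel" by (simp add: M_def sets_series_measure sN)
  have spM: "space M = UNIV" using sets_eq_imp_space_eq[OF sM] by simp
  have em: "emeasure M B = (\<Sum>n. emeasure (N' n) B)" if "B \<in> sets borel" for B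
    unfolding M_def using that sN by (intro emeasure_series_measure[of N', OF sN']) simp
  have le: "emeasure (N' n) UNIV \<le> ennreal ((1/2) ^ n)" for n
  proof -
    interpret finite_measure "N n" using N by (rule radonD)
    define a where "a = measure (N n) UNIV"
    have a: "0 \<le> a" by (simp add: a_def)
    then have "(1/2) ^ n * (a / (1 + a)) \<le> (1/2) ^ n * (1::real)" by (intro mult_left_mono) auto
    moreover have "c n * a = (1/2) ^ n * (a / (1 + a))" by (simp add: c_def a_def power_one_over)
    ultimately have "c n * measure (N n) UNIV \<le> (1/2) ^ n" by (simp add: a_def)
    then show ?thesis
      using c[of n] by (simp add: N'_def emeasure_eq_measure ennreal_mult[symmetric] ennreal_leI)
  qed
  have "emeasure M UNIV \<le> (\<Sum>n. ennreal ((1/2) ^ n))"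
    unfolding em[OF borel_open[OF open_UNIV]] by (intro suminf_le le) auto
  also have "\<dots> < \<infinity>"
    by (subst suminf_ennreal2) (auto intro: summable_geometric)
  finally have finM: "finite_measure M" by (intro finite_measureI) (simp add: spM)
  have ac: "absolutely_continuous M (N n)" for n
  proof -
    have "absolutely_continuous M (N' n)"
      unfolding M_def by (rule absolutely_continuous_series_measure[of N', OF sN'])
    then show ?thesis
      using c[of n] sN[of n] radonD(1)[OF N, of n]
      by (auto simp: absolutely_continuous_def N'_def null_sets_def)
  qed
  have "radon M"
  proof (rule radonI_sequence[OF sM finM])
    fix B :: "'a set" assume B: "B \<in> sets borel"
    have "\<exists>C::nat \<Rightarrow> 'a set. (\<forall>k. compact (C k) \<and> C k \<subseteq> B) \<and> emeasure (N n) (B - (\<Union>k. C k)) = 0" for n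
      using radon_compacts[OF N[of n] B] by metis
    then obtain C :: "nat \<Rightarrow> nat \<Rightarrow> 'a set"
      where C: "\<And>n k. compact (C n k)" "\<And>n k. C n k \<subseteq> B" "\<And>n. emeasure (N n) (B - (\<Union>k. C n k)) = 0"
      by metis
    define K where "K i = C (fst (prod_decode i)) (snd (prod_decode i))" for i
    have KC: "C n k \<subseteq> (\<Union>i. K i)" for n k
      using UN_upper[of "prod_encode (n, k)" UNIV K] by (simp add: K_def)
    have Kb: "K i \<in> sets borel" for i unfolding K_def by (rule compact_imp_borel[OF C(1)])
    have "emeasure (N' n) (B - (\<Union>i. K i)) = 0" for n
    proof -
      have "emeasure (N n) (B - (\<Union>i. K i)) \<le> emeasure (N n) (B - (\<Union>k. C n k))"
        using B KC compact_imp_borel[OF C(1)] radonD(1)[OF N, of n] by (intro emeasure_mono) blast+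
      then show ?thesis using C(3)[of n] by (simp add: N'_def)
    qed
    then have "emeasure M (B - (\<Union>i. K i)) = 0" using em[of "B - (\<Union>i. K i)"] B Kb by simp
    moreover have "compact (K i) \<and> K i \<subseteq> B" for i using C by (simp add: K_def)
    ultimately show "\<exists>C::nat \<Rightarrow> 'a set. (\<forall>n. compact (C n) \<and> C n \<subseteq> B) \<and> emeasure M (B - (\<Union>n. C n)) = 0" by blast
  qed
  then show ?thesis using ac by blast
qed

text \<open>Submultiplicativity is left to \<open>group_weight\<close>, so that the same theory
  applies to the weight \<open>\<omega> s * \<omega> t\<close> on pairs.\<close>

locale weight =
  fixes \<omega> :: "'a::t2_space \<Rightarrow> real"
  assumes cont: "continuous_on UNIV \<omega>" and pos: "\<And>x. 0 < \<omega> x"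
begin

lemma nonzero: "\<omega> x \<noteq> 0"
  using pos[of x] by simp

lemma measurable_weight[measurable]: "\<omega> \<in> borel_measurable borel"
  using cont by (rule borel_measurable_continuous_onI)

lemma cont_complex: "continuous_on UNIV (\<lambda>x. complex_of_real (\<omega> x))"
  using cont by (intro continuous_intros)

lemma cont_inverse: "continuous_on UNIV (\<lambda>x. 1 / \<omega> x)"
  using cont nonzero by (intro continuous_intros) auto

text \<open>Integrability is asked of \<open>\<omega> x * h x\<close>. Where the weight is small
  \<open>h\<close> may fail to be integrable, which is how unbounded measures are represented over a
  finite \<open>M\<close>.\<close>

definition weighted_density :: "'a measure \<Rightarrow> ('a \<Rightarrow> complex) \<Rightarrow> bool" where
  "weighted_density M h \<longleftrightarrow> radon M \<and> h \<in> borel_measurable borel \<and> integrable M (\<lambda>x. of_real (\<omega> x) * h x)"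

lemma weighted_densityD:
  assumes "weighted_density M h"
  shows "radon M" "h \<in> borel_measurable borel" "integrable M (\<lambda>x. of_real (\<omega> x) * h x)"
    "sets M = sets borel" "finite_measure M"
  using assms radonD[of M] by (auto simp: weighted_density_def)

lemma integrable_weight_bound:
  assumes wd: "weighted_density M h" and f: "f \<in> borel_measurable borel" and b: "\<And>x. norm (f x) \<le> c * \<omega> x"
  shows "integrable M (\<lambda>x. f x * h x)"
proof (rule Bochner_Integration.integrable_bound)
  note [measurable] = weighted_densityD(2)[OF wd] f and [measurable_cong] = weighted_densityD(4)[OF wd]
  show "integrable M (\<lambda>x. of_real c * (of_real (\<omega> x) * h x))"
    by (intro integrable_mult_right weighted_densityD(3)[OF wd])
  show "AE x in M. norm (f x * h x) \<le> norm (of_real c * (of_real (\<omega> x) * h x))"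
  proof (rule AE_I2)
    fix x
    have "norm (f x) \<le> \<bar>c\<bar> * \<omega> x" using b[of x] pos[of x] by (smt (verit) mult_right_mono)
    then have "norm (f x) * norm (h x) \<le> (\<bar>c\<bar> * \<omega> x) * norm (h x)" by (rule mult_right_mono) simp
    then show "norm (f x * h x) \<le> norm (of_real c * (of_real (\<omega> x) * h x))"
      using pos[of x] by (simp add: norm_mult mult.assoc)
  qed
  show "(\<lambda>x. f x * h x) \<in> borel_measurable M" by measurable
qed

text \<open>The reciprocal of the weight is continuous, hence bounded on a set of compact closure.
  This brings indicators of members of \<open>cborel\<close> under the bound by a multiple of
  \<open>\<omega>\<close> that all integrability arguments use.\<close>

lemma indicator_weight_bound:
  assumes A: "A \<in> cborel"
  shows "\<exists>c. \<forall>x. indicator A x \<le> c * \<omega> x"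
proof -
  obtain c where c: "0 < c" "\<And>x. x \<in> A \<Longrightarrow> norm (1 / \<omega> x) \<le> c"
    using bounded_on_cborel[OF cont_inverse A] by auto
  have "indicator A x \<le> c * \<omega> x" for x
    using c(2)[of x] pos[of x] c(1) by (auto simp: indicator_def field_simps abs_of_pos)
  then show ?thesis by blast
qed

lemma weighted_density_locally_integrable:
  assumes wd: "weighted_density M h"
  shows "locally_integrable M h"
  unfolding locally_integrable_def
proof (intro conjI ballI weighted_densityD(2)[OF wd])
  fix A :: "'a set" assume A: "A \<in> cborel"
  obtain c where c: "\<And>x. indicator A x \<le> c * \<omega> x" using indicator_weight_bound[OF A] by blast
  have "integrable M (\<lambda>x. indicator A x * h x)"
  proof (rule integrable_weight_bound[OF wd])
    show "norm (indicator A x :: complex) \<le> c * \<omega> x" for x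
      using c[of x] by (cases "x \<in> A") auto
  qed (use A in \<open>auto simp: cborel_def\<close>)
  moreover have "indicator A x *\<^sub>R h x = indicator A x * h x" for x by (simp add: indicator_def)
  ultimately show "set_integrable M A h" by (simp add: set_integrable_def)
qed

lemma fun_times_meas:
  assumes wd: "weighted_density M h"
  shows "fun_times_measure (\<lambda>x. of_real (\<omega> x)) (meas M h) = meas M (\<lambda>x. of_real (\<omega> x) * h x)"
proof
  fix A :: "'a set"
  note [measurable] = weighted_densityD(2)[OF wd] and [measurable_cong] = weighted_densityD(4)[OF wd]
  show "fun_times_measure (\<lambda>x. of_real (\<omega> x)) (meas M h) A = meas M (\<lambda>x. of_real (\<omega> x) * h x) A"
  proof (cases "A \<in> cborel")
    case True
    then have [measurable]: "A \<in> sets borel" by (simp add: cborel_def)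
    have eq: "of_real (\<omega> x) * indicator A x * h x = indicator A x *\<^sub>R (of_real (\<omega> x) * h x)" for x
      by (simp add: indicator_def)
    have "dr_integral cborel (meas M h) (\<lambda>x. of_real (\<omega> x) * indicator A x) =
        (\<integral>x. of_real (\<omega> x) * indicator A x * h x \<partial>M)"
    proof (rule dr_integral_density[OF borel_ring_cborel])
      show "density_on (meas M h) B M h" if "B \<in> cborel" for B
        using density_on_meas[OF weighted_densityD(4)[OF wd] weighted_density_locally_integrable[OF wd] that] .
      show "carried_by cborel (\<lambda>_. A) (\<lambda>x. of_real (\<omega> x) * indicator A x)"
        using True by (rule carried_by_const) simp
      show "integrable M (\<lambda>x. of_real (\<omega> x) * indicator A x * h x)"
        unfolding eq by (intro integrable_mult_indicator weighted_densityD(3)[OF wd]) simp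
    qed measurable
    then show ?thesis using True by (simp add: fun_times_measure_def meas_def set_lebesgue_integral_def eq)
  qed (simp add: fun_times_measure_def meas_def)
qed

lemma meas_in_M_weighted:
  assumes wd: "weighted_density M h"
  shows "meas M h \<in> M_weighted \<omega>" "norm_weighted \<omega> (meas M h) = (\<integral>x. \<omega> x * norm (h x) \<partial>M)"
proof -
  note M = weighted_densityD(1)[OF wd] and sM = weighted_densityD(4)[OF wd]
  have li: "locally_integrable M (\<lambda>x. of_real (\<omega> x) * h x)"
    using weighted_densityD(2)[OF wd] weighted_densityD(3)[OF wd]
    by (intro locally_integrable_of_integrable[OF sM]) auto
  have n: "norm (of_real (\<omega> x) * h x) = \<omega> x * norm (h x)" for x
    using pos[of x] by (simp add: norm_mult)
  have i: "integrable M (\<lambda>x. \<omega> x * norm (h x))"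
    using integrable_norm[OF weighted_densityD(3)[OF wd]] unfolding n .
  have "total_mass (meas M (\<lambda>x. of_real (\<omega> x) * h x)) = (\<integral>\<^sup>+x. ennreal (\<omega> x * norm (h x)) \<partial>M)"
    unfolding total_mass_meas[OF M li] n ..
  also have "\<dots> = ennreal (\<integral>x. \<omega> x * norm (h x) \<partial>M)"
    using i pos by (intro nn_integral_eq_integral) (auto simp: less_imp_le)
  finally have t: "total_mass (meas M (\<lambda>x. of_real (\<omega> x) * h x)) = ennreal (\<integral>x. \<omega> x * norm (h x) \<partial>M)" .
  show "meas M h \<in> M_weighted \<omega>"
    using meas_regular[OF M weighted_density_locally_integrable[OF wd]] meas_regular[OF M li] t
    by (simp add: M_weighted_def bounded_regular_measures_def fun_times_meas[OF wd])
  have "0 \<le> (\<integral>x. \<omega> x * norm (h x) \<partial>M)"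
    using pos by (intro Bochner_Integration.integral_nonneg) (auto simp: less_imp_le)
  then show "norm_weighted \<omega> (meas M h) = (\<integral>x. \<omega> x * norm (h x) \<partial>M)"
    unfolding norm_weighted_def fun_times_meas[OF wd] t by simp
qed

text \<open>The product of the weight with \<open>\<nu>\<close> is bounded and so has a density
  \<open>k\<close>, and \<open>k\<close> divided by the weight is the candidate. On a given
  \<open>A\<close>, however, \<open>\<nu>\<close> is known only through a local density
  \<open>g\<close> over another measure \<open>N\<close>; the two are compared by noting that
  \<open>\<omega> x * g x\<close> and \<open>k x\<close> represent the same measure on
  \<open>A\<close>.\<close>

lemma M_weighted_density:
  assumes \<nu>: "\<nu> \<in> M_weighted \<omega>"
  shows "\<exists>M h. weighted_density M h \<and> \<nu> = meas M h"
proof -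
  note R = borel_ring_cborel
  define m where "m = fun_times_measure (\<lambda>x. of_real (\<omega> x)) \<nu>"
  have cm: "complex_measure_on cborel \<nu>" and m: "m \<in> bounded_regular_measures"
    using \<nu> by (auto simp: M_weighted_def regular_measures_def m_def)
  obtain M k where M: "radon M" and k[measurable]: "k \<in> borel_measurable borel" and ki: "integrable M k"
    and mk: "m = meas M k"
    using bounded_regular_density[OF m] by blast
  note sM[measurable_cong] = radonD(1)[OF M]
  define h where "h x = k x / of_real (\<omega> x)" for x
  have h[measurable]: "h \<in> borel_measurable borel" unfolding h_def by measurable
  have wh: "of_real (\<omega> x) * h x = k x" "of_real (1 / \<omega> x) * k x = h x" for x
    using nonzero[of x] by (auto simp: h_def)
  have wd: "weighted_density M h" using M h ki by (simp add: weighted_density_def wh)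
  have "\<nu> = meas M h"
  proof
    fix A :: "'a set"
    show "\<nu> A = meas M h A"
    proof (cases "A \<in> cborel")
      case A: True
      then have Ab[measurable]: "A \<in> sets borel" by (simp add: cborel_def)
      obtain N g where d: "density_on \<nu> A N g" using density_on_exists[OF R A cm] by blast
      note sN[measurable_cong] = density_onD(1)[OF d] and g[measurable] = density_onD(2)[OF d]
      obtain c where c: "\<And>x. x \<in> A \<Longrightarrow> norm (complex_of_real (\<omega> x)) \<le> c"
        using bounded_on_cborel[OF cont_complex A] by blast
      obtain c' where c': "\<And>x. x \<in> A \<Longrightarrow> norm (1 / \<omega> x) \<le> c'"
        using bounded_on_cborel[OF cont_inverse A] by blast
      have gw: "set_integrable N A (\<lambda>x. of_real (\<omega> x) * g x)"
        by (rule set_integrable_bounded_mult[OF d Ab _ c]) measurable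
      have mB: "m B = (LINT x:B|N. of_real (\<omega> x) * g x)" if [measurable]: "B \<in> sets borel" and "B \<subseteq> A" for B
      proof -
        have B: "B \<in> cborel" using borel_ring_subset[OF R A that] .
        have "m B = dr_integral cborel \<nu> (\<lambda>x. of_real (\<omega> x) * indicator B x)"
          using B by (simp add: m_def fun_times_measure_def)
        also have "\<dots> = (LINT x:B|N. of_real (\<omega> x) * indicator B x * g x)"
          by (rule dr_integral_bounded[OF R density_on_exists[OF R _ cm] B density_on_subset[OF d that], where c="c"])
            (use c that(2) in \<open>auto simp: norm_mult indicator_def split: if_splits\<close>)
        also have "\<dots> = (LINT x:B|N. of_real (\<omega> x) * g x)"
          unfolding set_lebesgue_integral_def by (intro Bochner_Integration.integral_cong) (auto simp: indicator_def)
        finally show ?thesis .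
      qed
      have d1: "density_on m A N (\<lambda>x. of_real (\<omega> x) * g x)"
        unfolding density_on_def using gw mB sN by auto
      have d2: "density_on m A M k"
        unfolding mk using density_on_meas[OF sM locally_integrable_of_integrable[OF sM k ki] A] .
      have fm: "(\<lambda>x. complex_of_real (1 / \<omega> x)) \<in> borel_measurable borel" by measurable
      have b: "norm (complex_of_real (1 / \<omega> x)) \<le> c'" if "x \<in> A" for x
        using c'[OF that] by (simp add: norm_divide)
      \<comment> \<open>\<open>integral_on\<close> does not mention a density, so both densities of \<open>m\<close> integrate \<open>1 / \<omega>\<close> to the same value.\<close>
      have "(LINT x:A|N. of_real (1 / \<omega> x) * (of_real (\<omega> x) * g x)) = integral_on cborel m A (\<lambda>x. of_real (1 / \<omega> x))"
        by (rule integral_on_density[OF R A d1 fm set_integrable_bounded_mult[OF d1 Ab fm b], symmetric])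
      also have "\<dots> = (LINT x:A|M. of_real (1 / \<omega> x) * k x)"
        by (rule integral_on_density[OF R A d2 fm set_integrable_bounded_mult[OF d2 Ab fm b]])
      finally have "(LINT x:A|N. g x) = (LINT x:A|M. h x)"
        using nonzero unfolding wh by (simp add: mult.assoc[symmetric])
      then show ?thesis using density_onD(4)[OF d Ab order_refl] A by (simp add: meas_def)
    next
      case False
      then show ?thesis using cm by (simp add: meas_def complex_measure_on_def)
    qed
  qed
  with wd show ?thesis by blast
qed

text \<open>Over a shared reference measure, sums and limits of measures become sums and limits of
  functions.\<close>

lemma common_weighted_density:
  assumes F: "\<And>n::nat. F n \<in> M_weighted \<omega>"
  shows "\<exists>M h. radon M \<and> (\<forall>n. weighted_density M (h n) \<and> F n = meas M (h n))"
proof -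
  have "\<forall>n. \<exists>M h. weighted_density M h \<and> F n = meas M h" using M_weighted_density[OF F] by blast
  then obtain N g where N: "\<And>n. weighted_density (N n) (g n)" "\<And>n. F n = meas (N n) (g n)" by metis
  obtain M where M: "radon M" and ac: "\<And>n. absolutely_continuous M (N n)"
    using radon_dominating[of N] weighted_densityD(1)[OF N(1)] by blast
  have "\<exists>h. weighted_density M h \<and> F n = meas M h" for n
  proof -
    note sM[measurable_cong] = radonD(1)[OF M] and g[measurable] = weighted_densityD(2)[OF N(1)[of n]]
    obtain D :: "'a \<Rightarrow> real" where Dm: "D \<in> borel_measurable M" and D0: "\<And>x. 0 \<le> D x"
      and D: "N n = density M (\<lambda>x. ennreal (D x))"
      using real_density_of_absolutely_continuous[OF radonD(2)[OF M] weighted_densityD(5)[OF N(1)] _ ac]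
        weighted_densityD(4)[OF N(1)] sM by metis
    have [measurable]: "D \<in> borel_measurable borel" using Dm sM by (simp cong: measurable_cong_sets)
    define h where "h x = of_real (D x) * g n x" for x
    have "integrable M (\<lambda>x. D x *\<^sub>R (of_real (\<omega> x) * g n x))"
      using weighted_densityD(3)[OF N(1)[of n]] D0 unfolding D by (subst (asm) integrable_density) auto
    then have "integrable M (\<lambda>x. of_real (\<omega> x) * h x)"
      by (simp add: h_def scaleR_conv_of_real mult_ac)
    moreover have "h \<in> borel_measurable borel" unfolding h_def by measurable
    ultimately have "weighted_density M h" using M by (simp add: weighted_density_def)
    moreover have "F n = meas M h"
    proof
      fix A
      show "F n A = meas M h A"
      proof (cases "A \<in> cborel")
        case True
        then have [measurable]: "A \<in> sets borel" by (simp add: cborel_def)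
        have "(LINT x:A|N n. g n x) = (\<integral>x. D x *\<^sub>R (indicator A x *\<^sub>R g n x) \<partial>M)"
          unfolding D set_lebesgue_integral_def using D0 by (subst integral_density) auto
        also have "\<dots> = (LINT x:A|M. h x)"
          unfolding set_lebesgue_integral_def
          by (intro Bochner_Integration.integral_cong) (auto simp: h_def scaleR_conv_of_real)
        finally show ?thesis using True by (simp add: N(2) meas_def)
      qed (simp add: N(2) meas_def)
    qed
    ultimately show ?thesis by blast
  qed
  then show ?thesis using M by metis
qed

lemma common_weighted_density2:
  assumes "\<mu> \<in> M_weighted \<omega>" "\<nu> \<in> M_weighted \<omega>"
  obtains M g h where "weighted_density M g" "weighted_density M h" "\<mu> = meas M g" "\<nu> = meas M h"
proof -
  have "(if n = 0 then \<mu> else \<nu>) \<in> M_weighted \<omega>" for n :: nat using assms by simp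
  from common_weighted_density[of "\<lambda>n. if n = 0 then \<mu> else \<nu>", OF this]
  obtain M k where "\<forall>n::nat. weighted_density M (k n) \<and> (if n = 0 then \<mu> else \<nu>) = meas M (k n)"
    by blast
  then have "weighted_density M (k 0)" "weighted_density M (k 1)" "\<mu> = meas M (k 0)" "\<nu> = meas M (k 1)"
    by (metis one_neq_zero)+
  then show ?thesis by (rule that)
qed

section \<open>Banach space structure\<close>

lemma weighted_density_add:
  assumes "weighted_density M g" "weighted_density M h"
  shows "weighted_density M (\<lambda>x. g x + h x)"
  using assms by (auto simp: weighted_density_def algebra_simps)

lemma weighted_density_cmult:
  assumes "weighted_density M h"
  shows "weighted_density M (\<lambda>x. c * h x)"
  using assms by (auto simp: weighted_density_def mult.left_commute)

lemma meas_add: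
  assumes "weighted_density M g" "weighted_density M h"
  shows "meas M (\<lambda>x. g x + h x) = (\<lambda>A. meas M g A + meas M h A)"
proof
  fix A
  show "meas M (\<lambda>x. g x + h x) A = meas M g A + meas M h A"
    using assms[THEN weighted_density_locally_integrable]
    by (auto simp: meas_def locally_integrable_def intro!: set_integral_add)
qed

lemma meas_cmult: "meas M (\<lambda>x. c * h x) = (\<lambda>A. c * meas M h A)"
  by (auto simp: meas_def set_lebesgue_integral_def)

lemma weighted_norm_integrable:
  assumes wd: "weighted_density M h"
  shows "integrable M (\<lambda>x. \<omega> x * norm (h x))"
  using integrable_norm[OF weighted_densityD(3)[OF wd]] pos by (simp add: norm_mult abs_of_pos)

lemma banach_M_weighted: "banach_space_on (M_weighted \<omega>) (norm_weighted \<omega>)"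
  unfolding banach_space_on_def
proof (intro conjI ballI allI impI)
  have wd0: "weighted_density (null_measure borel) (\<lambda>_. 0)"
    by (auto simp: weighted_density_def intro!: radonI_sequence finite_measureI)
  have "meas (null_measure borel :: 'a measure) (\<lambda>_. 0) = (\<lambda>_. 0)"
    by (auto simp: meas_def set_lebesgue_integral_def)
  then show "(\<lambda>_. 0) \<in> M_weighted \<omega>" using meas_in_M_weighted(1)[OF wd0] by simp
next
  fix f g assume fg: "f \<in> M_weighted \<omega>" "g \<in> M_weighted \<omega>"
  obtain M h k where *: "weighted_density M h" "weighted_density M k" "f = meas M h" "g = meas M k"
    using common_weighted_density2[OF fg] .
  note wa = weighted_density_add[OF *(1,2)]
  have eq: "(\<lambda>x. f x + g x) = meas M (\<lambda>x. h x + k x)" by (simp add: * meas_add)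
  show "(\<lambda>x. f x + g x) \<in> M_weighted \<omega>" unfolding eq by (rule meas_in_M_weighted(1)[OF wa])
  have "(\<integral>x. \<omega> x * norm (h x + k x) \<partial>M) \<le> (\<integral>x. \<omega> x * norm (h x) + \<omega> x * norm (k x) \<partial>M)"
  proof (intro integral_mono Bochner_Integration.integrable_add weighted_norm_integrable wa *(1,2))
    fix x
    have "\<omega> x * norm (h x + k x) \<le> \<omega> x * (norm (h x) + norm (k x))"
      using pos[of x] by (intro mult_left_mono norm_triangle_ineq) simp
    then show "\<omega> x * norm (h x + k x) \<le> \<omega> x * norm (h x) + \<omega> x * norm (k x)" by (simp add: distrib_left)
  qed
  also have "\<dots> = norm_weighted \<omega> f + norm_weighted \<omega> g"
    unfolding *(3,4) meas_in_M_weighted(2)[OF *(1)] meas_in_M_weighted(2)[OF *(2)]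
    by (intro Bochner_Integration.integral_add weighted_norm_integrable *(1,2))
  finally show "norm_weighted \<omega> (\<lambda>x. f x + g x) \<le> norm_weighted \<omega> f + norm_weighted \<omega> g"
    unfolding eq meas_in_M_weighted(2)[OF wa] .
next
  fix c f assume f: "f \<in> M_weighted \<omega>"
  obtain M h where *: "weighted_density M h" "f = meas M h" using M_weighted_density[OF f] by blast
  note wc = weighted_density_cmult[OF *(1), of c]
  have eq: "(\<lambda>x. c * f x) = meas M (\<lambda>x. c * h x)" by (simp add: * meas_cmult)
  show "(\<lambda>x. c * f x) \<in> M_weighted \<omega>" unfolding eq by (rule meas_in_M_weighted(1)[OF wc])
  show "norm_weighted \<omega> (\<lambda>x. c * f x) = norm c * norm_weighted \<omega> f"
  proof -
    have "norm_weighted \<omega> (\<lambda>x. c * f x) = (\<integral>x. \<omega> x * norm (c * h x) \<partial>M)" unfolding eq by (rule meas_in_M_weighted(2)[OF wc])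
    moreover have "norm_weighted \<omega> f = (\<integral>x. \<omega> x * norm (h x) \<partial>M)" unfolding *(2) by (rule meas_in_M_weighted(2)[OF *(1)])
    ultimately show ?thesis by (simp add: norm_mult mult.left_commute)
  qed
next
  fix f assume f: "f \<in> M_weighted \<omega>"
  obtain M h where *: "weighted_density M h" "f = meas M h" using M_weighted_density[OF f] by blast
  note i = weighted_norm_integrable[OF *(1)]
  show "0 \<le> norm_weighted \<omega> f"
    unfolding *(2) meas_in_M_weighted(2)[OF *(1)] using pos by (intro Bochner_Integration.integral_nonneg) (auto simp: less_imp_le)
  assume "norm_weighted \<omega> f = 0"
  then have "(\<integral>x. \<omega> x * norm (h x) \<partial>M) = 0" unfolding *(2) meas_in_M_weighted(2)[OF *(1)] .
  then have "AE x in M. \<omega> x * norm (h x) = 0"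
    using i pos by (subst (asm) integral_nonneg_eq_0_iff_AE) (auto simp: less_imp_le)
  then have ae: "AE x in M. h x = 0" by (rule AE_mp) (use nonzero in auto)
  show "f = (\<lambda>_. 0)"
  proof
    fix A
    have "(LINT x:A|M. h x) = (\<integral>x. 0 \<partial>M)" if "A \<in> cborel"
      unfolding set_lebesgue_integral_def
    proof (rule integral_cong_AE)
      show "(\<lambda>x. indicator A x *\<^sub>R h x) \<in> borel_measurable M"
        using weighted_densityD(2,4)[OF *(1)] that by (auto simp: cborel_def cong: measurable_cong_sets)
      show "AE x in M. indicator A x *\<^sub>R h x = 0" using ae by (rule AE_mp) auto
    qed simp
    then show "f A = 0" by (simp add: *(2) meas_def)
  qed
next
  fix F :: "nat \<Rightarrow> 'a set \<Rightarrow> complex"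
  assume as: "range F \<subseteq> M_weighted \<omega> \<and> (\<forall>e>0. \<exists>k. \<forall>m\<ge>k. \<forall>n\<ge>k. norm_weighted \<omega> (\<lambda>x. F m x - F n x) < e)"
  then have F: "\<And>n. F n \<in> M_weighted \<omega>" by auto
  obtain M h where M: "radon M" and wd: "\<And>n. weighted_density M (h n)" and Fh: "\<And>n. F n = meas M (h n)"
    using common_weighted_density[of F, OF F] by blast
  note sM[measurable_cong] = radonD(1)[OF M]
  have [measurable]: "h n \<in> borel_measurable borel" for n using weighted_densityD(2)[OF wd] .
  have diff: "norm_weighted \<omega> (\<lambda>A. meas M g A - meas M k A) = (\<integral>x. norm (of_real (\<omega> x) * g x - of_real (\<omega> x) * k x) \<partial>M)"
    if g: "weighted_density M g" and k: "weighted_density M k" for g k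
  proof -
    note w = weighted_density_add[OF g weighted_density_cmult[OF k, of "-1"]]
    have "(\<lambda>A. meas M g A - meas M k A) = meas M (\<lambda>x. g x + (-1) * k x)"
      unfolding meas_add[OF g weighted_density_cmult[OF k]] meas_cmult by simp
    then have "norm_weighted \<omega> (\<lambda>A. meas M g A - meas M k A) = (\<integral>x. \<omega> x * norm (g x + (-1) * k x) \<partial>M)"
      using meas_in_M_weighted(2)[OF w] by simp
    also have "\<dots> = (\<integral>x. norm (of_real (\<omega> x) * g x - of_real (\<omega> x) * k x) \<partial>M)"
      using pos by (intro Bochner_Integration.integral_cong) (auto simp: norm_mult abs_of_pos right_diff_distrib[symmetric])
    finally show ?thesis .
  qed
  \<comment> \<open>With the weight absorbed into the density, the weighted norm of a difference is
    a plain L1 distance; the limit is divided by the weight at the end to give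
    \<open>g\<close>.\<close>
  define s where "s n x = of_real (\<omega> x) * h n x" for n x
  have si: "integrable M (s n)" for n unfolding s_def using weighted_densityD(3)[OF wd] .
  have [measurable]: "s n \<in> borel_measurable borel" for n unfolding s_def by measurable
  have cauchy: "\<exists>k. \<forall>i\<ge>k. \<forall>j\<ge>k. (\<integral>x. norm (s i x - s j x) \<partial>M) < e" if "0 < e" for e
    using as that unfolding Fh diff[OF wd wd] s_def by blast
  obtain r where r: "strict_mono r" "AE x in M. Cauchy (\<lambda>i. s (r i) x)"
    using cauchy_L1_AE_cauchy_subseq[of M s] si cauchy by metis
  define S where "S x = lim (\<lambda>i. s (r i) x)" for x
  have [measurable]: "S \<in> borel_measurable borel" unfolding S_def by measurable
  have SAE: "AE x in M. (\<lambda>i. s (r i) x) \<longlonglongrightarrow> S x"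
    using r(2) by (rule AE_mp) (auto simp: S_def Cauchy_convergent_iff convergent_LIMSEQ_iff)
  \<comment> \<open>Fatou along the almost everywhere convergent subsequence. As \<open>r i\<close>
    is at least \<open>i\<close>, the Cauchy bound applies to \<open>s m\<close> against
    \<open>s (r i)\<close>, so the estimate holds for every \<open>m\<close> past \<open>k\<close>
    and not only along the subsequence.\<close>
  have fat: "(\<integral>\<^sup>+x. ennreal (norm (s m x - S x)) \<partial>M) \<le> ennreal e"
    if m: "\<forall>i\<ge>k. \<forall>j\<ge>k. (\<integral>x. norm (s i x - s j x) \<partial>M) < e" "k \<le> m" for k m e
  proof -
    have "(\<integral>\<^sup>+x. ennreal (norm (s m x - S x)) \<partial>M) = (\<integral>\<^sup>+x. liminf (\<lambda>i. ennreal (norm (s m x - s (r i) x))) \<partial>M)"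
    proof (rule nn_integral_cong_AE, use SAE in eventually_elim)
      case (elim x)
      then have "(\<lambda>i. ennreal (norm (s m x - s (r i) x))) \<longlonglongrightarrow> ennreal (norm (s m x - S x))"
        by (intro tendsto_intros tendsto_ennrealI)
      then show ?case using lim_imp_Liminf[OF trivial_limit_sequentially] by metis
    qed
    also have "\<dots> \<le> liminf (\<lambda>i. \<integral>\<^sup>+x. ennreal (norm (s m x - s (r i) x)) \<partial>M)"
      by (rule nn_integral_liminf) measurable
    also have "\<dots> \<le> limsup (\<lambda>i. \<integral>\<^sup>+x. ennreal (norm (s m x - s (r i) x)) \<partial>M)"
      by (rule Liminf_le_Limsup) simp
    also have "\<dots> \<le> ennreal e"
    proof (rule Limsup_bounded)
      show "\<forall>\<^sub>F i in sequentially. (\<integral>\<^sup>+x. ennreal (norm (s m x - s (r i) x)) \<partial>M) \<le> ennreal e"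
      proof (rule eventually_sequentiallyI[of k])
        fix i assume "k \<le> i"
        then have "k \<le> r i" using seq_suble[OF r(1), of i] by simp
        then have "(\<integral>x. norm (s m x - s (r i) x) \<partial>M) < e" using m by blast
        moreover have "(\<integral>\<^sup>+x. ennreal (norm (s m x - s (r i) x)) \<partial>M) = ennreal (\<integral>x. norm (s m x - s (r i) x) \<partial>M)"
          using si by (intro nn_integral_eq_integral) auto
        ultimately show "(\<integral>\<^sup>+x. ennreal (norm (s m x - s (r i) x)) \<partial>M) \<le> ennreal e"
          by (simp add: ennreal_leI less_imp_le)
      qed
    qed
    finally show ?thesis .
  qed
  have di: "integrable M (\<lambda>x. s m x - S x)" if m: "\<forall>i\<ge>k. \<forall>j\<ge>k. (\<integral>x. norm (s i x - s j x) \<partial>M) < e" "k \<le> m" for k m e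
    using fat[OF m] by (intro integrableI_bounded) (auto simp: order_le_less_trans)
  obtain k where k: "\<forall>i\<ge>k. \<forall>j\<ge>k. (\<integral>x. norm (s i x - s j x) \<partial>M) < 1" using cauchy[of 1] by auto
  have Si: "integrable M S"
    using Bochner_Integration.integrable_diff[OF si[of k] di[OF k order_refl]] by simp
  define g where "g x = S x / of_real (\<omega> x)" for x
  have wg: "of_real (\<omega> x) * g x = S x" for x using nonzero[of x] by (simp add: g_def)
  have wdg: "weighted_density M g"
  proof -
    have "g \<in> borel_measurable borel" unfolding g_def by measurable
    then show ?thesis unfolding weighted_density_def wg using M Si by simp
  qed
  have "(\<lambda>n. norm_weighted \<omega> (\<lambda>x. F n x - meas M g x)) \<longlonglongrightarrow> 0"
  proof (rule LIMSEQ_I)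
    fix e :: real assume "0 < e"
    then obtain k where k: "\<forall>i\<ge>k. \<forall>j\<ge>k. (\<integral>x. norm (s i x - s j x) \<partial>M) < e / 2" using cauchy[of "e / 2"] by auto
    have "norm (norm_weighted \<omega> (\<lambda>x. F n x - meas M g x) - 0) < e" if "k \<le> n" for n
    proof -
      have "norm_weighted \<omega> (\<lambda>x. F n x - meas M g x) = (\<integral>x. norm (s n x - S x) \<partial>M)"
        unfolding Fh diff[OF wd wdg] wg s_def ..
      moreover have "ennreal (\<integral>x. norm (s n x - S x) \<partial>M) \<le> ennreal (e / 2)"
        using fat[OF k that] di[OF k that] by (subst nn_integral_eq_integral[symmetric]) auto
      moreover have "0 \<le> (\<integral>x. norm (s n x - S x) \<partial>M)" by (intro Bochner_Integration.integral_nonneg) auto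
      ultimately show ?thesis using \<open>0 < e\<close> by (simp add: ennreal_le_iff)
    qed
    then show "\<exists>no. \<forall>n\<ge>no. norm (norm_weighted \<omega> (\<lambda>x. F n x - meas M g x) - 0) < e" by blast
  qed
  then show "\<exists>f\<in>M_weighted \<omega>. (\<lambda>n. norm_weighted \<omega> (\<lambda>x. F n x - f x)) \<longlonglongrightarrow> 0"
    using meas_in_M_weighted(1)[OF wdg] by blast
qed

end

section \<open>Products of inner regular measures\<close>

text \<open>The Borel sets that are approximable together with their complement contain the open
  sets and are closed under countable unions. A closed set is cut with a compact set that nearly
  fills the space, which exists because \<open>UNIV\<close> is open. For a union, the countable
  families are merged; for its complement, compacts with summable errors are intersected.\<close>

lemma radon_if_open:
  fixes M :: "'a::t2_space measure"
  assumes M: "sets M = sets borel" "finite_measure M"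
    and op: "\<And>U. open U \<Longrightarrow> \<exists>K. countable K \<and> (\<forall>C\<in>K. compact C \<and> C \<subseteq> U) \<and> emeasure M (U - \<Union>K) = 0"
  shows "radon M"
proof -
  interpret finite_measure M by fact
  define P where "P B \<longleftrightarrow> (\<forall>e>0. \<exists>C. compact C \<and> C \<subseteq> B \<and> measure M (B - C) < e)" for B
  have Piff: "P B \<longleftrightarrow> (\<exists>K. countable K \<and> (\<forall>C\<in>K. compact C \<and> C \<subseteq> B) \<and> emeasure M (B - \<Union>K) = 0)"
    if "B \<in> sets borel" for B
    unfolding P_def using inner_approx_iff[OF M that] by simp
  have Popen: "P U" if "open U" for U
    using op[OF that] Piff[of U] that by simp
  have Q: "B \<in> sets borel \<and> P B \<and> P (- B)" if "B \<in> sigma_sets UNIV {S. open S}" for B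
    using that
  proof (induction rule: sigma_sets.induct)
    case (Basic U)
    then have U: "open U" by simp
    have "P (- U)"
      unfolding P_def
    proof (intro allI impI)
      fix e :: real assume "0 < e"
      then obtain C where C: "compact C" "measure M (UNIV - C) < e"
        using Popen[OF open_UNIV] unfolding P_def by blast
      have "measure M (- U - (C \<inter> - U)) \<le> measure M (UNIV - C)"
      proof (rule finite_measure_mono)
        show "UNIV - C \<in> sets M" using compact_imp_borel[OF C(1)] by (simp add: M(1))
      qed auto
      then show "\<exists>C. compact C \<and> C \<subseteq> - U \<and> measure M (- U - C) < e"
        using C U by (intro exI[of _ "C \<inter> - U"]) (auto simp: compact_Int_closed)
    qed
    then show ?case using U Popen by simp
  next
    case Empty
    then show ?case using Popen[OF open_UNIV] Popen[OF open_empty] by simp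
  next
    case (Compl a)
    then show ?case by (auto simp: Compl_eq_Diff_UNIV[symmetric] intro: borel_comp)
  next
    case (Union A)
    have Ab: "A i \<in> sets borel" for i using Union by blast
    have "\<forall>i. \<exists>K. countable K \<and> (\<forall>C\<in>K. compact C \<and> C \<subseteq> A i) \<and> emeasure M (A i - \<Union>K) = 0"
      using Union Piff by blast
    then obtain K where K: "\<And>i. countable (K i)" "\<And>i C. C \<in> K i \<Longrightarrow> compact C \<and> C \<subseteq> A i"
      "\<And>i. emeasure M (A i - \<Union>(K i)) = 0" by metis
    have Km: "\<Union>(K i) \<in> sets M" for i
      using K(1,2) M by (intro sets.countable_Union) (auto simp: compact_imp_borel)
    have "(\<Union>i. A i - \<Union>(K i)) \<in> null_sets M"
      using K(3) Km Ab M by (intro null_sets_UN null_setsI) auto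
    moreover have "(\<Union>i. A i) - \<Union>(\<Union>i. K i) \<subseteq> (\<Union>i. A i - \<Union>(K i))" by auto
    moreover have "(\<Union>i. A i) - \<Union>(\<Union>i. K i) \<in> sets M"
    proof -
      have "(\<Union>i. A i) - (\<Union>i. \<Union>(K i)) \<in> sets M"
        using Km Ab M by (intro sets.Diff sets.countable_UN) auto
      moreover have "\<Union>(\<Union>i. K i) = (\<Union>i. \<Union>(K i))" by auto
      ultimately show ?thesis by simp
    qed
    ultimately have "(\<Union>i. A i) - \<Union>(\<Union>i. K i) \<in> null_sets M"
      by (metis null_sets_subset)
    then have "emeasure M ((\<Union>i. A i) - \<Union>(\<Union>i. K i)) = 0" by auto
    moreover have UA: "(\<Union>i. A i) \<in> sets borel" using Ab by auto
    ultimately have 1: "P (\<Union>i. A i)"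
      unfolding Piff[OF UA] using K by (intro exI[of _ "\<Union>i. K i"]) blast
    have 2: "P (- (\<Union>i. A i))"
      unfolding P_def
    proof (intro allI impI)
      fix e :: real assume e: "0 < e"
      \<comment> \<open>The errors sum to \<open>e / 2\<close> and not to \<open>e\<close>, because
        passing to the series keeps only a weak inequality.\<close>
      have "\<exists>C. compact C \<and> C \<subseteq> - A i \<and> measure M (- A i - C) < e / 2 * (1/2) ^ Suc i" for i
        using Union e unfolding P_def by (metis half_gt_zero_iff mult_pos_pos zero_less_divide_1_iff zero_less_numeral zero_less_power)
      then obtain C where C: "\<And>i. compact (C i)" "\<And>i. C i \<subseteq> - A i" "\<And>i. measure M (- A i - C i) < e / 2 * (1/2) ^ Suc i"
        by metis
      have Cm: "C i \<in> sets M" for i using C(1) M by (simp add: compact_imp_borel)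
      have sum: "(\<lambda>i. e / 2 * (1/2) ^ Suc i) sums (e / 2 * 1)"
        by (intro sums_mult power_half_series)
      have s2: "summable (\<lambda>i. measure M (- A i - C i))"
        using C(3) by (intro summable_comparison_test'[OF sums_summable[OF sum]]) (auto simp: less_imp_le)
      have "measure M (\<Union>i. - A i - C i) \<le> (\<Sum>i. measure M (- A i - C i))"
        using Cm Ab M s2 by (intro finite_measure_subadditive_countably) auto
      also have "\<dots> \<le> e / 2 * 1"
        using C(3) s2 sum by (intro sums_le[OF _ summable_sums[OF s2] sum]) (auto simp: less_imp_le)
      also have "\<dots> < e" using e by simp
      finally have "measure M (\<Union>i. - A i - C i) < e" .
      moreover have "measure M (- (\<Union>i. A i) - (\<Inter>i. C i)) \<le> measure M (\<Union>i. - A i - C i)"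
        using Cm Ab M by (intro finite_measure_mono) auto
      moreover have "compact (\<Inter>i. C i)"
      proof -
        have "(\<Inter>i. C i) = C 0 \<inter> (\<Inter>i. C i)" by auto
        then show ?thesis using C(1) compact_Int_closed[OF C(1)[of 0], of "\<Inter>i. C i"] by (simp add: closed_INT compact_imp_closed)
      qed
      ultimately show "\<exists>C. compact C \<and> C \<subseteq> - (\<Union>i. A i) \<and> measure M (- (\<Union>i. A i) - C) < e"
        using C(2) by (intro exI[of _ "\<Inter>i. C i"]) force
    qed
    show ?case using 1 2 UA by simp
  qed
  show ?thesis
  proof (rule radonI[OF M])
    fix B :: "'a set" and e :: real assume "B \<in> sets borel" "0 < e"
    then show "\<exists>C. compact C \<and> C \<subseteq> B \<and> measure M (B - C) < e"
      using Q[of B] by (simp add: sets_borel P_def)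
  qed
qed

section \<open>Sections of Borel sets and the product measure\<close>

lemma section_borel: "E \<in> sets borel \<Longrightarrow> (\<lambda>s. (s, t)) -` E \<in> sets (borel :: 'a::topological_space measure)"
  using measurable_sets[of "\<lambda>s. (s, t)" borel borel E]
  by (simp add: borel_measurable_continuous_onI continuous_intros)

lemma measurable_swap_borel: "prod.swap \<in> borel_measurable (borel :: ('a::topological_space \<times> 'b::topological_space) measure)"
  by (intro borel_measurable_continuous_onI continuous_on_swap)

lemma Times_in_borel:
  fixes A :: "'a::topological_space set" and B :: "'b::topological_space set"
  assumes "A \<in> sets borel" "B \<in> sets borel"
  shows "A \<times> B \<in> sets borel"
proof -
  have "A \<times> B = fst -` A \<inter> snd -` B" by auto
  moreover have "fst -` A \<in> sets (borel :: ('a \<times> 'b) measure)" "snd -` B \<in> sets (borel :: ('a \<times> 'b) measure)"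
    using measurable_sets[of "fst :: 'a \<times> 'b \<Rightarrow> 'a" borel borel A] measurable_sets[of "snd :: 'a \<times> 'b \<Rightarrow> 'b" borel borel B] assms
    by (auto simp: borel_measurable_continuous_onI continuous_on_fst continuous_on_snd continuous_on_id)
  ultimately show ?thesis by auto
qed

lemma tube_open:
  fixes U :: "('a::topological_space \<times> 'b::topological_space) set"
  assumes "compact C" "open U" "\<And>s. s \<in> C \<Longrightarrow> (s, t) \<in> U"
  shows "\<exists>B. open B \<and> t \<in> B \<and> C \<times> B \<subseteq> U"
proof -
  have "open (prod.swap -` U)"
    using assms(2) by (intro open_vimage continuous_on_swap)
  then have "\<exists>X0. t \<in> X0 \<and> open X0 \<and> X0 \<times> C \<subseteq> prod.swap -` U"
    using assms by (intro Elementary_Topology.tube_lemma) auto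
  then obtain X0 where "t \<in> X0" "open X0" "X0 \<times> C \<subseteq> prod.swap -` U" by blast
  then show ?thesis by (intro exI[of _ X0]) auto
qed

context
  fixes L :: "'a::t2_space measure"
  assumes L: "radon L"
begin

interpretation L: finite_measure L using L by (rule radonD)

text \<open>Lower semicontinuity. A compact part of the section at \<open>t\<close> still has
  measure above \<open>a\<close>, and by the tube lemma its product with a neighbourhood of
  \<open>t\<close> stays in \<open>U\<close>, so all nearby sections contain it.\<close>

lemma open_section_greater:
  assumes U: "open U"
  shows "open {t::'b::t2_space. a < measure L ((\<lambda>s. (s, t)) -` U)}"
proof (subst open_subopen, rule ballI)
  fix t :: 'b assume "t \<in> {t. a < measure L ((\<lambda>s. (s, t)) -` U)}"
  then have t: "0 < measure L ((\<lambda>s. (s, t)) -` U) - a" by simp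
  have S: "(\<lambda>s. (s, t)) -` U \<in> sets borel" for t using U by (intro section_borel) simp
  obtain C where C: "compact C" "C \<subseteq> (\<lambda>s. (s, t)) -` U"
    "measure L ((\<lambda>s. (s, t)) -` U - C) < measure L ((\<lambda>s. (s, t)) -` U) - a"
    using radon_compact_approx[OF L S t] by blast
  have LC: "a < measure L C"
    using C(3) L.finite_measure_Diff[of "(\<lambda>s. (s, t)) -` U" C] C S radonD(1)[OF L]
    by (simp add: compact_imp_borel)
  obtain B where B: "open B" "t \<in> B" "C \<times> B \<subseteq> U"
    using tube_open[OF C(1) U, of t] C(2) by (metis subsetD vimageD)
  have "a < measure L ((\<lambda>s. (s, u)) -` U)" if "u \<in> B" for u
  proof -
    have "C \<subseteq> (\<lambda>s. (s, u)) -` U" using B(3) that by auto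
    then show ?thesis
      using LC L.finite_measure_mono[of C "(\<lambda>s. (s, u)) -` U"] S[of u] radonD(1)[OF L] by simp
  qed
  then show "\<exists>T. open T \<and> t \<in> T \<and> T \<subseteq> {t. a < measure L ((\<lambda>s. (s, t)) -` U)}"
    using B by (intro exI[of _ B]) auto
qed

text \<open>Induction over the disjoint-union closure of the open sets, where the sections are lower
  semicontinuous. Starting from rectangles would reach only the product sigma-algebra, which may be
  smaller than \<open>borel\<close>.\<close>

lemma measurable_emeasure_section:
  assumes E: "E \<in> sets borel"
  shows "(\<lambda>t::'b::t2_space. emeasure L ((\<lambda>s. (s, t)) -` E)) \<in> borel_measurable borel"
proof -
  note sL = radonD(1)[OF L]
  have "Int_stable {S::('a \<times> 'b) set. open S}" by (auto simp: Int_stable_def)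
  moreover have "{S::('a \<times> 'b) set. open S} \<subseteq> Pow UNIV" by simp
  moreover have "E \<in> sigma_sets UNIV {S. open S}" using E by (simp add: sets_borel)
  ultimately show ?thesis
  proof (induction rule: sigma_sets_induct_disjoint)
    case (basic U)
    have "(\<lambda>t::'b. measure L ((\<lambda>s. (s, t)) -` U)) \<in> borel_measurable borel"
      unfolding borel_measurable_iff_greater using open_section_greater[of U] basic by auto
    then show ?case unfolding L.emeasure_eq_measure by measurable
  next
    case (compl A)
    have A: "(\<lambda>s. (s, t)) -` A \<in> sets L" for t
      using compl section_borel[of A t] sL by (simp add: sets_borel)
    have "(\<lambda>s. (s, t)) -` (UNIV - A) = space L - (\<lambda>s. (s, t)) -` A" for t
      using radonD(3)[OF L] by auto
    then have "emeasure L ((\<lambda>s. (s, t)) -` (UNIV - A)) = emeasure L (space L) - emeasure L ((\<lambda>s. (s, t)) -` A)" for t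
      using A by (simp add: emeasure_compl L.emeasure_finite)
    then show ?case using compl by simp
  next
    case (union A)
    have A: "(\<lambda>s. (s, t)) -` A i \<in> sets L" for t i
      using union section_borel[of "A i" t] sL by (auto simp: sets_borel)
    have "emeasure L ((\<lambda>s. (s, t)) -` (\<Union>i. A i)) = (\<Sum>i. emeasure L ((\<lambda>s. (s, t)) -` A i))" for t
      unfolding vimage_UN
    proof (rule suminf_emeasure[symmetric])
      show "disjoint_family (\<lambda>i. (\<lambda>s. (s, t)) -` A i)"
        using union(1) unfolding disjoint_family_on_def by blast
    qed (use A in auto)
    then show ?case using union by simp
  qed simp
qed

end

text \<open>The product measure on the Borel sigma-algebra of the product topology, with sections of
  the first variable measured first; \<open>rprod_swap\<close> shows later that the order does not
  matter for inner regular measures.\<close>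

definition rprod :: "'a::t2_space measure \<Rightarrow> 'b::t2_space measure \<Rightarrow> ('a \<times> 'b) measure" where
  "rprod L K = measure_of UNIV (sets borel) (\<lambda>E. \<integral>\<^sup>+t. emeasure L ((\<lambda>s. (s, t)) -` E) \<partial>K)"

lemma sets_rprod[measurable_cong]: "sets (rprod L K) = sets borel"
  unfolding rprod_def using sets.sigma_sets_eq[of borel] by simp

lemma space_rprod: "space (rprod L K) = UNIV"
  using sets_eq_imp_space_eq[OF sets_rprod] by simp

context
  fixes L :: "'a::t2_space measure" and K :: "'b::t2_space measure"
  assumes L: "radon L" and K: "radon K"
begin

interpretation L: finite_measure L using L by (rule radonD)
interpretation K: finite_measure K using K by (rule radonD)

lemma measurable_section[measurable]:
  "E \<in> sets borel \<Longrightarrow> (\<lambda>t. emeasure L ((\<lambda>s. (s, t)) -` E)) \<in> borel_measurable K"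
  using measurable_emeasure_section[OF L] radonD(1)[OF K] by (simp cong: measurable_cong_sets)

lemma emeasure_rprod:
  assumes E: "E \<in> sets borel"
  shows "emeasure (rprod L K) E = (\<integral>\<^sup>+t. emeasure L ((\<lambda>s. (s, t)) -` E) \<partial>K)"
  unfolding rprod_def
proof (rule emeasure_measure_of_sigma[OF _ _ _ E])
  show "sigma_algebra UNIV (sets (borel :: ('a \<times> 'b) measure))"
    using sets.sigma_algebra_axioms[of borel] by simp
  show "positive (sets borel) (\<lambda>E. \<integral>\<^sup>+t. emeasure L ((\<lambda>s. (s, t)) -` E) \<partial>K)"
    by (simp add: positive_def)
  show "countably_additive (sets borel) (\<lambda>E. \<integral>\<^sup>+t. emeasure L ((\<lambda>s. (s, t)) -` E) \<partial>K)"
    unfolding countably_additive_def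
  proof (intro allI impI)
    fix F :: "nat \<Rightarrow> ('a \<times> 'b) set" assume F: "range F \<subseteq> sets borel" "disjoint_family F"
    have Fm: "(\<lambda>s. (s, t)) -` F i \<in> sets L" for t i
      using F section_borel[of "F i" t] radonD(1)[OF L] by auto
    have "(\<Sum>i. \<integral>\<^sup>+t. emeasure L ((\<lambda>s. (s, t)) -` F i) \<partial>K) = (\<integral>\<^sup>+t. (\<Sum>i. emeasure L ((\<lambda>s. (s, t)) -` F i)) \<partial>K)"
      using F by (intro nn_integral_suminf[symmetric]) auto
    also have "\<dots> = (\<integral>\<^sup>+t. emeasure L ((\<lambda>s. (s, t)) -` (\<Union>i. F i)) \<partial>K)"
      unfolding vimage_UN
    proof (intro nn_integral_cong suminf_emeasure)
      show "disjoint_family (\<lambda>i. (\<lambda>s. (s, t)) -` F i)" for t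
        using F(2) unfolding disjoint_family_on_def by blast
    qed (use Fm in auto)
    finally show "(\<Sum>i. \<integral>\<^sup>+t. emeasure L ((\<lambda>s. (s, t)) -` F i) \<partial>K) = (\<integral>\<^sup>+t. emeasure L ((\<lambda>s. (s, t)) -` (\<Union>i. F i)) \<partial>K)" .
  qed
qed

lemma emeasure_rprod_times:
  assumes "A \<in> sets borel" "B \<in> sets borel" "A \<times> B \<in> sets borel"
  shows "emeasure (rprod L K) (A \<times> B) = emeasure L A * emeasure K B"
proof -
  have "(\<lambda>s. (s, t)) -` (A \<times> B) = (if t \<in> B then A else {})" for t by auto
  then have "emeasure (rprod L K) (A \<times> B) = (\<integral>\<^sup>+t. emeasure L A * indicator B t \<partial>K)"
    unfolding emeasure_rprod[OF assms(3)] by (intro nn_integral_cong) (auto simp: indicator_def)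
  then show ?thesis using assms radonD(1)[OF K] by (simp add: nn_integral_cmult_indicator)
qed

lemma finite_measure_rprod: "finite_measure (rprod L K)"
  using emeasure_rprod_times[of UNIV UNIV]
  by (intro finite_measureI) (simp add: space_rprod ennreal_mult_eq_top_iff L.emeasure_finite K.emeasure_finite)

text \<open>
  The sections of \<open>U\<close> and of the union \<open>E\<close> of the rectangles have the same \<open>L\<close>-measure for almost
  all \<open>t\<close>: otherwise the two functions of \<open>t\<close> would be separated on a non-null set by a rational level.
\<close>

lemma open_rectangle_approx:
  assumes U: "open U"
  shows "\<exists>\<R>. countable \<R> \<and> (\<forall>(C, B)\<in>\<R>. compact C \<and> open B \<and> C \<times> B \<subseteq> U) \<and>
    emeasure (rprod L K) (U - (\<Union>(C, B)\<in>\<R>. C \<times> B)) = 0"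
proof -
  note sL = radonD(1)[OF L] and sK = radonD(1)[OF K]
  define f where "f t = measure L ((\<lambda>s. (s, t)) -` U)" for t
  have S: "(\<lambda>s. (s, t)) -` U \<in> sets borel" for t using U by (intro section_borel) simp
  \<comment> \<open>A finite family of rectangles inside \<open>U\<close> such that those whose
    compact side has measure above \<open>q\<close> have open sides covering the set of
    \<open>t\<close> with \<open>f t\<close> above \<open>q\<close>, up to measure 1 / (n +
    1).\<close>
  define good where "good q n F \<longleftrightarrow> finite F \<and> (\<forall>(C, B)\<in>F. compact C \<and> open B \<and> C \<times> B \<subseteq> U) \<and>
     measure K ({t. q < f t} - (\<Union>(C, B)\<in>{(C, B)\<in>F. q < measure L C}. B)) < 1 / real (Suc n)" for q n F
  have "\<exists>F. good q n F" for q n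
  proof -
    define V where "V = {t. q < f t}"
    have V: "open V" unfolding V_def f_def by (rule open_section_greater[OF L U])
    obtain D where D: "compact D" "D \<subseteq> V" "measure K (V - D) < 1 / real (Suc n)"
      using radon_compact_approx[OF K, of V "1 / real (Suc n)"] V by auto
    \<comment> \<open>Inner regularity of \<open>K\<close> has replaced the open level set by a
      compact subset \<open>D\<close>, so finitely many of the tubes chosen here cover it.\<close>
    have "\<exists>C B. compact C \<and> open B \<and> t \<in> B \<and> C \<times> B \<subseteq> U \<and> q < measure L C" if t: "t \<in> D" for t
    proof -
      have "0 < f t - q" using t D by (auto simp: V_def)
      then obtain C where C: "compact C" "C \<subseteq> (\<lambda>s. (s, t)) -` U" "measure L ((\<lambda>s. (s, t)) -` U - C) < f t - q"
        using radon_compact_approx[OF L S] by blast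
      have "q < measure L C"
        using C(3) L.finite_measure_Diff[of "(\<lambda>s. (s, t)) -` U" C] C S sL
        by (simp add: compact_imp_borel f_def)
      moreover obtain B where "open B" "t \<in> B" "C \<times> B \<subseteq> U"
        using tube_open[OF C(1) U, of t] C(2) by (metis subsetD vimageD)
      ultimately show ?thesis using C by blast
    qed
    then obtain C B where CB: "\<And>t. t \<in> D \<Longrightarrow> compact (C t) \<and> open (B t) \<and> t \<in> B t \<and> C t \<times> B t \<subseteq> U \<and> q < measure L (C t)"
      by metis
    obtain T where T: "T \<subseteq> D" "finite T" "D \<subseteq> (\<Union>t\<in>T. B t)"
      by (rule compactE_image[OF D(1), of D B]) (use CB in auto)
    define F where "F = (\<lambda>t. (C t, B t)) ` T"
    have "V - (\<Union>(C, B)\<in>{(C, B)\<in>F. q < measure L C}. B) \<subseteq> V - D"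
      using T CB by (force simp: F_def)
    moreover have "V - D \<in> sets K"
      unfolding sK using V compact_imp_borel[OF D(1)] by (intro sets.Diff) auto
    ultimately have "measure K (V - (\<Union>(C, B)\<in>{(C, B)\<in>F. q < measure L C}. B)) \<le> measure K (V - D)"
      by (rule K.finite_measure_mono)
    then have "measure K (V - (\<Union>(C, B)\<in>{(C, B)\<in>F. q < measure L C}. B)) < 1 / real (Suc n)" using D(3) by simp
    moreover have "finite F" using T(2) by (simp add: F_def)
    moreover have "\<forall>(C, B)\<in>F. compact C \<and> open B \<and> C \<times> B \<subseteq> U"
    proof
      fix p assume "p \<in> F"
      then obtain t where "t \<in> T" "p = (C t, B t)" by (auto simp: F_def)
      then show "case p of (C, B) \<Rightarrow> compact C \<and> open B \<and> C \<times> B \<subseteq> U" using CB[of t] T(1) by auto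
    qed
    ultimately show ?thesis unfolding V_def good_def by blast
  qed
  then have "good q n (SOME F. good q n F)" for q n by (rule someI_ex)
  then obtain F where "\<And>q n. good q n (F q n)" by (rule that[of "\<lambda>q n. SOME F. good q n F"])
  then have F: "\<And>q n. finite (F q n)"
    "\<And>q n. \<forall>(C, B)\<in>F q n. compact C \<and> open B \<and> C \<times> B \<subseteq> U"
    "\<And>q n. measure K ({t. q < f t} - (\<Union>(C, B)\<in>{(C, B)\<in>F q n. q < measure L C}. B)) < 1 / real (Suc n)"
    unfolding good_def by auto
  define \<R> where "\<R> = (\<Union>q\<in>\<rat>. \<Union>n. F q n)"
  have cR: "countable \<R>"
    unfolding \<R>_def using F(1) by (intro countable_UN countable_rat) (auto intro: countable_finite)
  have R: "\<forall>(C, B)\<in>\<R>. compact C \<and> open B \<and> C \<times> B \<subseteq> U" using F(2) by (fastforce simp: \<R>_def)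
  define E where "E = (\<Union>(C, B)\<in>\<R>. C \<times> B)"
  have rect: "C \<times> B \<in> sets borel" if "compact C" "open B" for C :: "'a set" and B :: "'b set"
    using that by (intro Times_in_borel) (auto simp: compact_imp_borel)
  have Eb: "E \<in> sets borel"
    unfolding E_def using cR R rect by (intro sets.countable_UN') auto
  have null: "AE t in K. q < f t \<longrightarrow> (\<exists>(C, B)\<in>\<R>. t \<in> B \<and> q < measure L C)" if q: "q \<in> \<rat>" for q
  proof -
    define N where "N = (\<Inter>n. {t. q < f t} - (\<Union>(C, B)\<in>{(C, B)\<in>F q n. q < measure L C}. B))"
    have Nn: "{t. q < f t} - (\<Union>(C, B)\<in>{(C, B)\<in>F q n. q < measure L C}. B) \<in> sets K" for n
    proof -
      have "open {t. q < f t}" unfolding f_def by (rule open_section_greater[OF L U])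
      moreover have "open (\<Union>(C, B)\<in>{(C, B)\<in>F q n. q < measure L C}. B)" using F(2)[of q n] by auto
      ultimately show ?thesis using sK by simp
    qed
    have Ns: "N \<in> sets K" unfolding N_def by (rule sets.countable_INT) (use Nn in blast)+
    have "measure K N \<le> 1 / real (Suc n)" for n
      using K.finite_measure_mono[of N, OF _ Nn[of n]] F(3)[of q n] by (force simp: N_def)
    then have "measure K N \<le> 0"
      by (intro LIMSEQ_le_const[OF LIMSEQ_Suc[OF lim_1_over_n]]) auto
    then have "N \<in> null_sets K" using Ns by (simp add: null_sets_def K.emeasure_eq_measure measure_le_0_iff)
    moreover have "{t\<in>space K. \<not> (q < f t \<longrightarrow> (\<exists>(C, B)\<in>\<R>. t \<in> B \<and> q < measure L C))} \<subseteq> N"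
      using q by (fastforce simp: N_def \<R>_def)
    ultimately show ?thesis by (rule AE_I')
  qed
  have "AE t in K. \<forall>q\<in>\<rat>. q < f t \<longrightarrow> (\<exists>(C, B)\<in>\<R>. t \<in> B \<and> q < measure L C)"
    using null by (subst AE_ball_countable[OF countable_rat]) auto
  then have "AE t in K. emeasure L ((\<lambda>s. (s, t)) -` (U - E)) = 0"
  proof eventually_elim
    case (elim t)
    have Et: "(\<lambda>s. (s, t)) -` E \<in> sets L" using section_borel[OF Eb] sL by simp
    have EU: "(\<lambda>s. (s, t)) -` E \<subseteq> (\<lambda>s. (s, t)) -` U" using R by (fastforce simp: E_def)
    have "f t \<le> measure L ((\<lambda>s. (s, t)) -` E)"
    proof (rule ccontr)
      assume "\<not> f t \<le> measure L ((\<lambda>s. (s, t)) -` E)"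
      then obtain q where q: "q \<in> \<rat>" "measure L ((\<lambda>s. (s, t)) -` E) < q" "q < f t"
        using Rats_dense_in_real[of "measure L ((\<lambda>s. (s, t)) -` E)" "f t"] by auto
      then obtain C B where CB: "(C, B) \<in> \<R>" "t \<in> B" "q < measure L C" using elim by blast
      then have "C \<subseteq> (\<lambda>s. (s, t)) -` E" by (auto simp: E_def)
      then have "measure L C \<le> measure L ((\<lambda>s. (s, t)) -` E)" using Et by (rule L.finite_measure_mono)
      then show False using q CB by simp
    qed
    moreover have "measure L ((\<lambda>s. (s, t)) -` U - (\<lambda>s. (s, t)) -` E) = f t - measure L ((\<lambda>s. (s, t)) -` E)"
      unfolding f_def using S Et EU sL by (intro L.finite_measure_Diff) auto
    ultimately have "measure L ((\<lambda>s. (s, t)) -` (U - E)) \<le> 0" by (simp add: vimage_Diff)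
    then show ?case by (simp add: L.emeasure_eq_measure measure_le_0_iff)
  qed
  then have "(\<integral>\<^sup>+t. emeasure L ((\<lambda>s. (s, t)) -` (U - E)) \<partial>K) = (\<integral>\<^sup>+t. 0 \<partial>K)"
    by (rule nn_integral_cong_AE)
  then have "emeasure (rprod L K) (U - E) = 0"
    using emeasure_rprod[of "U - E"] U Eb by simp
  then show ?thesis using cR R unfolding E_def by blast
qed

text \<open>The rectangles that exhaust an open \<open>U\<close> have one compact and one open side.
  Exhausting the open side by compacts up to a \<open>K\<close>-null set gives countably many
  compact rectangles, and by the product formula the loss stays null.\<close>

lemma radon_rprod: "radon (rprod L K)"
proof (rule radon_if_open[OF sets_rprod finite_measure_rprod])
  fix U :: "('a \<times> 'b) set" assume "open U"
  from open_rectangle_approx[OF this] obtain \<R> where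
    R0: "countable \<R> \<and> (\<forall>(C, B)\<in>\<R>. compact C \<and> open B \<and> C \<times> B \<subseteq> U) \<and>
      emeasure (rprod L K) (U - (\<Union>(C, B)\<in>\<R>. C \<times> B)) = 0" ..
  then have R: "countable \<R>" "\<And>C B. (C, B) \<in> \<R> \<Longrightarrow> compact C \<and> open B \<and> C \<times> B \<subseteq> U"
    and null: "emeasure (rprod L K) (U - (\<Union>(C, B)\<in>\<R>. C \<times> B)) = 0"
    by auto
  have "\<forall>B\<in>snd ` \<R>. \<exists>D. (\<forall>n::nat. compact (D n) \<and> D n \<subseteq> B) \<and> emeasure K (B - (\<Union>n. D n)) = 0"
  proof
    fix B assume "B \<in> snd ` \<R>"
    then have "B \<in> sets borel" using R(2) by force
    then show "\<exists>D. (\<forall>n::nat. compact (D n) \<and> D n \<subseteq> B) \<and> emeasure K (B - (\<Union>n. D n)) = 0"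
      using radon_compacts[OF K] by metis
  qed
  then obtain D where D: "\<And>B n. B \<in> snd ` \<R> \<Longrightarrow> compact (D B (n::nat)) \<and> D B n \<subseteq> B"
    "\<And>B. B \<in> snd ` \<R> \<Longrightarrow> emeasure K (B - (\<Union>n. D B n)) = 0" by metis
  define \<K> where "\<K> = (\<Union>(C, B)\<in>\<R>. \<Union>n. {C \<times> D B n})"
  have cK: "countable \<K>" unfolding \<K>_def using R(1) by (intro countable_UN) auto
  have K': "compact C \<and> C \<subseteq> U" if "C \<in> \<K>" for C
    using that R(2) D(1) by (fastforce simp: \<K>_def intro!: compact_Times)
  have b: "\<Union>\<K> \<in> sets borel" using cK K' by (intro sets.countable_Union) (auto simp: compact_imp_borel)
  have n1: "C \<times> (B - (\<Union>n. D B n)) \<in> null_sets (rprod L K)" if CB: "(C, B) \<in> \<R>" for C B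
  proof -
    have B: "B \<in> snd ` \<R>" using CB by force
    have Cb: "C \<in> sets borel" using R(2)[OF CB] by (simp add: compact_imp_borel)
    have Bb: "B - (\<Union>n. D B n) \<in> sets borel"
    proof (intro sets.Diff sets.countable_UN)
      show "range (D B) \<subseteq> sets borel" using D(1)[OF B] compact_imp_borel by blast
    qed (use R(2)[OF CB] in auto)
    note s = Times_in_borel[OF Cb Bb]
    show ?thesis
      using emeasure_rprod_times[OF Cb Bb s] D(2)[OF B] s by (auto simp: null_sets_def sets_rprod)
  qed
  have s0: "U - (\<Union>(C, B)\<in>\<R>. C \<times> B) \<in> null_sets (rprod L K)"
  proof -
    have "C \<times> B \<in> sets borel" if "(C, B) \<in> \<R>" for C B
      using R(2)[OF that] by (intro Times_in_borel) (auto simp: compact_imp_borel)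
    then have "(\<Union>(C, B)\<in>\<R>. C \<times> B) \<in> sets borel" using R(1) by (intro sets.countable_UN') auto
    then show ?thesis using null \<open>open U\<close> by (auto simp: null_sets_def sets_rprod)
  qed
  have "(U - (\<Union>(C, B)\<in>\<R>. C \<times> B)) \<union> (\<Union>(C, B)\<in>\<R>. C \<times> (B - (\<Union>n. D B n))) \<in> null_sets (rprod L K)"
    using s0 n1 R(1) by (intro null_sets.Un null_sets_UN') auto
  moreover have "U - \<Union>\<K> \<in> sets (rprod L K)" using b \<open>open U\<close> by (simp add: sets_rprod)
  moreover have "U - \<Union>\<K> \<subseteq> (U - (\<Union>(C, B)\<in>\<R>. C \<times> B)) \<union> (\<Union>(C, B)\<in>\<R>. C \<times> (B - (\<Union>n. D B n)))"
    by (fastforce simp: \<K>_def)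
  ultimately have "U - \<Union>\<K> \<in> null_sets (rprod L K)"
    by (rule null_sets_subset)
  then have "emeasure (rprod L K) (U - \<Union>\<K>) = 0" by auto
  then show "\<exists>K'. countable K' \<and> (\<forall>C\<in>K'. compact C \<and> C \<subseteq> U) \<and> emeasure (rprod L K) (U - \<Union>K') = 0"
    using cK K' by blast
qed

end

section \<open>Tonelli and Fubini for Borel functions on the product\<close>

context
  fixes L :: "'a::t2_space measure" and K :: "'b::t2_space measure"
  assumes L: "radon L" and K: "radon K"
begin

interpretation L: finite_measure L using L by (rule radonD)
interpretation K: finite_measure K using K by (rule radonD)

lemma measurable_slice[measurable (raw)]:
  fixes f :: "'a \<times> 'b \<Rightarrow> 'c::topological_space"
  assumes "f \<in> borel_measurable borel"
  shows "(\<lambda>s. f (s, t)) \<in> borel_measurable L"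
  using measurable_compose[of "\<lambda>s. (s, t)" borel borel f borel] assms radonD(1)[OF L]
  by (simp add: borel_measurable_continuous_onI continuous_intros cong: measurable_cong_sets)

text \<open>Measurability of the inner integral is part of the claim because the induction steps for
  multiples, sums and suprema use it for the outer integral.\<close>

lemma nn_integral_rprod:
  fixes f :: "'a \<times> 'b \<Rightarrow> ennreal"
  assumes f: "f \<in> borel_measurable borel"
  shows "(\<lambda>t. \<integral>\<^sup>+s. f (s, t) \<partial>L) \<in> borel_measurable borel \<and>
    (\<integral>\<^sup>+z. f z \<partial>rprod L K) = (\<integral>\<^sup>+t. \<integral>\<^sup>+s. f (s, t) \<partial>L \<partial>K)"
  using f
proof (induction rule: borel_measurable_induct)
  case (cong f g)
  then show ?case by (simp cong: nn_integral_cong)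
next
  case (set E)
  have "(\<integral>\<^sup>+s. indicator E (s, t) \<partial>L) = emeasure L ((\<lambda>s. (s, t)) -` E)" for t
  proof -
    have "(\<integral>\<^sup>+s. indicator E (s, t) \<partial>L) = (\<integral>\<^sup>+s. indicator ((\<lambda>s. (s, t)) -` E) s \<partial>L)"
      by (intro nn_integral_cong) (auto simp: indicator_def)
    then show ?thesis using section_borel[OF set, of t] radonD(1)[OF L] by simp
  qed
  then show ?case
    using set measurable_emeasure_section[OF L set] emeasure_rprod[OF L K set] by (simp add: sets_rprod)
next
  case (mult u c)
  note [measurable] = mult(2)
  have [measurable]: "(\<lambda>t. \<integral>\<^sup>+s. u (s, t) \<partial>L) \<in> borel_measurable K"
    using mult radonD(1)[OF K] by (simp cong: measurable_cong_sets)
  have [measurable]: "(\<lambda>t. \<integral>\<^sup>+s. u (s, t) \<partial>L) \<in> borel_measurable borel" using mult by simp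
  show ?case using mult by (simp add: nn_integral_cmult)
next
  case (add u v)
  note [measurable] = add(1,3)
  have [measurable]: "(\<lambda>t. \<integral>\<^sup>+s. u (s, t) \<partial>L) \<in> borel_measurable K" "(\<lambda>t. \<integral>\<^sup>+s. v (s, t) \<partial>L) \<in> borel_measurable K"
    using add radonD(1)[OF K] by (simp_all cong: measurable_cong_sets)
  have [measurable]: "(\<lambda>t. \<integral>\<^sup>+s. u (s, t) \<partial>L) \<in> borel_measurable borel"
    "(\<lambda>t. \<integral>\<^sup>+s. v (s, t) \<partial>L) \<in> borel_measurable borel" using add by simp_all
  show ?case using add by (simp add: nn_integral_add)
next
  case (seq U)
  note [measurable] = seq(1)
  have [measurable]: "(\<lambda>t. \<integral>\<^sup>+s. U i (s, t) \<partial>L) \<in> borel_measurable K" for i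
    using seq radonD(1)[OF K] by (simp cong: measurable_cong_sets)
  have sl: "(\<integral>\<^sup>+s. (SUP i. U i) (s, t) \<partial>L) = (SUP i. \<integral>\<^sup>+s. U i (s, t) \<partial>L)" for t
    unfolding SUP_apply using \<open>incseq U\<close>
    by (intro nn_integral_monotone_convergence_SUP) (auto simp: incseq_def le_fun_def)
  have "(\<integral>\<^sup>+z. (SUP i. U i) z \<partial>rprod L K) = (SUP i. \<integral>\<^sup>+z. U i z \<partial>rprod L K)"
    unfolding SUP_apply using \<open>incseq U\<close> by (intro nn_integral_monotone_convergence_SUP) auto
  also have "\<dots> = (SUP i. \<integral>\<^sup>+t. \<integral>\<^sup>+s. U i (s, t) \<partial>L \<partial>K)" using seq by simp
  also have "\<dots> = (\<integral>\<^sup>+t. (SUP i. \<integral>\<^sup>+s. U i (s, t) \<partial>L) \<partial>K)"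
    using \<open>incseq U\<close>
    by (intro nn_integral_monotone_convergence_SUP[symmetric])
      (auto simp: incseq_def le_fun_def intro!: nn_integral_mono)
  moreover have "(\<lambda>t. SUP i. \<integral>\<^sup>+s. U i (s, t) \<partial>L) \<in> borel_measurable borel"
    using seq by (intro borel_measurable_SUP) auto
  ultimately show ?case using seq unfolding sl by simp
qed

lemma measurable_integral_slice_real:
  fixes f :: "'a \<times> 'b \<Rightarrow> real"
  assumes f[measurable]: "f \<in> borel_measurable borel" and sl: "\<And>t. integrable L (\<lambda>s. f (s, t))"
  shows "(\<lambda>t. \<integral>s. f (s, t) \<partial>L) \<in> borel_measurable borel"
proof -
  have "(\<lambda>t. \<integral>\<^sup>+s. ennreal (f (s, t)) \<partial>L) \<in> borel_measurable borel"
    "(\<lambda>t. \<integral>\<^sup>+s. ennreal (- f (s, t)) \<partial>L) \<in> borel_measurable borel"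
    using nn_integral_rprod[of "\<lambda>z. ennreal (f z)"] nn_integral_rprod[of "\<lambda>z. ennreal (- f z)"] by simp_all
  then show ?thesis unfolding real_lebesgue_integral_def[OF sl] by measurable
qed

text \<open>Slices are taken integrable for every \<open>t\<close>, as the weighted bounds will
  provide, so both parts of the inner integral are finite everywhere and no exceptional null set has
  to be removed.\<close>

lemma integral_rprod_real:
  fixes f :: "'a \<times> 'b \<Rightarrow> real"
  assumes f[measurable]: "f \<in> borel_measurable borel" and int: "integrable (rprod L K) f"
    and sl: "\<And>t. integrable L (\<lambda>s. f (s, t))"
  shows "integrable K (\<lambda>t. \<integral>s. f (s, t) \<partial>L)"
    "(\<integral>z. f z \<partial>rprod L K) = (\<integral>t. \<integral>s. f (s, t) \<partial>L \<partial>K)"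
proof -
  define P where "P t = (\<integral>\<^sup>+s. ennreal (f (s, t)) \<partial>L)" for t
  define N where "N t = (\<integral>\<^sup>+s. ennreal (- f (s, t)) \<partial>L)" for t
  have P: "P \<in> borel_measurable borel" "(\<integral>\<^sup>+z. ennreal (f z) \<partial>rprod L K) = (\<integral>\<^sup>+t. P t \<partial>K)"
    using nn_integral_rprod[of "\<lambda>z. ennreal (f z)"] unfolding P_def by simp_all
  have N: "N \<in> borel_measurable borel" "(\<integral>\<^sup>+z. ennreal (- f z) \<partial>rprod L K) = (\<integral>\<^sup>+t. N t \<partial>K)"
    using nn_integral_rprod[of "\<lambda>z. ennreal (- f z)"] unfolding N_def by simp_all
  have [measurable]: "P \<in> borel_measurable K" "N \<in> borel_measurable K"
    using P N radonD(1)[OF K] by (simp_all cong: measurable_cong_sets)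
  have fin: "P t < \<infinity>" "N t < \<infinity>" for t
    using sl[of t] unfolding real_integrable_def P_def N_def by (auto simp: less_top)
  have eq: "(\<integral>s. f (s, t) \<partial>L) = enn2real (P t) - enn2real (N t)" for t
    unfolding P_def N_def by (rule real_lebesgue_integral_def[OF sl])
  have fin2: "(\<integral>\<^sup>+t. P t \<partial>K) < \<infinity>" "(\<integral>\<^sup>+t. N t \<partial>K) < \<infinity>"
    using int unfolding real_integrable_def P N by (auto simp: less_top)
  have e2: "(\<integral>\<^sup>+t. ennreal (enn2real (P t)) \<partial>K) = (\<integral>\<^sup>+t. P t \<partial>K)" "(\<integral>\<^sup>+t. ennreal (enn2real (N t)) \<partial>K) = (\<integral>\<^sup>+t. N t \<partial>K)"
    using fin by (auto intro!: nn_integral_cong simp: less_top)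
  have iP: "integrable K (\<lambda>t. enn2real (P t))" and iN: "integrable K (\<lambda>t. enn2real (N t))"
    using fin2 e2 by (auto intro!: integrableI_nonneg)
  show "integrable K (\<lambda>t. \<integral>s. f (s, t) \<partial>L)" unfolding eq using iP iN by simp
  have "(\<integral>z. f z \<partial>rprod L K) = enn2real (\<integral>\<^sup>+t. P t \<partial>K) - enn2real (\<integral>\<^sup>+t. N t \<partial>K)"
    unfolding real_lebesgue_integral_def[OF int] P N ..
  also have "\<dots> = (\<integral>t. enn2real (P t) \<partial>K) - (\<integral>t. enn2real (N t) \<partial>K)"
    by (simp add: integral_eq_nn_integral e2)
  also have "\<dots> = (\<integral>t. \<integral>s. f (s, t) \<partial>L \<partial>K)"
    unfolding eq using iP iN by simp
  finally show "(\<integral>z. f z \<partial>rprod L K) = (\<integral>t. \<integral>s. f (s, t) \<partial>L \<partial>K)" .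
qed

lemma integral_slice_complex:
  fixes f :: "'a \<times> 'b \<Rightarrow> complex"
  assumes sl: "integrable L (\<lambda>s. f (s, t))"
  shows "(\<integral>s. f (s, t) \<partial>L) = of_real (\<integral>s. Re (f (s, t)) \<partial>L) + \<i> * of_real (\<integral>s. Im (f (s, t)) \<partial>L)"
  using integral_Re[OF sl] integral_Im[OF sl] by (simp add: complex_eq_iff)

lemma measurable_integral_slice:
  fixes f :: "'a \<times> 'b \<Rightarrow> complex"
  assumes f[measurable]: "f \<in> borel_measurable borel" and sl: "\<And>t. integrable L (\<lambda>s. f (s, t))"
  shows "(\<lambda>t. \<integral>s. f (s, t) \<partial>L) \<in> borel_measurable borel"
proof -
  have mR: "(\<lambda>z. Re (f z)) \<in> borel_measurable borel" and mI: "(\<lambda>z. Im (f z)) \<in> borel_measurable borel"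
    by measurable
  show ?thesis
    unfolding integral_slice_complex[OF sl]
    using measurable_integral_slice_real[OF mR integrable_Re[OF sl]]
      measurable_integral_slice_real[OF mI integrable_Im[OF sl]] by measurable
qed

lemma integral_rprod:
  fixes f :: "'a \<times> 'b \<Rightarrow> complex"
  assumes f[measurable]: "f \<in> borel_measurable borel" and int: "integrable (rprod L K) f"
    and sl: "\<And>t. integrable L (\<lambda>s. f (s, t))"
  shows "integrable K (\<lambda>t. \<integral>s. f (s, t) \<partial>L)"
    "(\<integral>z. f z \<partial>rprod L K) = (\<integral>t. \<integral>s. f (s, t) \<partial>L \<partial>K)"
proof -
  have mR: "(\<lambda>z. Re (f z)) \<in> borel_measurable borel" and mI: "(\<lambda>z. Im (f z)) \<in> borel_measurable borel"
    by measurable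
  note R = integral_rprod_real[OF mR integrable_Re[OF int] integrable_Re[OF sl]]
  note I = integral_rprod_real[OF mI integrable_Im[OF int] integrable_Im[OF sl]]
  show i: "integrable K (\<lambda>t. \<integral>s. f (s, t) \<partial>L)" unfolding integral_slice_complex[OF sl] using R(1) I(1) by simp
  show "(\<integral>z. f z \<partial>rprod L K) = (\<integral>t. \<integral>s. f (s, t) \<partial>L \<partial>K)"
    using R(2) I(2) integral_Re[OF int] integral_Im[OF int] integral_Re[OF i] integral_Im[OF i]
      integral_Re[OF sl] integral_Im[OF sl] by (simp add: complex_eq_iff)
qed

end

section \<open>Independence of the order of integration\<close>

text \<open>On the product sigma-algebra both orders compute the measure of \<open>E\<close> under
  \<open>L \<Otimes>\<^sub>M K\<close>, where the classical theorem for sigma-finite measures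
  applies.\<close>

lemma emeasure_rprod_swap_product:
  fixes L :: "'a::t2_space measure" and K :: "'b::t2_space measure"
  assumes L: "radon L" and K: "radon K" and E: "E \<in> sets (borel \<Otimes>\<^sub>M borel)" "E \<in> sets borel"
  shows "emeasure (rprod L K) E = emeasure (rprod K L) (prod.swap -` E)"
proof -
  interpret L: finite_measure L using L by (rule radonD)
  interpret K: finite_measure K using K by (rule radonD)
  interpret LK: pair_sigma_finite L K ..
  have s: "sets (L \<Otimes>\<^sub>M K) = sets (borel \<Otimes>\<^sub>M borel)"
    using radonD(1)[OF L] radonD(1)[OF K] by (rule sets_pair_measure_cong)
  have Es: "prod.swap -` E \<in> sets borel"
    using measurable_sets[OF measurable_swap_borel E(2)] by simp
  have "emeasure (rprod L K) E = emeasure (L \<Otimes>\<^sub>M K) E"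
    using emeasure_rprod[OF L K E(2)] LK.emeasure_pair_measure_alt2[of E] E s by simp
  also have "\<dots> = (\<integral>\<^sup>+s. emeasure K (Pair s -` E) \<partial>L)"
    using E s by (intro K.emeasure_pair_measure_alt) simp
  also have "\<dots> = emeasure (rprod K L) (prod.swap -` E)"
    using emeasure_rprod[OF K L Es] by (simp add: vimage_def)
  finally show ?thesis .
qed

text \<open>The union \<open>E\<close> of countably many rectangles exhausts \<open>U\<close> up to
  a null set of \<open>rprod L K\<close> and lies in the product sigma-algebra, where the orders
  agree. The remainder is not yet known to be null in the other order, so only an inequality
  results.\<close>

lemma emeasure_rprod_open_le_swap:
  fixes L :: "'a::t2_space measure" and K :: "'b::t2_space measure"
  assumes L: "radon L" and K: "radon K" and U: "open U"
  shows "emeasure (rprod L K) U \<le> emeasure (rprod K L) (prod.swap -` U)"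
proof -
  from open_rectangle_approx[OF L K U] obtain \<R> where
    R0: "countable \<R> \<and> (\<forall>(C, B)\<in>\<R>. compact C \<and> open B \<and> C \<times> B \<subseteq> U) \<and>
      emeasure (rprod L K) (U - (\<Union>(C, B)\<in>\<R>. C \<times> B)) = 0" ..
  define E where "E = (\<Union>(C, B)\<in>\<R>. C \<times> B)"
  have r: "C \<in> sets borel \<and> B \<in> sets borel" if "(C, B) \<in> \<R>" for C B
    using that R0 by (auto simp: compact_imp_borel)
  have Eb: "E \<in> sets borel" unfolding E_def using R0 r
    by (intro sets.countable_UN') (auto intro: Times_in_borel)
  have Ep: "E \<in> sets (borel \<Otimes>\<^sub>M borel)" unfolding E_def using R0 r
    by (intro sets.countable_UN') auto
  have EU: "E \<subseteq> U" unfolding E_def using R0 by fast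
  have Us: "prod.swap -` U \<in> sets borel"
    using measurable_sets[OF measurable_swap_borel borel_open[OF U]] by simp
  have "emeasure (rprod L K) U = emeasure (rprod L K) (E \<union> (U - E))" using EU by (simp add: Un_absorb1)
  also have "\<dots> = emeasure (rprod L K) E"
    using R0 Eb U by (intro emeasure_Un_null_set) (auto simp: null_sets_def sets_rprod E_def)
  also have "\<dots> = emeasure (rprod K L) (prod.swap -` E)"
    by (rule emeasure_rprod_swap_product[OF L K Ep Eb])
  also have "\<dots> \<le> emeasure (rprod K L) (prod.swap -` U)"
    using EU Us by (intro emeasure_mono) (auto simp: sets_rprod)
  finally show ?thesis .
qed

text \<open>Exchanging the roles of the two factors in the inequality for open sets gives the
  reverse inequality; finite measures that agree on the open sets are equal.\<close>

lemma rprod_swap: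
  fixes L :: "'a::t2_space measure" and K :: "'b::t2_space measure"
  assumes L: "radon L" and K: "radon K"
  shows "rprod L K = distr (rprod K L) borel prod.swap"
proof (rule measure_eqI_generator_eq[where \<Omega>=UNIV and E="{S. open S}" and A="\<lambda>_. UNIV"])
  have sw: "prod.swap \<in> rprod K L \<rightarrow>\<^sub>M borel"
    using measurable_swap_borel unfolding measurable_cong_sets[OF sets_rprod refl] .
  show "Int_stable {S::('a \<times> 'b) set. open S}" by (auto simp: Int_stable_def)
  show "sets (rprod L K) = sigma_sets UNIV {S. open S}" by (simp add: sets_rprod sets_borel)
  show "sets (distr (rprod K L) borel prod.swap) = sigma_sets UNIV {S. open S}" by (simp add: sets_borel)
  fix U :: "('a \<times> 'b) set" assume "U \<in> {S. open S}"
  then have U: "open U" by simp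
  have d: "emeasure (distr (rprod K L) borel prod.swap) U = emeasure (rprod K L) (prod.swap -` U)"
    using U by (subst emeasure_distr[OF sw]) (auto simp: space_rprod)
  have "emeasure (rprod K L) (prod.swap -` U) \<le> emeasure (rprod L K) (prod.swap -` (prod.swap -` U))"
    by (rule emeasure_rprod_open_le_swap[OF K L open_vimage[OF U continuous_on_swap]])
  moreover have "prod.swap -` (prod.swap -` U) = U" by auto
  ultimately show "emeasure (rprod L K) U = emeasure (distr (rprod K L) borel prod.swap) U"
    unfolding d using emeasure_rprod_open_le_swap[OF L K U] by (simp add: antisym)
next
  interpret finite_measure "rprod L K" using finite_measure_rprod[OF L K] .
  show "emeasure (rprod L K) UNIV \<noteq> \<infinity>" for i :: nat by simp
qed auto

lemma integral_rprod_swap: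
  fixes L :: "'a::t2_space measure" and K :: "'b::t2_space measure" and f :: "'a \<times> 'b \<Rightarrow> complex"
  assumes L: "radon L" and K: "radon K" and f: "f \<in> borel_measurable borel" and int: "integrable (rprod L K) f"
    and sl: "\<And>s. integrable K (\<lambda>t. f (s, t))"
  shows "integrable L (\<lambda>s. \<integral>t. f (s, t) \<partial>K)"
    "(\<integral>z. f z \<partial>rprod L K) = (\<integral>s. \<integral>t. f (s, t) \<partial>K \<partial>L)"
proof -
  have sw: "prod.swap \<in> rprod K L \<rightarrow>\<^sub>M borel"
    using measurable_swap_borel unfolding measurable_cong_sets[OF sets_rprod refl] .
  have m: "(\<lambda>z. f (prod.swap z)) \<in> borel_measurable borel"
    using measurable_compose[OF measurable_swap_borel f] .
  have i: "integrable (rprod K L) (\<lambda>z. f (prod.swap z))"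
    using int f unfolding rprod_swap[OF L K] by (simp add: integrable_distr_eq[OF sw])
  have e: "(\<integral>z. f z \<partial>rprod L K) = (\<integral>z. f (prod.swap z) \<partial>rprod K L)"
    unfolding rprod_swap[OF L K] by (rule integral_distr[OF sw f])
  show "integrable L (\<lambda>s. \<integral>t. f (s, t) \<partial>K)"
    "(\<integral>z. f z \<partial>rprod L K) = (\<integral>s. \<integral>t. f (s, t) \<partial>K \<partial>L)"
    using integral_rprod[OF K L m i] sl e by simp_all
qed

lemma measurable_integral_slice_swap:
  fixes K :: "'b::t2_space measure" and f :: "'a::t2_space \<times> 'b \<Rightarrow> complex"
  assumes K: "radon K" and f: "f \<in> borel_measurable borel" and sl: "\<And>s. integrable K (\<lambda>t. f (s, t))"
  shows "(\<lambda>s. \<integral>t. f (s, t) \<partial>K) \<in> borel_measurable borel"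
proof -
  \<comment> \<open>\<open>measurable_integral_slice\<close> is stated for a pair of inner regular
    measures; the null measure fills the second place.\<close>
  have "radon (null_measure borel :: 'a measure)"
    by (rule radonI_sequence) (auto intro!: finite_measureI)
  then show ?thesis
    using measurable_integral_slice[OF K, of "null_measure borel :: 'a measure" "\<lambda>z. f (prod.swap z)"]
      measurable_compose[OF measurable_swap_borel f] sl by simp
qed

section \<open>Uniqueness of regular measures and the maximal extension\<close>

lemma Hausdorff_euclidean_t2: "Hausdorff_space (euclidean :: 'a::t2_space topology)"
  unfolding Hausdorff_space_def disjnt_def using hausdorff by fastforce

lemma compact_open_separation:
  fixes C :: "'a::t2_space set"
  assumes lc: "locally_compact_space (euclidean :: 'a topology)" and C: "compact C" and U: "open U" "C \<subseteq> U"
  shows "\<exists>V. open V \<and> C \<subseteq> V \<and> compact (closure V) \<and> closure V \<subseteq> U"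
proof -
  have nb: "neighbourhood_base_of (\<lambda>C. compactin euclidean C \<and> closedin euclidean C) (euclidean :: 'a topology)"
    using lc locally_compact_space_neighbourhood_base_closedin Hausdorff_euclidean_t2 by blast
  have "\<exists>V. open V \<and> x \<in> V \<and> compact (closure V) \<and> closure V \<subseteq> U" if "x \<in> C" for x
  proof -
    have "openin euclidean U \<and> x \<in> U" using U that by auto
    then obtain V D where V: "openin euclidean V" "compactin euclidean D \<and> closedin euclidean D" "x \<in> V" "V \<subseteq> D" "D \<subseteq> U"
      using nb unfolding neighbourhood_base_of by metis
    then have "closure V \<subseteq> D" "compact D" by (simp_all add: closure_minimal)
    then have "compact (closure V)"
      using compact_Int_closed[of D "closure V"] by (simp add: Int_absorb1)
    then show ?thesis using V \<open>closure V \<subseteq> D\<close> by auto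
  qed
  then obtain V where V: "\<And>x. x \<in> C \<Longrightarrow> open (V x) \<and> x \<in> V x \<and> compact (closure (V x)) \<and> closure (V x) \<subseteq> U"
    by metis
  obtain T where T: "T \<subseteq> C" "finite T" "C \<subseteq> (\<Union>x\<in>T. V x)"
    by (rule compactE_image[OF C, of C V]) (use V in auto)
  let ?V = "\<Union>x\<in>T. V x" and ?D = "\<Union>x\<in>T. closure (V x)"
  have D: "compact ?D" "?D \<subseteq> U" using V T by (auto intro!: compact_UN)
  have cl: "closure ?V \<subseteq> ?D"
  proof (rule closure_minimal)
    show "?V \<subseteq> ?D" using closure_subset by (intro UN_mono) auto
    show "closed ?D" using T(2) by (intro closed_UN) auto
  qed
  have "compact (closure ?V)"
    using compact_Int_closed[OF D(1), of "closure ?V"] cl by (simp add: Int_absorb1)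
  moreover have "open ?V" using V T(1) by blast
  ultimately show ?thesis using T(3) D(2) cl by (intro exI[of _ ?V]) auto
qed

lemma Urysohn_compact_support:
  fixes C :: "'a::t2_space set"
  assumes lc: "locally_compact_space (euclidean :: 'a topology)" and C: "compact C" and U: "open U" "C \<subseteq> U"
  shows "\<exists>f::'a \<Rightarrow> real. continuous_on UNIV f \<and> (\<forall>x. 0 \<le> f x \<and> f x \<le> 1) \<and> (\<forall>x\<in>C. f x = 1) \<and>
    (\<forall>x. x \<notin> U \<longrightarrow> f x = 0) \<and> compact (closure {x. f x \<noteq> 0})"
proof -
  obtain V where V: "open V" "C \<subseteq> V" "compact (closure V)" "closure V \<subseteq> U"
    using compact_open_separation[OF assms] by blast
  have cr: "completely_regular_space (euclidean :: 'a topology)"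
    using lc locally_compact_regular_imp_completely_regular_space Hausdorff_euclidean_t2 by blast
  obtain g :: "'a \<Rightarrow> real" where g: "continuous_map euclidean (subtopology euclidean {0..1}) g" "g ` C \<subseteq> {1}" "g ` (- V) \<subseteq> {0}"
  proof (rule Urysohn_completely_regular_compact_closed[OF zero_le_one cr, of C "- V"])
    show "disjnt C (- V)" using V(2) by (auto simp: disjnt_def)
  qed (use C V(1) in \<open>simp_all add: closed_def\<close>)
  have gc: "continuous_on UNIV g" and g01: "\<And>x. 0 \<le> g x \<and> g x \<le> 1"
    using g(1) by (auto simp: continuous_map_in_subtopology Pi_iff)
  have "{x. g x \<noteq> 0} \<subseteq> V" using g(3) by force
  then have "closure {x. g x \<noteq> 0} \<subseteq> closure V" by (rule closure_mono)
  then have "compact (closure {x. g x \<noteq> 0})"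
    using compact_Int_closed[OF V(3), of "closure {x. g x \<noteq> 0}"] by (simp add: Int_absorb1)
  moreover have "g x = 0" if "x \<notin> U" for x
    using that V(4) closure_subset[of V] g(3) by force
  moreover have "g x = 1" if "x \<in> C" for x using that g(2) by force
  ultimately show ?thesis using gc g01 by blast
qed

lemma set_integrable_norm_density:
  assumes d: "density_on \<mu> W N h" and A: "A \<in> sets borel" "A \<subseteq> W"
  shows "set_integrable N A h" "set_integrable N A (\<lambda>x. norm (h x))"
    "emeasure (density N (\<lambda>x. ennreal (norm (h x)))) A = ennreal (LINT x:A|N. norm (h x))"
proof -
  note sN = density_onD(1)[OF d] and h = density_onD(2)[OF d]
  show i: "set_integrable N A h"
    using density_onD(3)[OF density_on_subset[OF d A]] .
  show j: "set_integrable N A (\<lambda>x. norm (h x))"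
    using integrable_norm[OF i[unfolded set_integrable_def]] by (simp add: set_integrable_def)
  have "emeasure (density N (\<lambda>x. ennreal (norm (h x)))) A = (\<integral>\<^sup>+x. ennreal (indicator A x *\<^sub>R norm (h x)) \<partial>N)"
    using A h sN
    by (subst emeasure_density) (auto simp: indicator_def intro!: nn_integral_cong cong: measurable_cong_sets)
  then show "emeasure (density N (\<lambda>x. ennreal (norm (h x)))) A = ennreal (LINT x:A|N. norm (h x))"
    using j by (simp add: set_integrable_def set_lebesgue_integral_def nn_integral_eq_integral)
qed

lemma LINT_norm_mono:
  assumes d: "density_on \<mu> W N h" and A: "A \<in> sets borel" "A \<subseteq> B" and B: "B \<in> sets borel" "B \<subseteq> W"
  shows "(LINT x:A|N. norm (h x)) \<le> (LINT x:B|N. norm (h x))"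
  using set_integrable_norm_density(2)[OF d B] set_integrable_norm_density(2)[OF d A(1)] A B
  unfolding set_lebesgue_integral_def set_integrable_def
  by (intro integral_mono) (auto simp: indicator_def)

text \<open>Regularity is a supremum of total variations in \<open>ennreal\<close>. A local density
  turns it into a compact set whose remainder has a small integral, the form in which it is combined
  with estimates of integrals.\<close>

lemma regular_measure_approx:
  fixes \<sigma> :: "'a::t2_space set \<Rightarrow> complex"
  assumes \<sigma>: "\<sigma> \<in> regular_measures" and W: "W \<in> cborel" and d: "density_on \<sigma> W N h"
    and A: "A \<in> sets borel" "A \<subseteq> W" and e: "0 < e"
  shows "\<exists>C. compact C \<and> C \<subseteq> A \<and> (LINT x:A - C|N. norm (h x)) < e"
proof -
  note R = borel_ring_cborel
  have Ac: "A \<in> cborel" using borel_ring_subset[OF R W A] .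
  have tv: "total_var cborel \<sigma> B = ennreal (LINT x:B|N. norm (h x))" if "B \<in> sets borel" "B \<subseteq> W" for B
    using total_var_emeasure[OF R W d that] set_integrable_norm_density(3)[OF d that] by simp
  have nn: "0 \<le> (LINT x:B|N. norm (h x))" for B
    unfolding set_lebesgue_integral_def by (rule Bochner_Integration.integral_nonneg) auto
  have "\<exists>C. compact C \<and> C \<subseteq> A \<and> (LINT x:A|N. norm (h x)) < (LINT x:C|N. norm (h x)) + e"
  proof (rule ccontr)
    assume no: "\<not> ?thesis"
    have "total_var cborel \<sigma> A = (SUP C\<in>{C. C \<subseteq> A \<and> compact C}. total_var cborel \<sigma> C)"
      using \<sigma> Ac by (simp add: regular_measures_def)
    also have "\<dots> \<le> ennreal (max 0 ((LINT x:A|N. norm (h x)) - e))"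
    proof (rule SUP_least)
      fix C assume C: "C \<in> {C. C \<subseteq> A \<and> compact C}"
      then have "\<not> (LINT x:A|N. norm (h x)) < (LINT x:C|N. norm (h x)) + e" using no by blast
      moreover have "total_var cborel \<sigma> C = ennreal (LINT x:C|N. norm (h x))"
        using C A by (intro tv) (auto simp: compact_imp_borel)
      ultimately show "total_var cborel \<sigma> C \<le> ennreal (max 0 ((LINT x:A|N. norm (h x)) - e))"
        by (simp add: ennreal_leI)
    qed
    finally have "(LINT x:A|N. norm (h x)) \<le> max 0 ((LINT x:A|N. norm (h x)) - e)"
      unfolding tv[OF A] by simp
    then have "(LINT x:A|N. norm (h x)) \<le> 0" using e by (auto simp: max_def split: if_splits)
    moreover have "\<not> (LINT x:A|N. norm (h x)) < (LINT x:{}|N. norm (h x)) + e" using no compact_empty by blast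
    ultimately show False using e by (simp add: set_lebesgue_integral_def)
  qed
  then obtain C where C: "compact C" "C \<subseteq> A" "(LINT x:A|N. norm (h x)) < (LINT x:C|N. norm (h x)) + e" by blast
  have Cb: "C \<in> sets borel" using C(1) by (rule compact_imp_borel)
  have "(LINT x:C \<union> (A - C)|N. norm (h x)) = (LINT x:C|N. norm (h x)) + (LINT x:A - C|N. norm (h x))"
    using C A Cb by (intro set_integral_Un set_integrable_norm_density(2)[OF d]) auto
  moreover have "C \<union> (A - C) = A" using C by auto
  ultimately have "(LINT x:A - C|N. norm (h x)) < e" using C(3) by simp
  then show ?thesis using C by blast
qed

lemma norm_diff_density_le:
  assumes d: "density_on \<mu> W N h" and A: "A \<in> sets borel" "A \<subseteq> W" and C: "C \<in> sets borel" "C \<subseteq> A"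
  shows "norm (\<mu> A - \<mu> C) \<le> (LINT x:A - C|N. norm (h x))"
proof -
  have i: "set_integrable N (A - C) h" "set_integrable N C h"
    using A C by (auto intro!: set_integrable_norm_density(1)[OF d])
  have "(LINT x:C \<union> (A - C)|N. h x) = (LINT x:C|N. h x) + (LINT x:A - C|N. h x)"
    using i by (intro set_integral_Un) auto
  moreover have "C \<union> (A - C) = A" using C by auto
  ultimately have "\<mu> A - \<mu> C = (LINT x:A - C|N. h x)"
    using density_onD(4)[OF d, of A] density_onD(4)[OF d, of C] A C by auto
  moreover have "norm (LINT x:A - C|N. h x) \<le> (LINT x:A - C|N. norm (h x))"
    using integral_norm_bound[of N "\<lambda>x. indicator (A - C) x *\<^sub>R h x"] by (simp add: set_lebesgue_integral_def)
  ultimately show ?thesis by simp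
qed

text \<open>As \<open>f\<close> is 1 on \<open>C\<close> and 0 off \<open>V\<close>, the integrands
  differ only on \<open>V - C\<close>, and there by at most the modulus of the density.\<close>

lemma dr_integral_close_to_compact:
  fixes \<sigma> :: "'a::t2_space set \<Rightarrow> complex"
  assumes \<sigma>: "\<sigma> \<in> regular_measures" and W: "W \<in> cborel" and d: "density_on \<sigma> W N h"
    and C: "C \<in> sets borel" "C \<subseteq> V" and V: "V \<in> sets borel" "V \<subseteq> W"
    and f: "f \<in> borel_measurable borel" "\<And>x. norm (f x) \<le> 1" "\<And>x. x \<in> C \<Longrightarrow> f x = 1" "\<And>x. x \<notin> V \<Longrightarrow> f x = 0"
  shows "norm (dr_integral cborel \<sigma> f - \<sigma> C) \<le> (LINT x:V - C|N. norm (h x))"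
proof -
  note R = borel_ring_cborel
  have cm: "complex_measure_on cborel \<sigma>" using \<sigma> by (simp add: regular_measures_def)
  have Wb: "W \<in> sets borel" using R W by (rule borel_ring_sets)
  have fi: "set_integrable N W (\<lambda>x. f x * h x)"
    by (rule set_integrable_bounded_mult[OF d Wb f(1,2)])
  have ci: "set_integrable N C h" "set_integrable N (V - C) (\<lambda>x. norm (h x))"
    using C V by (auto intro!: set_integrable_norm_density[OF d])
  have "dr_integral cborel \<sigma> f = (LINT x:W|N. f x * h x)"
    using f(2,4) V(2) by (intro dr_integral_bounded[OF R density_on_exists[OF R _ cm] W d f(1)]) auto
  then have "dr_integral cborel \<sigma> f - \<sigma> C = (\<integral>x. indicator W x *\<^sub>R (f x * h x) - indicator C x *\<^sub>R h x \<partial>N)"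
    using fi ci(1) density_onD(4)[OF d, of C] C V
    by (subst Bochner_Integration.integral_diff) (auto simp: set_lebesgue_integral_def set_integrable_def)
  also have "norm \<dots> \<le> (\<integral>x. norm (indicator W x *\<^sub>R (f x * h x) - indicator C x *\<^sub>R h x) \<partial>N)"
    by (rule integral_norm_bound)
  also have "\<dots> \<le> (\<integral>x. indicator (V - C) x *\<^sub>R norm (h x) \<partial>N)"
  proof (rule integral_mono)
    show "integrable N (\<lambda>x. norm (indicator W x *\<^sub>R (f x * h x) - indicator C x *\<^sub>R h x))"
      using fi ci(1) unfolding set_integrable_def by (intro integrable_norm Bochner_Integration.integrable_diff)
    show "integrable N (\<lambda>x. indicator (V - C) x *\<^sub>R norm (h x))"
      using ci(2) by (simp add: set_integrable_def)
    fix x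
    have "norm (f x) * norm (h x) \<le> 1 * norm (h x)" using f(2)[of x] by (intro mult_right_mono) auto
    then show "norm (indicator W x *\<^sub>R (f x * h x) - indicator C x *\<^sub>R h x) \<le> indicator (V - C) x *\<^sub>R norm (h x)"
      using f(3,4)[of x] C V by (auto simp: indicator_def norm_mult)
  qed
  finally show ?thesis by (simp add: set_lebesgue_integral_def)
qed

text \<open>Supplies the uniqueness behind the definite description in \<open>prod_meas\<close>.
  Values on a compact set are recovered from test functions that are 1 on it and vanish off a small
  neighbourhood, and inner regularity extends the agreement from compact sets to all of
  \<open>cborel\<close>.\<close>

lemma regular_measures_eqI:
  fixes \<sigma> \<tau> :: "'a::t2_space set \<Rightarrow> complex"
  assumes lc: "locally_compact_space (euclidean :: 'a topology)"
    and \<sigma>: "\<sigma> \<in> regular_measures" and \<tau>: "\<tau> \<in> regular_measures"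
    and eq: "\<And>f. f \<in> C00 \<Longrightarrow> dr_integral cborel \<sigma> f = dr_integral cborel \<tau> f"
  shows "\<sigma> = \<tau>"
proof
  note R = borel_ring_cborel
  have cm: "complex_measure_on cborel \<sigma>" "complex_measure_on cborel \<tau>"
    using \<sigma> \<tau> by (simp_all add: regular_measures_def)
  have comp: "\<sigma> C = \<tau> C" if C: "compact C" for C
  proof -
    have Cb: "C \<in> sets borel" using C by (rule compact_imp_borel)
    obtain W where W: "open W" "C \<subseteq> W" "compact (closure W)"
      using compact_open_separation[OF lc C open_UNIV] by auto
    have Wc: "W \<in> cborel" using W by (simp add: cborel_def)
    obtain N h where d: "density_on \<sigma> W N h" using density_on_exists[OF R Wc cm(1)] by blast
    obtain N' h' where d': "density_on \<tau> W N' h'" using density_on_exists[OF R Wc cm(2)] by blast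
    have "norm (\<sigma> C - \<tau> C) \<le> 2 * e" if e: "0 < e" for e
    proof -
      have WC: "W - C \<in> sets borel" "W - C \<subseteq> W" using W Cb by auto
      obtain D where D: "compact D" "D \<subseteq> W - C" "(LINT x:W - C - D|N. norm (h x)) < e"
        using regular_measure_approx[OF \<sigma> Wc d WC e] by blast
      obtain D' where D': "compact D'" "D' \<subseteq> W - C" "(LINT x:W - C - D'|N'. norm (h' x)) < e"
        using regular_measure_approx[OF \<tau> Wc d' WC e] by blast
      \<comment> \<open>Outer regularity at \<open>C\<close> is derived from inner regularity of
        \<open>W - C\<close>: \<open>D\<close> and \<open>D'\<close> take up all but
        \<open>e\<close> of the two variations there, so one open set \<open>V\<close> around
        \<open>C\<close> is tight for both measures.\<close>
      define V where "V = W - (D \<union> D')"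
      have V: "open V" "C \<subseteq> V" "V \<subseteq> W"
        using W D D' by (auto simp: V_def intro!: open_Diff compact_imp_closed compact_Un)
      obtain f :: "'a \<Rightarrow> real" where f: "continuous_on UNIV f" "\<And>x. 0 \<le> f x \<and> f x \<le> 1" "\<And>x. x \<in> C \<Longrightarrow> f x = 1"
         "\<And>x. x \<notin> V \<Longrightarrow> f x = 0" "compact (closure {x. f x \<noteq> 0})"
        using Urysohn_compact_support[OF lc C V(1,2)] by blast
      define F where "F x = complex_of_real (f x)" for x
      have Fc: "continuous_on UNIV F" unfolding F_def using f(1) by (intro continuous_intros)
      have F: "F \<in> C00" using Fc f(5) by (simp add: C00_def F_def)
      have Fm: "F \<in> borel_measurable borel" using Fc by (rule borel_measurable_continuous_onI)
      have F1: "norm (F x) \<le> 1" "x \<in> C \<Longrightarrow> F x = 1" "x \<notin> V \<Longrightarrow> F x = 0" for x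
        using f(2)[of x] f(3,4) by (auto simp: F_def)
      have Vb: "V \<in> sets borel" using V by simp
      have "norm (dr_integral cborel \<sigma> F - \<sigma> C) \<le> (LINT x:V - C|N. norm (h x))"
        by (rule dr_integral_close_to_compact[OF \<sigma> Wc d Cb V(2) Vb V(3) Fm F1])
      also have "\<dots> \<le> (LINT x:W - C - D|N. norm (h x))"
        using Vb Cb W D by (intro LINT_norm_mono[OF d]) (auto simp: V_def compact_imp_borel)
      also have "\<dots> < e" by fact
      finally have 1: "norm (dr_integral cborel \<sigma> F - \<sigma> C) < e" .
      have "norm (dr_integral cborel \<tau> F - \<tau> C) \<le> (LINT x:V - C|N'. norm (h' x))"
        by (rule dr_integral_close_to_compact[OF \<tau> Wc d' Cb V(2) Vb V(3) Fm F1])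
      also have "\<dots> \<le> (LINT x:W - C - D'|N'. norm (h' x))"
        using Vb Cb W D' by (intro LINT_norm_mono[OF d']) (auto simp: V_def compact_imp_borel)
      also have "\<dots> < e" by fact
      finally have 2: "norm (dr_integral cborel \<tau> F - \<tau> C) < e" .
      have "\<sigma> C - \<tau> C = (dr_integral cborel \<tau> F - \<tau> C) - (dr_integral cborel \<sigma> F - \<sigma> C)"
        using eq[OF F] by simp
      then show ?thesis
        using 1 2 norm_triangle_ineq4[of "dr_integral cborel \<tau> F - \<tau> C" "dr_integral cborel \<sigma> F - \<sigma> C"] by simp
    qed
    then have "norm (\<sigma> C - \<tau> C) \<le> e" if "0 < e" for e using that half_gt_zero[of e] by fastforce
    then have "norm (\<sigma> C - \<tau> C) \<le> 0" by (rule field_le_epsilon[of _ 0, simplified])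
    then show ?thesis by simp
  qed
  fix A
  show "\<sigma> A = \<tau> A"
  proof (cases "A \<in> cborel")
    case A: True
    then have Ab: "A \<in> sets borel" by (rule borel_ring_sets[OF R])
    obtain N h where d: "density_on \<sigma> A N h" using density_on_exists[OF R A cm(1)] by blast
    obtain N' h' where d': "density_on \<tau> A N' h'" using density_on_exists[OF R A cm(2)] by blast
    have "norm (\<sigma> A - \<tau> A) \<le> 0 + e" if e: "0 < e" for e
    proof -
      have e2: "0 < e / 2" using e by simp
      obtain D where D: "compact D" "D \<subseteq> A" "(LINT x:A - D|N. norm (h x)) < e / 2"
        using regular_measure_approx[OF \<sigma> A d Ab order_refl e2] by blast
      obtain D' where D': "compact D'" "D' \<subseteq> A" "(LINT x:A - D'|N'. norm (h' x)) < e / 2"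
        using regular_measure_approx[OF \<tau> A d' Ab order_refl e2] by blast
      define C where "C = D \<union> D'"
      have C: "compact C" "C \<subseteq> A" using D D' by (auto simp: C_def)
      have Cb: "C \<in> sets borel" using C(1) by (rule compact_imp_borel)
      have "norm (\<sigma> A - \<sigma> C) \<le> (LINT x:A - C|N. norm (h x))"
        by (rule norm_diff_density_le[OF d Ab order_refl Cb C(2)])
      also have "\<dots> \<le> (LINT x:A - D|N. norm (h x))"
        using Ab Cb D by (intro LINT_norm_mono[OF d]) (auto simp: C_def compact_imp_borel)
      finally have 1: "norm (\<sigma> A - \<sigma> C) < e / 2" using D(3) by simp
      have "norm (\<tau> A - \<tau> C) \<le> (LINT x:A - C|N'. norm (h' x))"
        by (rule norm_diff_density_le[OF d' Ab order_refl Cb C(2)])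
      also have "\<dots> \<le> (LINT x:A - D'|N'. norm (h' x))"
        using Ab Cb D' by (intro LINT_norm_mono[OF d']) (auto simp: C_def compact_imp_borel)
      finally have 2: "norm (\<tau> A - \<tau> C) < e / 2" using D'(3) by simp
      have "\<sigma> A - \<tau> A = (\<sigma> A - \<sigma> C) - (\<tau> A - \<tau> C)" using comp[OF C(1)] by simp
      then show ?thesis using 1 2 norm_triangle_ineq4[of "\<sigma> A - \<sigma> C" "\<tau> A - \<tau> C"] by simp
    qed
    then have "norm (\<sigma> A - \<tau> A) \<le> 0" by (rule field_le_epsilon)
    then show ?thesis by simp
  next
    case False
    then show ?thesis using cm by (simp add: complex_measure_on_def)
  qed
qed

section \<open>The maximal extension of a measure with a density\<close>

lemma ext_ring_meas:
  fixes M :: "'a::t2_space measure"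
  assumes M: "radon M" and h: "locally_integrable M h"
  shows "ext_ring (meas M h) = {A \<in> sets borel. \<exists>U. open U \<and> A \<subseteq> U \<and> (\<integral>\<^sup>+x\<in>U. ennreal (norm (h x)) \<partial>M) < \<infinity>}"
  unfolding ext_ring_def using SUP_total_var_meas[OF M h] by (auto simp: less_top)

lemma borel_ring_ext_ring:
  fixes M :: "'a::t2_space measure"
  assumes M: "radon M" and h: "locally_integrable M h"
  shows "borel_ring (ext_ring (meas M h))"
  unfolding borel_ring_def
proof (intro conjI ballI impI)
  note e = ext_ring_meas[OF M h]
  show "ext_ring (meas M h) \<subseteq> sets borel" by (auto simp: e)
  show "{} \<in> ext_ring (meas M h)" by (auto simp: e intro: exI[of _ "{}"])
  fix A B
  show "B \<in> ext_ring (meas M h)" if "A \<in> ext_ring (meas M h)" "B \<in> sets borel" "B \<subseteq> A"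
    using that unfolding e by blast
  show "A \<union> B \<in> ext_ring (meas M h)" if AB: "A \<in> ext_ring (meas M h)" "B \<in> ext_ring (meas M h)"
  proof -
    note [measurable_cong] = radonD(1)[OF M]
    have [measurable]: "h \<in> borel_measurable borel" using h by (simp add: locally_integrable_def)
    obtain U V where UV: "open U" "A \<subseteq> U" "(\<integral>\<^sup>+x\<in>U. ennreal (norm (h x)) \<partial>M) < \<infinity>"
      "open V" "B \<subseteq> V" "(\<integral>\<^sup>+x\<in>V. ennreal (norm (h x)) \<partial>M) < \<infinity>"
      using AB unfolding e by blast
    have [measurable]: "U \<in> sets borel" "V \<in> sets borel" using UV by auto
    have "(\<integral>\<^sup>+x\<in>U \<union> V. ennreal (norm (h x)) \<partial>M)
        \<le> (\<integral>\<^sup>+x. ennreal (norm (h x)) * indicator U x + ennreal (norm (h x)) * indicator V x \<partial>M)"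
      by (intro nn_integral_mono) (auto simp: indicator_def)
    also have "\<dots> = (\<integral>\<^sup>+x\<in>U. ennreal (norm (h x)) \<partial>M) + (\<integral>\<^sup>+x\<in>V. ennreal (norm (h x)) \<partial>M)"
      by (intro nn_integral_add) measurable
    also have "\<dots> < \<infinity>" using UV by simp
    finally have "(\<integral>\<^sup>+x\<in>U \<union> V. ennreal (norm (h x)) \<partial>M) < \<infinity>" .
    then show ?thesis
      using AB UV unfolding e by (auto intro!: exI[of _ "U \<union> V"])
  qed
qed

lemma ext_ring_integrable:
  fixes M :: "'a::t2_space measure"
  assumes M: "radon M" and h: "locally_integrable M h" and A: "A \<in> ext_ring (meas M h)"
  shows "set_integrable M A h"
proof -
  note [measurable_cong] = radonD(1)[OF M]
  have [measurable]: "h \<in> borel_measurable borel" using h by (simp add: locally_integrable_def)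
  obtain U where U: "A \<in> sets borel" "A \<subseteq> U" "(\<integral>\<^sup>+x\<in>U. ennreal (norm (h x)) \<partial>M) < \<infinity>"
    using A by (auto simp: ext_ring_meas[OF M h])
  have [measurable]: "A \<in> sets borel" by fact
  have "(\<integral>\<^sup>+x. ennreal (norm (indicator A x *\<^sub>R h x)) \<partial>M) \<le> (\<integral>\<^sup>+x\<in>U. ennreal (norm (h x)) \<partial>M)"
    using U(2) by (intro nn_integral_mono) (auto simp: indicator_def)
  then have "(\<integral>\<^sup>+x. ennreal (norm (indicator A x *\<^sub>R h x)) \<partial>M) < \<infinity>" using U(3) by simp
  then show ?thesis unfolding set_integrable_def by (intro integrableI_bounded) auto
qed

text \<open>The union of two compact subsets is again one, so the tails form a filter base and a
  single tail decides.\<close>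

lemma eventually_compact_subsets_at_top:
  "eventually P (compact_subsets_at_top A) \<longleftrightarrow>
     (\<exists>C. compact C \<and> C \<subseteq> A \<and> (\<forall>D. compact D \<and> C \<subseteq> D \<and> D \<subseteq> A \<longrightarrow> P D))"
  unfolding compact_subsets_at_top_def
proof (subst eventually_INF_base)
  show "{C. compact C \<and> C \<subseteq> A} \<noteq> {}" by auto
  fix C D assume "C \<in> {C. compact C \<and> C \<subseteq> A}" "D \<in> {C. compact C \<and> C \<subseteq> A}"
  then show "\<exists>X\<in>{C. compact C \<and> C \<subseteq> A}. principal {D. compact D \<and> X \<subseteq> D \<and> D \<subseteq> A}
      \<le> inf (principal {D. compact D \<and> C \<subseteq> D \<and> D \<subseteq> A}) (principal {E. compact E \<and> D \<subseteq> E \<and> E \<subseteq> A})"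
    by (intro bexI[of _ "C \<union> D"]) auto
qed (auto simp: eventually_principal)

text \<open>The density is integrable over a member of the ring, and a compact \<open>C\<close> can
  be chosen that misses less than \<open>e\<close> of the integral of its modulus. Beyond
  \<open>C\<close> all values of the net are within \<open>e\<close> of the integral over
  \<open>A\<close>.\<close>

lemma ext_measure_meas:
  fixes M :: "'a::t2_space measure"
  assumes M: "radon M" and h: "locally_integrable M h" and A: "A \<in> ext_ring (meas M h)"
  shows "ext_measure (meas M h) A = (LINT x:A|M. h x)"
proof -
  note sM[measurable_cong] = radonD(1)[OF M]
  have hm[measurable]: "h \<in> borel_measurable borel" using h by (simp add: locally_integrable_def)
  have Ab: "A \<in> sets borel" using A by (simp add: ext_ring_def)
  have d: "density_on (\<lambda>B. LINT x:B|M. h x) A M h"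
    using sM hm ext_ring_integrable[OF M h A] by (simp add: density_on_def)
  let ?N = "density M (\<lambda>x. ennreal (norm (h x)))"
  have "(meas M h \<longlongrightarrow> (LINT x:A|M. h x)) (compact_subsets_at_top A)"
  proof (rule tendstoI)
    fix e :: real assume e: "0 < e"
    have N: "emeasure ?N B = ennreal (LINT x:B|M. norm (h x))" if "B \<in> sets borel" "B \<subseteq> A" for B
      using set_integrable_norm_density(3)[OF d that] .
    have nn: "0 \<le> (LINT x:B|M. norm (h x))" for B
      unfolding set_lebesgue_integral_def by (rule Bochner_Integration.integral_nonneg) auto
    have S: "emeasure ?N A = (SUP C\<in>{C. C \<subseteq> A \<and> compact C}. emeasure ?N C)"
      using sM Ab by (intro emeasure_radon_SUP[OF M] absolutely_continuousI_density) (auto simp: compact_imp_borel)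
    \<comment> \<open>If the whole integral is below \<open>e\<close> the empty set will do;
      separating this case keeps the difference inside \<open>ennreal\<close> nonnegative.\<close>
    have "\<exists>C. compact C \<and> C \<subseteq> A \<and> (LINT x:A|M. norm (h x)) < (LINT x:C|M. norm (h x)) + e"
    proof (cases "(LINT x:A|M. norm (h x)) < e")
      case True
      then show ?thesis by (intro exI[of _ "{}"]) (simp add: set_lebesgue_integral_def)
    next
      case False
      have "ennreal ((LINT x:A|M. norm (h x)) - e) < emeasure ?N A"
        using e False nn[of A] N[OF Ab order_refl] by (auto simp: ennreal_less_iff)
      then obtain C where C: "C \<subseteq> A" "compact C" "ennreal ((LINT x:A|M. norm (h x)) - e) < emeasure ?N C"
        unfolding S less_SUP_iff by auto
      then have "(LINT x:A|M. norm (h x)) - e < (LINT x:C|M. norm (h x))"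
        using N[of C] False nn by (simp add: compact_imp_borel ennreal_less_iff)
      then show ?thesis using C by (intro exI[of _ C]) simp
    qed
    then obtain C where C: "compact C" "C \<subseteq> A" "(LINT x:A|M. norm (h x)) < (LINT x:C|M. norm (h x)) + e" by blast
    have "dist (meas M h D) (LINT x:A|M. h x) < e" if D: "compact D" "C \<subseteq> D" "D \<subseteq> A" for D
    proof -
      have Db: "D \<in> sets borel" "C \<in> sets borel" using D C by (auto simp: compact_imp_borel)
      have "meas M h D = (LINT x:D|M. h x)" using D(1) by (simp add: meas_def compact_in_cborel)
      then have "dist (meas M h D) (LINT x:A|M. h x) = norm ((LINT x:A|M. h x) - (LINT x:D|M. h x))"
        by (simp add: dist_norm norm_minus_commute)
      also have "\<dots> \<le> (LINT x:A - D|M. norm (h x))"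
        using norm_diff_density_le[OF d Ab order_refl Db(1) D(3)] .
      also have "\<dots> \<le> (LINT x:A - C|M. norm (h x))"
        using Db Ab D by (intro LINT_norm_mono[OF d]) auto
      also have "\<dots> < e"
      proof -
        have "(LINT x:C \<union> (A - C)|M. norm (h x)) = (LINT x:C|M. norm (h x)) + (LINT x:A - C|M. norm (h x))"
          using C Ab Db by (intro set_integral_Un set_integrable_norm_density(2)[OF d]) auto
        moreover have "C \<union> (A - C) = A" using C by auto
        ultimately show ?thesis using C(3) by simp
      qed
      finally show ?thesis .
    qed
    then show "\<forall>\<^sub>F D in compact_subsets_at_top A. dist (meas M h D) (LINT x:A|M. h x) < e"
      unfolding eventually_compact_subsets_at_top using C by blast
  qed
  moreover have "compact_subsets_at_top A \<noteq> bot"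
    unfolding trivial_limit_def eventually_compact_subsets_at_top by auto
  ultimately have "Lim (compact_subsets_at_top A) (meas M h) = (LINT x:A|M. h x)"
    by (intro tendsto_Lim)
  then show ?thesis using A by (simp add: ext_measure_def)
qed

text \<open>The extension has the same density on its larger ring, so
  \<open>dr_integral_density\<close> and \<open>L1_density\<close> apply to it unchanged.\<close>

lemma density_on_ext_measure:
  fixes M :: "'a::t2_space measure"
  assumes M: "radon M" and h: "locally_integrable M h" and A: "A \<in> ext_ring (meas M h)"
  shows "density_on (ext_measure (meas M h)) A M h"
  using ext_measure_meas[OF M h] ext_ring_integrable[OF M h A] borel_ring_subset[OF borel_ring_ext_ring[OF M h] A]
    radonD(1)[OF M] h
  by (simp add: density_on_def locally_integrable_def)

section \<open>Images and products of densities\<close>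

text \<open>Compact sets exhausting the preimage of \<open>B\<close> have compact images inside
  \<open>B\<close>, and what these images miss pulls back into a null set.\<close>

lemma radon_distr:
  fixes M :: "'a::t2_space measure" and p :: "'a \<Rightarrow> 'b::t2_space"
  assumes M: "radon M" and p: "continuous_on UNIV p"
  shows "radon (distr M borel p)"
proof (rule radonI_sequence)
  interpret finite_measure M using M by (rule radonD)
  have pm: "p \<in> M \<rightarrow>\<^sub>M borel"
    using borel_measurable_continuous_onI[OF p] radonD(1)[OF M] by (simp cong: measurable_cong_sets)
  show "finite_measure (distr M borel p)" using pm by (rule finite_measure_distr)
  fix B :: "'b set" assume B: "B \<in> sets borel"
  have pB: "p -` B \<in> sets borel" using measurable_sets[OF borel_measurable_continuous_onI[OF p] B] by simp
  obtain C where C: "incseq C" "\<And>n. compact (C n)" "\<And>n. C n \<subseteq> p -` B" "emeasure M (p -` B - (\<Union>n. C n)) = 0"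
    using radon_compacts[OF M pB] by metis
  have D: "compact (p ` C n)" "p ` C n \<subseteq> B" for n
    using C(2,3)[of n] p by (auto intro!: compact_continuous_image intro: continuous_on_subset)
  have m: "B - (\<Union>n. p ` C n) \<in> sets borel"
    using B D(1) by (intro sets.Diff sets.countable_UN) (auto simp: compact_imp_borel)
  have "emeasure (distr M borel p) (B - (\<Union>n. p ` C n)) = emeasure M (p -` (B - (\<Union>n. p ` C n)))"
    using emeasure_distr[OF pm m] radonD(3)[OF M] by simp
  also have "\<dots> \<le> emeasure M (p -` B - (\<Union>n. C n))"
    using pB C(2) radonD(1)[OF M]
    by (intro emeasure_mono sets.Diff sets.countable_UN) (auto simp: compact_imp_borel)
  finally have "emeasure (distr M borel p) (B - (\<Union>n. p ` C n)) = 0" using C(4) by simp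
  then show "\<exists>D::nat \<Rightarrow> 'b set. (\<forall>n. compact (D n) \<and> D n \<subseteq> B) \<and> emeasure (distr M borel p) (B - (\<Union>n. D n)) = 0"
    using D by (intro exI[of _ "\<lambda>n. p ` C n"]) auto
qed simp

text \<open>\<open>D\<close> plays the role of a conditional expectation of \<open>d\<close> given
  \<open>p\<close>: it is the Radon-Nikodym derivative of the image of \<open>density M d\<close>
  with respect to the image of \<open>M\<close>.\<close>

lemma pushforward_real_density:
  fixes d :: "'a \<Rightarrow> real" and p :: "'a \<Rightarrow> 'b::topological_space"
  assumes fin: "finite_measure M" and p: "p \<in> M \<rightarrow>\<^sub>M borel" and d: "integrable M d" "\<And>x. 0 \<le> d x"
  shows "\<exists>D::'b \<Rightarrow> real. D \<in> borel_measurable borel \<and> (\<forall>y. 0 \<le> D y) \<and>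
    (\<forall>\<phi>::'b \<Rightarrow> complex. \<phi> \<in> borel_measurable borel \<longrightarrow> integrable M (\<lambda>x. d x *\<^sub>R \<phi> (p x)) \<longrightarrow>
      integrable (distr M borel p) (\<lambda>y. D y *\<^sub>R \<phi> y) \<and>
      (\<integral>y. D y *\<^sub>R \<phi> y \<partial>distr M borel p) = (\<integral>x. d x *\<^sub>R \<phi> (p x) \<partial>M))"
proof -
  interpret finite_measure M by fact
  have [measurable]: "d \<in> borel_measurable M" using d by auto
  let ?Q = "distr M borel p" and ?N = "density M (\<lambda>x. ennreal (d x))"
  have pN: "p \<in> ?N \<rightarrow>\<^sub>M borel" using p by simp
  have "emeasure ?N (space ?N) = (\<integral>\<^sup>+x. ennreal (d x) \<partial>M)"
    by (subst emeasure_density) (auto intro!: nn_integral_cong)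
  also have "\<dots> = ennreal (\<integral>x. d x \<partial>M)" using d by (intro nn_integral_eq_integral) auto
  finally have fN: "finite_measure ?N" by (intro finite_measureI) simp
  have "absolutely_continuous ?Q (distr ?N borel p)"
    unfolding absolutely_continuous_def
  proof
    fix B assume "B \<in> null_sets ?Q"
    then have B: "B \<in> sets borel" "p -` B \<inter> space M \<in> null_sets M"
      using p by (auto simp: null_sets_distr_iff)
    then have "p -` B \<inter> space M \<in> null_sets ?N"
      using absolutely_continuousI_density[of "\<lambda>x. ennreal (d x)" M] by (auto simp: absolutely_continuous_def)
    then show "B \<in> null_sets (distr ?N borel p)" using B pN by (simp add: null_sets_distr_iff)
  qed
  then obtain D :: "'b \<Rightarrow> real" where D: "D \<in> borel_measurable ?Q" "\<And>y. 0 \<le> D y"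
    and eq: "distr ?N borel p = density ?Q (\<lambda>y. ennreal (D y))"
    using real_density_of_absolutely_continuous[OF finite_measure_distr[OF p] finite_measure.finite_measure_distr[OF fN pN]]
    by auto
  have "integrable ?Q (\<lambda>y. D y *\<^sub>R \<phi> y) \<and> (\<integral>y. D y *\<^sub>R \<phi> y \<partial>?Q) = (\<integral>x. d x *\<^sub>R \<phi> (p x) \<partial>M)"
    if \<phi>: "\<phi> \<in> borel_measurable borel" and i: "integrable M (\<lambda>x. d x *\<^sub>R \<phi> (p x))" for \<phi> :: "'b \<Rightarrow> complex"
  proof -
    have \<phi>p: "(\<lambda>x. \<phi> (p x)) \<in> borel_measurable M" using measurable_compose[OF p \<phi>] .
    have "integrable ?N (\<lambda>x. \<phi> (p x))"
      using i d(2) \<phi>p by (subst integrable_density) auto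
    then have "integrable (distr ?N borel p) \<phi>" using \<phi> pN by (simp add: integrable_distr_eq)
    then have 1: "integrable ?Q (\<lambda>y. D y *\<^sub>R \<phi> y)"
      unfolding eq using D \<phi> by (subst (asm) integrable_density) auto
    have "(\<integral>y. D y *\<^sub>R \<phi> y \<partial>?Q) = (\<integral>y. \<phi> y \<partial>distr ?N borel p)"
      unfolding eq using D \<phi> by (subst integral_density) auto
    also have "\<dots> = (\<integral>x. \<phi> (p x) \<partial>?N)" by (rule integral_distr[OF pN \<phi>])
    also have "\<dots> = (\<integral>x. d x *\<^sub>R \<phi> (p x) \<partial>M)" using d(2) \<phi>p by (subst integral_density) auto
    finally show ?thesis using 1 by blast
  qed
  moreover have "D \<in> borel_measurable borel" using D(1) by simp
  ultimately show ?thesis using D(2) by blast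
qed

text \<open>The positive and negative parts of the real and imaginary part of \<open>G\<close> are
  pushed forward separately. Each is dominated by the modulus of \<open>G\<close>, so a function
  integrable against \<open>G\<close> is integrable against every part and the four identities may
  be added.\<close>

lemma pushforward_complex_density:
  fixes G :: "'a \<Rightarrow> complex" and p :: "'a \<Rightarrow> 'b::topological_space"
  assumes fin: "finite_measure M" and p: "p \<in> M \<rightarrow>\<^sub>M borel" and G: "integrable M G"
  shows "\<exists>k::'b \<Rightarrow> complex. k \<in> borel_measurable borel \<and>
    (\<forall>\<phi>::'b \<Rightarrow> complex. \<phi> \<in> borel_measurable borel \<longrightarrow> integrable M (\<lambda>x. \<phi> (p x) * G x) \<longrightarrow>
      integrable (distr M borel p) (\<lambda>y. \<phi> y * k y) \<and>
      (\<integral>y. \<phi> y * k y \<partial>distr M borel p) = (\<integral>x. \<phi> (p x) * G x \<partial>M))"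
proof -
  let ?Q = "distr M borel p"
  have [measurable]: "G \<in> borel_measurable M" using G by auto
  define pushes where "pushes e D \<longleftrightarrow> D \<in> borel_measurable borel \<and>
    (\<forall>\<phi>::'b \<Rightarrow> complex. \<phi> \<in> borel_measurable borel \<longrightarrow> integrable M (\<lambda>x. \<phi> (p x) * G x) \<longrightarrow>
      integrable M (\<lambda>x. max 0 (e x) *\<^sub>R \<phi> (p x)) \<and> integrable ?Q (\<lambda>y. D y *\<^sub>R \<phi> y) \<and>
      (\<integral>y. D y *\<^sub>R \<phi> y \<partial>?Q) = (\<integral>x. max 0 (e x) *\<^sub>R \<phi> (p x) \<partial>M))" for e :: "'a \<Rightarrow> real" and D :: "'b \<Rightarrow> real"
  have part: "\<exists>D. pushes e D"
    if [measurable]: "e \<in> borel_measurable M" and le: "\<And>x. \<bar>e x\<bar> \<le> norm (G x)" for e :: "'a \<Rightarrow> real"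
  proof -
    have le': "\<bar>max 0 (e x)\<bar> \<le> norm (G x)" for x using le[of x] by (auto simp: max_def)
    have "integrable M (\<lambda>x. max 0 (e x))"
      using G by (rule Bochner_Integration.integrable_bound) (use le' in auto)
    from pushforward_real_density[OF fin p this] obtain D :: "'b \<Rightarrow> real" where D: "D \<in> borel_measurable borel"
      "\<And>\<phi>::'b \<Rightarrow> complex. \<phi> \<in> borel_measurable borel \<Longrightarrow> integrable M (\<lambda>x. max 0 (e x) *\<^sub>R \<phi> (p x)) \<Longrightarrow>
        integrable ?Q (\<lambda>y. D y *\<^sub>R \<phi> y) \<and> (\<integral>y. D y *\<^sub>R \<phi> y \<partial>?Q) = (\<integral>x. max 0 (e x) *\<^sub>R \<phi> (p x) \<partial>M)"
      by auto
    have "integrable M (\<lambda>x. max 0 (e x) *\<^sub>R \<phi> (p x))"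
      if \<phi>: "\<phi> \<in> borel_measurable borel" and i: "integrable M (\<lambda>x. \<phi> (p x) * G x)" for \<phi> :: "'b \<Rightarrow> complex"
    proof (rule Bochner_Integration.integrable_bound[OF i])
      have [measurable]: "(\<lambda>x. \<phi> (p x)) \<in> borel_measurable M" using measurable_compose[OF p \<phi>] .
      show "(\<lambda>x. max 0 (e x) *\<^sub>R \<phi> (p x)) \<in> borel_measurable M" by measurable
      show "AE x in M. norm (max 0 (e x) *\<^sub>R \<phi> (p x)) \<le> norm (\<phi> (p x) * G x)"
      proof (rule AE_I2)
        fix x
        have "norm (\<phi> (p x)) * \<bar>max 0 (e x)\<bar> \<le> norm (\<phi> (p x)) * norm (G x)"
          using le'[of x] by (rule mult_left_mono) simp
        then show "norm (max 0 (e x) *\<^sub>R \<phi> (p x)) \<le> norm (\<phi> (p x) * G x)"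
          by (simp add: norm_mult mult.commute)
      qed
    qed
    then show ?thesis using D unfolding pushes_def by (intro exI[of _ D] conjI allI impI) simp_all
  qed
  obtain D1 D2 D3 D4 where D: "pushes (\<lambda>x. Re (G x)) D1" "pushes (\<lambda>x. - Re (G x)) D2"
      "pushes (\<lambda>x. Im (G x)) D3" "pushes (\<lambda>x. - Im (G x)) D4"
    using part[of "\<lambda>x. Re (G x)"] part[of "\<lambda>x. - Re (G x)"] part[of "\<lambda>x. Im (G x)"] part[of "\<lambda>x. - Im (G x)"]
    by (auto simp: abs_Re_le_cmod abs_Im_le_cmod)
  define k where "k y = complex_of_real (D1 y - D2 y) + \<i> * complex_of_real (D3 y - D4 y)" for y
  have [measurable]: "D1 \<in> borel_measurable borel" "D2 \<in> borel_measurable borel"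
    "D3 \<in> borel_measurable borel" "D4 \<in> borel_measurable borel"
    using D unfolding pushes_def by blast+
  have "k \<in> borel_measurable borel" unfolding k_def by measurable
  moreover have "integrable ?Q (\<lambda>y. \<phi> y * k y) \<and> (\<integral>y. \<phi> y * k y \<partial>?Q) = (\<integral>x. \<phi> (p x) * G x \<partial>M)"
    if \<phi>: "\<phi> \<in> borel_measurable borel" and i: "integrable M (\<lambda>x. \<phi> (p x) * G x)" for \<phi> :: "'b \<Rightarrow> complex"
  proof -
    note P = D[unfolded pushes_def, THEN conjunct2, rule_format, OF \<phi> i]
    have 1: "\<phi> y * k y = (D1 y *\<^sub>R \<phi> y - D2 y *\<^sub>R \<phi> y) + \<i> * (D3 y *\<^sub>R \<phi> y - D4 y *\<^sub>R \<phi> y)" for y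
      by (simp add: k_def scaleR_conv_of_real algebra_simps)
    have m: "max 0 r - max 0 (- r) = r" for r :: real by (auto simp: max_def)
    have 2: "(max 0 (Re (G x)) *\<^sub>R \<phi> (p x) - max 0 (- Re (G x)) *\<^sub>R \<phi> (p x)) +
        \<i> * (max 0 (Im (G x)) *\<^sub>R \<phi> (p x) - max 0 (- Im (G x)) *\<^sub>R \<phi> (p x)) = \<phi> (p x) * G x" for x
    proof -
      have "(max 0 (Re (G x)) *\<^sub>R \<phi> (p x) - max 0 (- Re (G x)) *\<^sub>R \<phi> (p x)) +
        \<i> * (max 0 (Im (G x)) *\<^sub>R \<phi> (p x) - max 0 (- Im (G x)) *\<^sub>R \<phi> (p x)) =
        \<phi> (p x) * (of_real (max 0 (Re (G x)) - max 0 (- Re (G x))) + \<i> * of_real (max 0 (Im (G x)) - max 0 (- Im (G x))))"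
        by (simp add: scaleR_conv_of_real algebra_simps)
      then show ?thesis unfolding m by (simp flip: complex_eq)
    qed
    have "(\<integral>y. \<phi> y * k y \<partial>?Q) = ((\<integral>y. D1 y *\<^sub>R \<phi> y \<partial>?Q) - (\<integral>y. D2 y *\<^sub>R \<phi> y \<partial>?Q)) +
        \<i> * ((\<integral>y. D3 y *\<^sub>R \<phi> y \<partial>?Q) - (\<integral>y. D4 y *\<^sub>R \<phi> y \<partial>?Q))"
      unfolding 1 using P by (subst Bochner_Integration.integral_add) auto
    also have "\<dots> = (\<integral>x. (max 0 (Re (G x)) *\<^sub>R \<phi> (p x) - max 0 (- Re (G x)) *\<^sub>R \<phi> (p x)) +
        \<i> * (max 0 (Im (G x)) *\<^sub>R \<phi> (p x) - max 0 (- Im (G x)) *\<^sub>R \<phi> (p x)) \<partial>M)"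
      using P by (subst Bochner_Integration.integral_add) auto
    finally show ?thesis unfolding 2 using P unfolding 1 by auto
  qed
  ultimately show ?thesis by blast
qed

lemma borel_measurable_fst: "f \<in> borel_measurable borel \<Longrightarrow> (\<lambda>z::'a::topological_space \<times> 'b::topological_space. f (fst z)) \<in> borel_measurable borel"
  using measurable_compose[of fst borel borel f borel]
  by (simp add: borel_measurable_continuous_onI continuous_on_fst continuous_on_id)

lemma borel_measurable_snd: "f \<in> borel_measurable borel \<Longrightarrow> (\<lambda>z::'a::topological_space \<times> 'b::topological_space. f (snd z)) \<in> borel_measurable borel"
  using measurable_compose[of snd borel borel f borel]
  by (simp add: borel_measurable_continuous_onI continuous_on_snd continuous_on_id)

lemma continuous_group_op: "continuous_on UNIV (group_op :: 'a::topological_group_add \<times> 'a \<Rightarrow> 'a)"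
  unfolding group_op_def case_prod_unfold by (intro continuous_intros)

section \<open>Weighted densities on pairs\<close>

context weight
begin

lemma dr_integral_meas:
  assumes g: "weighted_density M g" and f: "f \<in> borel_measurable borel" and c: "carried_by cborel A f" and i: "integrable M (\<lambda>x. f x * g x)"
  shows "dr_integral cborel (meas M g) f = (\<integral>x. f x * g x \<partial>M)" "f \<in> L1 cborel (meas M g)"
  using dr_integral_density[OF borel_ring_cborel density_on_meas[OF weighted_densityD(4)[OF g] weighted_density_locally_integrable[OF g]] f c i]
    L1_density[OF borel_ring_cborel density_on_meas[OF weighted_densityD(4)[OF g] weighted_density_locally_integrable[OF g]] f c i]
  by auto

lemma weight_pair: "weight (\<lambda>z. \<omega> (fst z) * \<omega> (snd z))"
proof
  show "continuous_on UNIV (\<lambda>z::'a \<times> 'a. \<omega> (fst z) * \<omega> (snd z))"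
    using continuous_on_compose[OF continuous_on_fst[OF continuous_on_id], of UNIV \<omega>]
      continuous_on_compose[OF continuous_on_snd[OF continuous_on_id], of UNIV \<omega>] cont
    by (intro continuous_intros) (auto simp: o_def intro: continuous_on_subset)
  show "0 < \<omega> (fst z) * \<omega> (snd z)" for z using pos by simp
qed

interpretation pair: weight "\<lambda>z. \<omega> (fst z) * \<omega> (snd z)"
  by (rule weight_pair)

definition pair_density :: "('a \<Rightarrow> complex) \<Rightarrow> ('a \<Rightarrow> complex) \<Rightarrow> 'a \<times> 'a \<Rightarrow> complex" where
  "pair_density g h = (\<lambda>z. g (fst z) * h (snd z))"

lemma measurable_pair_density: "g \<in> borel_measurable borel \<Longrightarrow> h \<in> borel_measurable borel \<Longrightarrow> pair_density g h \<in> borel_measurable borel"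
  unfolding pair_density_def by (intro borel_measurable_times borel_measurable_fst borel_measurable_snd)

context
  fixes M N :: "'a measure" and g h :: "'a \<Rightarrow> complex"
  assumes g: "weighted_density M g" and h: "weighted_density N h"
begin

text \<open>Weight and density both split into a factor in \<open>s\<close> and one in
  \<open>t\<close>. The norm estimate for convolutions is obtained by comparison with this
  value.\<close>

lemma nn_integral_pair_density:
  "(\<integral>\<^sup>+z. ennreal (\<omega> (fst z) * \<omega> (snd z) * norm (pair_density g h z)) \<partial>rprod M N) =
    ennreal ((\<integral>x. \<omega> x * norm (g x) \<partial>M) * (\<integral>x. \<omega> x * norm (h x) \<partial>N))"
proof -
  note [measurable] = weighted_densityD(2)[OF g] weighted_densityD(2)[OF h]
    and [measurable_cong] = weighted_densityD(4)[OF g] weighted_densityD(4)[OF h]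
  have "(\<lambda>z. ennreal (\<omega> (fst z) * \<omega> (snd z) * norm (pair_density g h z))) \<in> borel_measurable borel"
    using weighted_densityD(2)[OF g] weighted_densityD(2)[OF h]
    by (intro measurable_compose[OF _ measurable_ennreal] borel_measurable_times[OF pair.measurable_weight]
        measurable_compose[OF _ borel_measurable_norm] measurable_pair_density)
  then have "(\<integral>\<^sup>+z. ennreal (\<omega> (fst z) * \<omega> (snd z) * norm (pair_density g h z)) \<partial>rprod M N) =
      (\<integral>\<^sup>+t. \<integral>\<^sup>+s. ennreal (\<omega> s * \<omega> t * norm (pair_density g h (s, t))) \<partial>M \<partial>N)"
    using nn_integral_rprod[OF weighted_densityD(1)[OF g] weighted_densityD(1)[OF h]] by simp
  also have "\<dots> = (\<integral>\<^sup>+t. \<integral>\<^sup>+s. ennreal (\<omega> t * norm (h t)) * ennreal (\<omega> s * norm (g s)) \<partial>M \<partial>N)"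
    using pos by (intro nn_integral_cong) (simp add: pair_density_def norm_mult ennreal_mult[symmetric] less_imp_le mult_ac)
  also have "\<dots> = (\<integral>\<^sup>+t. ennreal (\<omega> t * norm (h t)) * (\<integral>\<^sup>+s. ennreal (\<omega> s * norm (g s)) \<partial>M) \<partial>N)"
    by (intro nn_integral_cong nn_integral_cmult) measurable
  also have "\<dots> = (\<integral>\<^sup>+t. ennreal (\<omega> t * norm (h t)) \<partial>N) * (\<integral>\<^sup>+s. ennreal (\<omega> s * norm (g s)) \<partial>M)"
    by (rule nn_integral_multc) measurable
  also have "\<dots> = ennreal ((\<integral>x. \<omega> x * norm (g x) \<partial>M) * (\<integral>x. \<omega> x * norm (h x) \<partial>N))"
    using pos weighted_norm_integrable[OF g] weighted_norm_integrable[OF h]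
    by (subst (1 2) nn_integral_eq_integral)
      (auto simp: less_imp_le mult.commute ennreal_mult[symmetric] intro!: Bochner_Integration.integral_nonneg)
  finally show ?thesis .
qed

lemma weighted_pair_density: "pair.weighted_density (rprod M N) (pair_density g h)"
proof -
  note sets_rprod[measurable_cong]
  have m[measurable]: "pair_density g h \<in> borel_measurable borel"
    using weighted_densityD(2)[OF g] weighted_densityD(2)[OF h] by (rule measurable_pair_density)
  have "integrable (rprod M N) (\<lambda>z. of_real (\<omega> (fst z) * \<omega> (snd z)) * pair_density g h z)"
  proof (rule integrableI_bounded)
    have "norm (of_real (\<omega> (fst z) * \<omega> (snd z)) * pair_density g h z) = \<omega> (fst z) * \<omega> (snd z) * norm (pair_density g h z)" for z
      using pos by (simp add: norm_mult abs_of_pos)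
    then show "(\<integral>\<^sup>+z. ennreal (norm (of_real (\<omega> (fst z) * \<omega> (snd z)) * pair_density g h z)) \<partial>rprod M N) < \<infinity>"
      using nn_integral_pair_density by simp
    show "(\<lambda>z. of_real (\<omega> (fst z) * \<omega> (snd z)) * pair_density g h z) \<in> borel_measurable (rprod M N)"
      unfolding measurable_cong_sets[OF sets_rprod refl]
      by (intro borel_measurable_times borel_measurable_continuous_onI[OF pair.cont_complex] m)
  qed
  then show ?thesis
    unfolding pair.weighted_density_def
    using radon_rprod[OF weighted_densityD(1)[OF g] weighted_densityD(1)[OF h]] m by simp
qed

text \<open>For each fixed \<open>t\<close> the slice is bounded by the constant
  \<open>c * \<omega> t\<close> times the weight, hence integrable against \<open>g\<close>, and
  symmetrically in the other variable. All slices are covered, so both iterated integrals hold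
  without exceptional points.\<close>

lemma fubini_weighted:
  assumes F: "F \<in> borel_measurable borel" and b: "\<And>s t. norm (F (s, t)) \<le> c * (\<omega> s * \<omega> t)"
  shows "integrable (rprod M N) (\<lambda>z. F z * pair_density g h z)"
    and "integrable M (\<lambda>s. F (s, t) * g s)"
    and "(\<lambda>t. \<integral>s. F (s, t) * g s \<partial>M) \<in> borel_measurable borel"
    and "integrable N (\<lambda>t. (\<integral>s. F (s, t) * g s \<partial>M) * h t)"
    and "(\<integral>z. F z * pair_density g h z \<partial>rprod M N) = (\<integral>t. (\<integral>s. F (s, t) * g s \<partial>M) * h t \<partial>N)"
    and "integrable N (\<lambda>t. F (s, t) * h t)"
    and "(\<lambda>s. \<integral>t. F (s, t) * h t \<partial>N) \<in> borel_measurable borel"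
    and "integrable M (\<lambda>s. (\<integral>t. F (s, t) * h t \<partial>N) * g s)"
    and "(\<integral>z. F z * pair_density g h z \<partial>rprod M N) = (\<integral>s. (\<integral>t. F (s, t) * h t \<partial>N) * g s \<partial>M)"
proof -
  note M = weighted_densityD(1)[OF g] and N = weighted_densityD(1)[OF h]
  note gm = weighted_densityD(2)[OF g] and hm = weighted_densityD(2)[OF h]
  show int: "integrable (rprod M N) (\<lambda>z. F z * pair_density g h z)"
  proof (rule pair.integrable_weight_bound[OF weighted_pair_density F])
    show "norm (F z) \<le> c * (\<omega> (fst z) * \<omega> (snd z))" for z using b[of "fst z" "snd z"] by simp
  qed
  have Fs: "(\<lambda>s. F (s, t)) \<in> borel_measurable borel" "(\<lambda>s. F (t, s)) \<in> borel_measurable borel" for t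
    using measurable_compose[of "\<lambda>s. (s, t)" borel borel F borel] measurable_compose[of "Pair t" borel borel F borel] F
    by (simp_all add: borel_measurable_continuous_onI continuous_intros)
  show i1: "integrable M (\<lambda>s. F (s, t) * g s)" for t
    using b by (intro integrable_weight_bound[OF g Fs(1), of t "c * \<omega> t"]) (simp add: mult_ac)
  show i2: "integrable N (\<lambda>t. F (s, t) * h t)" for s
    using b by (intro integrable_weight_bound[OF h Fs(2), of s "c * \<omega> s"]) (simp add: mult.assoc)
  have m1: "(\<lambda>z. F z * g (fst z)) \<in> borel_measurable borel" and m2: "(\<lambda>z. F z * h (snd z)) \<in> borel_measurable borel"
    and m3: "(\<lambda>z. F z * pair_density g h z) \<in> borel_measurable borel"
    using F gm hm by (auto intro!: borel_measurable_times borel_measurable_fst borel_measurable_snd measurable_pair_density)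
  show "(\<lambda>t. \<integral>s. F (s, t) * g s \<partial>M) \<in> borel_measurable borel"
    using measurable_integral_slice[OF M N m1] i1 by simp
  show "(\<lambda>s. \<integral>t. F (s, t) * h t \<partial>N) \<in> borel_measurable borel"
    using measurable_integral_slice_swap[OF N m2] i2 by simp
  have e1: "F (s, t) * pair_density g h (s, t) = (F (s, t) * g s) * h t" "F (s, t) * pair_density g h (s, t) = (F (s, t) * h t) * g s" for s t
    by (simp_all add: pair_density_def mult_ac)
  have j1: "integrable M (\<lambda>s. F (s, t) * pair_density g h (s, t))" for t
    unfolding e1(1) using i1 by (intro integrable_mult_left)
  have j2: "integrable N (\<lambda>t. F (s, t) * pair_density g h (s, t))" for s
    unfolding e1(2) using i2 by (intro integrable_mult_left)
  show "integrable N (\<lambda>t. (\<integral>s. F (s, t) * g s \<partial>M) * h t)"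
    and "(\<integral>z. F z * pair_density g h z \<partial>rprod M N) = (\<integral>t. (\<integral>s. F (s, t) * g s \<partial>M) * h t \<partial>N)"
    using integral_rprod[OF M N m3 int j1] unfolding e1(1) by simp_all
  show "integrable M (\<lambda>s. (\<integral>t. F (s, t) * h t \<partial>N) * g s)"
    and "(\<integral>z. F z * pair_density g h z \<partial>rprod M N) = (\<integral>s. (\<integral>t. F (s, t) * h t \<partial>N) * g s \<partial>M)"
    using integral_rprod_swap[OF M N m3 int j2] unfolding e1(2) by simp_all
qed

end

text \<open>Functions in \<open>C00\<close> satisfy the weighted bound, so Fubini shows that the
  candidate has the defining property; \<open>regular_measures_eqI\<close> on the locally compact
  product space shows that nothing else has it.\<close>

lemma prod_meas_meas:
  assumes lc: "locally_compact_space (euclidean :: 'a topology)"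
    and g: "weighted_density M g" and h: "weighted_density N h"
  shows "prod_meas (meas M g) (meas N h) = meas (rprod M N) (pair_density g h)"
proof -
  let ?R = "rprod M N" and ?H = "pair_density g h"
  note wd = weighted_pair_density[OF g h]
  have lc2: "locally_compact_space (euclidean :: ('a \<times> 'a) topology)"
    unfolding prod_topology_euclidean[symmetric] locally_compact_space_prod_topology using lc by blast
  have reg: "meas ?R ?H \<in> regular_measures"
    using pair.weighted_densityD(1)[OF wd] pair.weighted_density_locally_integrable[OF wd] by (rule meas_regular)
  have C: "dr_integral cborel (meas ?R ?H) f =
      dr_integral cborel (meas N h) (\<lambda>t. dr_integral cborel (meas M g) (\<lambda>s. f (s, t)))" if f: "f \<in> C00" for f
  proof -
    have fc: "continuous_on UNIV f" using f by (simp add: C00_def)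
    then have fm: "f \<in> borel_measurable borel" by (rule borel_measurable_continuous_onI)
    define S where "S = closure {x. f x \<noteq> 0}"
    have S: "compact S" using f by (simp add: C00_def S_def)
    have fS: "f x = 0" if "x \<notin> S" for x using that closure_subset[of "{x. f x \<noteq> 0}"] by (auto simp: S_def)
    have Sc: "S \<in> cborel" using S by (rule compact_in_cborel)
    obtain c1 where c1: "0 < c1" "\<And>x. x \<in> S \<Longrightarrow> norm (f x) \<le> c1" using bounded_on_cborel[OF fc Sc] by blast
    obtain c2 where c2: "\<And>z. indicator S z \<le> c2 * (\<omega> (fst z) * \<omega> (snd z))" using pair.indicator_weight_bound[OF Sc] by blast
    \<comment> \<open>The constant multiplies a bound of \<open>f\<close> on its support
      \<open>S\<close> with a bound of the indicator of \<open>S\<close> by the product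
      weight.\<close>
    have b: "norm (f (s, t)) \<le> c1 * c2 * (\<omega> s * \<omega> t)" for s t
    proof -
      have "norm (f (s, t)) \<le> c1 * indicator S (s, t)" using c1 fS by (cases "(s, t) \<in> S") auto
      also have "\<dots> \<le> c1 * (c2 * (\<omega> s * \<omega> t))" using c1(1) c2[of "(s, t)"] by (intro mult_left_mono) auto
      finally show ?thesis by (simp add: mult_ac)
    qed
    note F = fubini_weighted[OF g h fm b]
    have K: "fst ` S \<in> cborel" "snd ` S \<in> cborel"
      using S by (auto intro!: compact_in_cborel compact_continuous_image continuous_on_fst continuous_on_snd continuous_on_id)
    have inner: "dr_integral cborel (meas M g) (\<lambda>s. f (s, t)) = (\<integral>s. f (s, t) * g s \<partial>M)" for t
    proof (rule dr_integral_meas(1)[OF g])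
      show "(\<lambda>s. f (s, t)) \<in> borel_measurable borel"
        using fm by (rule measurable_compose[rotated]) (simp add: borel_measurable_continuous_onI continuous_intros)
      show "carried_by cborel (\<lambda>_. fst ` S) (\<lambda>s. f (s, t))"
        using K(1) fS by (intro carried_by_const) force+
    qed (rule F(2))
    have "dr_integral cborel (meas N h) (\<lambda>t. dr_integral cborel (meas M g) (\<lambda>s. f (s, t))) =
        (\<integral>t. (\<integral>s. f (s, t) * g s \<partial>M) * h t \<partial>N)"
      unfolding inner
    proof (rule dr_integral_meas(1)[OF h F(3) _ F(4)])
      have "f (s, t) = 0" if "t \<notin> snd ` S" for s t using that fS by force
      then show "carried_by cborel (\<lambda>_. snd ` S) (\<lambda>t. \<integral>s. f (s, t) * g s \<partial>M)"
        using K(2) by (intro carried_by_const) auto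
    qed
    moreover have "dr_integral cborel (meas ?R ?H) f = (\<integral>z. f z * ?H z \<partial>?R)"
      using fm Sc fS F(1) by (intro pair.dr_integral_meas(1)[OF wd _ carried_by_const[of S]]) auto
    ultimately show ?thesis using F(5) by simp
  qed
  show ?thesis
    unfolding prod_meas_def
  proof (rule the_equality)
    show "meas ?R ?H \<in> regular_measures \<and> (\<forall>f\<in>C00. dr_integral cborel (meas ?R ?H) f =
        dr_integral cborel (meas N h) (\<lambda>t. dr_integral cborel (meas M g) (\<lambda>s. f (s, t))))"
      using reg C by blast
    fix \<sigma> assume "\<sigma> \<in> regular_measures \<and> (\<forall>f\<in>C00. dr_integral cborel \<sigma> f =
        dr_integral cborel (meas N h) (\<lambda>t. dr_integral cborel (meas M g) (\<lambda>s. f (s, t))))"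
    then show "\<sigma> = meas ?R ?H"
      using C by (intro regular_measures_eqI[OF lc2 _ reg]) auto
  qed
qed

end

section \<open>Convolution\<close>

locale group_weight = weight \<omega> for \<omega> :: "'a::{topological_group_add, t2_space} \<Rightarrow> real" +
  assumes lc: "locally_compact_space (euclidean :: 'a topology)"
    and submult: "\<omega> (s + t) \<le> \<omega> s * \<omega> t"
begin

interpretation pair: weight "\<lambda>z. \<omega> (fst z) * \<omega> (snd z)"
  by (rule weight_pair)

text \<open>Submultiplicativity turns a bound by the weight into one by the product weight, which
  brings functions of \<open>s + t\<close> under \<open>fubini_weighted\<close>. The constant may be
  multiplied through because the assumed bound forces it to be nonnegative.\<close>

lemma bound_group_op:
  assumes "\<And>x. norm (\<phi> x) \<le> c * \<omega> x"
  shows "norm (\<phi> (s + t)) \<le> c * (\<omega> s * \<omega> t)"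
proof -
  have "0 \<le> c * \<omega> s" using assms[of s] norm_ge_zero order_trans by blast
  then have "0 \<le> c" using pos[of s] by (simp add: zero_le_mult_iff)
  then have "c * \<omega> (s + t) \<le> c * (\<omega> s * \<omega> t)" using submult by (rule mult_left_mono[rotated])
  then show ?thesis using assms[of "s + t"] by simp
qed

lemma measurable_group_op: "group_op \<in> borel_measurable (borel :: ('a \<times> 'a) measure)"
  by (intro borel_measurable_continuous_onI continuous_group_op)

lemma measurable_comp_group_op:
  assumes "\<phi> \<in> borel_measurable borel"
  shows "(\<lambda>z::'a \<times> 'a. \<phi> (group_op z)) \<in> borel_measurable borel"
  using measurable_compose[OF measurable_group_op assms] .

lemma group_op_simp [simp]: "group_op (s, t) = s + t"
  by (simp add: group_op_def)

lemma vimage_group_op_borel: "A \<in> sets borel \<Longrightarrow> group_op -` A \<in> sets (borel :: ('a \<times> 'a) measure)"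
  using measurable_sets[OF measurable_group_op, of A] by simp

text \<open>Collects what the later proofs need to know about a density of the convolution. The
  integral identity is demanded for all Borel functions bounded by a multiple of the weight, a class
  that contains inner integrals as well as indicators and members of
  \<open>C0_weighted\<close>.\<close>

definition conv_density ::
    "'a measure \<Rightarrow> ('a \<Rightarrow> complex) \<Rightarrow> 'a measure \<Rightarrow> ('a \<Rightarrow> complex) \<Rightarrow> 'a measure \<Rightarrow> ('a \<Rightarrow> complex) \<Rightarrow> bool"
  where "conv_density M g N h Q k \<longleftrightarrow> weighted_density Q k \<and> conv (meas M g) (meas N h) = meas Q k \<and>
    (\<forall>\<phi> c. \<phi> \<in> borel_measurable borel \<longrightarrow> (\<forall>x. norm (\<phi> x) \<le> c * \<omega> x) \<longrightarrow>
      (\<integral>x. \<phi> x * k x \<partial>Q) = (\<integral>z. \<phi> (group_op z) * pair_density g h z \<partial>rprod M N)) \<and>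
    (\<integral>x. \<omega> x * norm (k x) \<partial>Q) \<le> (\<integral>x. \<omega> x * norm (g x) \<partial>M) * (\<integral>x. \<omega> x * norm (h x) \<partial>N)"

lemma conv_densityD:
  assumes "conv_density M g N h Q k"
  shows "weighted_density Q k" "conv (meas M g) (meas N h) = meas Q k"
    "\<phi> \<in> borel_measurable borel \<Longrightarrow> (\<And>x. norm (\<phi> x) \<le> c * \<omega> x) \<Longrightarrow>
      (\<integral>x. \<phi> x * k x \<partial>Q) = (\<integral>z. \<phi> (group_op z) * pair_density g h z \<partial>rprod M N)"
    "(\<integral>x. \<omega> x * norm (k x) \<partial>Q) \<le> (\<integral>x. \<omega> x * norm (g x) \<partial>M) * (\<integral>x. \<omega> x * norm (h x) \<partial>N)"
  using assms unfolding conv_density_def by blast+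

section \<open>Existence of the convolution and its density\<close>

context
  fixes M N :: "'a measure" and g h :: "'a \<Rightarrow> complex"
  assumes g: "weighted_density M g" and h: "weighted_density N h"
begin

lemma locally_integrable_pair_density: "locally_integrable (rprod M N) (pair_density g h)"
  by (rule pair.weighted_density_locally_integrable[OF weighted_pair_density[OF g h]])

lemma radon_rprod_densities: "radon (rprod M N)"
  by (rule radon_rprod[OF weighted_densityD(1)[OF g] weighted_densityD(1)[OF h]])

lemmas prod_meas_densities = prod_meas_meas[OF lc g h]

lemma fubini_group_op:
  assumes \<phi>: "\<phi> \<in> borel_measurable borel" and b: "\<And>x. norm (\<phi> x) \<le> c * \<omega> x"
  shows "integrable (rprod M N) (\<lambda>z. \<phi> (group_op z) * pair_density g h z)" (is ?F1)
    and "integrable M (\<lambda>s. \<phi> (s + t) * g s)" (is ?F2)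
    and "(\<lambda>t. \<integral>s. \<phi> (s + t) * g s \<partial>M) \<in> borel_measurable borel" (is ?F3)
    and "integrable N (\<lambda>t. (\<integral>s. \<phi> (s + t) * g s \<partial>M) * h t)" (is ?F4)
    and "(\<integral>z. \<phi> (group_op z) * pair_density g h z \<partial>rprod M N) = (\<integral>t. (\<integral>s. \<phi> (s + t) * g s \<partial>M) * h t \<partial>N)" (is ?F5)
    and "integrable N (\<lambda>t. \<phi> (s + t) * h t)" (is ?F6)
    and "(\<lambda>s. \<integral>t. \<phi> (s + t) * h t \<partial>N) \<in> borel_measurable borel" (is ?F7)
    and "integrable M (\<lambda>s. (\<integral>t. \<phi> (s + t) * h t \<partial>N) * g s)" (is ?F8)
    and "(\<integral>z. \<phi> (group_op z) * pair_density g h z \<partial>rprod M N) = (\<integral>s. (\<integral>t. \<phi> (s + t) * h t \<partial>N) * g s \<partial>M)" (is ?F9)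
proof -
  have "norm (\<phi> (group_op (s, t))) \<le> c * (\<omega> s * \<omega> t)" for s t
    using bound_group_op[OF b] by simp
  note F = fubini_weighted[OF g h measurable_comp_group_op[OF \<phi>] this, unfolded group_op_simp]
  show ?F1 and ?F2 and ?F3 and ?F4 and ?F5 and ?F6 and ?F7 and ?F8 and ?F9
    by (rule F)+
qed

text \<open>An open \<open>V\<close> of compact closure around the closure of \<open>A\<close> has
  an open preimage, and its indicator is bounded by a multiple of the weight; hence the pair density
  is integrable over that preimage. This is the existence of the convolution.\<close>

lemma vimage_group_op_ext_ring:
  assumes A: "A \<in> cborel"
  shows "group_op -` A \<in> ext_ring (meas (rprod M N) (pair_density g h))"
proof -
  have Ab: "A \<in> sets borel" and cA: "compact (closure A)" using A by (auto simp: cborel_def)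
  obtain V where V: "open V" "closure A \<subseteq> V" "compact (closure V)"
    using compact_open_separation[OF lc cA open_UNIV] by auto
  have Vc: "V \<in> cborel" using V by (simp add: cborel_def)
  obtain c where c: "\<And>x. indicator V x \<le> c * \<omega> x" using indicator_weight_bound[OF Vc] by blast
  have b: "norm (indicator V x :: complex) \<le> c * \<omega> x" for x using c[of x] by (cases "x \<in> V") auto
  have "(indicator V :: 'a \<Rightarrow> complex) \<in> borel_measurable borel" using V by simp
  from fubini_group_op(1)[OF this b]
  have "integrable (rprod M N) (\<lambda>z. indicator V (group_op z) * pair_density g h z)" .
  then have "(\<integral>\<^sup>+z. ennreal (norm (indicator V (group_op z) * pair_density g h z)) \<partial>rprod M N) < \<infinity>"
    by (simp add: integrable_iff_bounded)
  also have "(\<integral>\<^sup>+z. ennreal (norm (indicator V (group_op z) * pair_density g h z)) \<partial>rprod M N) =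
      (\<integral>\<^sup>+z\<in>group_op -` V. ennreal (norm (pair_density g h z)) \<partial>rprod M N)"
    by (intro nn_integral_cong) (auto simp: indicator_def)
  finally have "(\<integral>\<^sup>+z\<in>group_op -` V. ennreal (norm (pair_density g h z)) \<partial>rprod M N) < \<infinity>" .
  moreover have "open (group_op -` V :: ('a \<times> 'a) set)" using V(1) continuous_group_op by (rule open_vimage)
  moreover have "group_op -` A \<subseteq> (group_op -` V :: ('a \<times> 'a) set)" using V(2) closure_subset[of A] by auto
  ultimately show ?thesis
    unfolding ext_ring_meas[OF radon_rprod_densities locally_integrable_pair_density]
    using vimage_group_op_borel[OF Ab] by blast
qed

lemma conv_exists_meas: "conv_exists (meas M g) (meas N h)"
  unfolding conv_exists_def prod_meas_densities using vimage_group_op_ext_ring by blast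

lemma conv_meas:
  assumes A: "A \<in> cborel"
  shows "conv (meas M g) (meas N h) A = (LINT z:group_op -` A|rprod M N. pair_density g h z)"
    and "set_integrable (rprod M N) (group_op -` A) (pair_density g h)"
  using A unfolding conv_def prod_meas_densities
  by (simp_all add: ext_measure_meas[OF radon_rprod_densities locally_integrable_pair_density vimage_group_op_ext_ring]
      ext_ring_integrable[OF radon_rprod_densities locally_integrable_pair_density vimage_group_op_ext_ring])

text \<open>The form in which associativity is computed: the group operation stands in the argument
  of the indicator.\<close>

lemma conv_iterated:
  assumes A: "A \<in> cborel"
  shows "conv (meas M g) (meas N h) A = (\<integral>t. (\<integral>s. indicator A (s + t) * g s \<partial>M) * h t \<partial>N)"
proof -
  obtain c where c: "\<And>x. indicator A x \<le> c * \<omega> x" using indicator_weight_bound[OF A] by blast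
  have b: "norm (indicator A x :: complex) \<le> c * \<omega> x" for x using c[of x] by (cases "x \<in> A") auto
  have m: "(indicator A :: 'a \<Rightarrow> complex) \<in> borel_measurable borel"
      using A by (intro borel_measurable_indicator) (simp add: cborel_def)
  have "(LINT z:group_op -` A|rprod M N. pair_density g h z) = (\<integral>z. indicator A (group_op z) * pair_density g h z \<partial>rprod M N)"
    unfolding set_lebesgue_integral_def
    by (intro Bochner_Integration.integral_cong) (auto simp: indicator_def)
  then show ?thesis using fubini_group_op(5)[OF m b] conv_meas(1)[OF A] by simp
qed

text \<open>The pair density alone need not be integrable, so \<open>G\<close>, its product with the
  weight at \<open>s + t\<close>, is pushed forward along the group operation. Dividing the image
  density by the weight gives \<open>k\<close>.\<close>

lemma conv_density_exists: "\<exists>Q k. conv_density M g N h Q k"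
proof -
  let ?R = "rprod M N" and ?H = "pair_density g h"
  define G where "G z = of_real (\<omega> (group_op z)) * ?H z" for z
  define Q where "Q = distr ?R borel group_op"
  have w: "(\<lambda>x. complex_of_real (\<omega> x)) \<in> borel_measurable borel"
    using cont_complex by (rule borel_measurable_continuous_onI)
  have Gi: "integrable ?R G"
    unfolding G_def using pos by (intro fubini_group_op(1)[OF w, of 1]) (simp add: less_imp_le)
  have p: "group_op \<in> ?R \<rightarrow>\<^sub>M borel"
    using measurable_group_op unfolding measurable_cong_sets[OF sets_rprod refl] .
  obtain k0 where k0: "k0 \<in> borel_measurable borel"
    "\<And>\<phi>::'a \<Rightarrow> complex. \<phi> \<in> borel_measurable borel \<Longrightarrow> integrable ?R (\<lambda>z. \<phi> (group_op z) * G z) \<Longrightarrow>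
      integrable Q (\<lambda>y. \<phi> y * k0 y) \<and> (\<integral>y. \<phi> y * k0 y \<partial>Q) = (\<integral>z. \<phi> (group_op z) * G z \<partial>?R)"
    using pushforward_complex_density[OF radonD(2)[OF radon_rprod_densities] p Gi] unfolding Q_def by blast
  define k where "k x = k0 x / of_real (\<omega> x)" for x
  have wk: "of_real (\<omega> x) * k x = k0 x" for x using nonzero[of x] by (simp add: k_def)
  have km: "k \<in> borel_measurable borel" unfolding k_def using k0(1) w by measurable
  have k0i: "integrable Q k0" using k0(2)[of "\<lambda>_. 1"] Gi by simp
  have rQ: "radon Q" unfolding Q_def using radon_rprod_densities continuous_group_op by (rule radon_distr)
  have wd: "weighted_density Q k" using rQ km k0i by (simp add: weighted_density_def wk)
  have int: "(\<integral>x. \<phi> x * k x \<partial>Q) = (\<integral>z. \<phi> (group_op z) * ?H z \<partial>?R)"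
    if \<phi>: "\<phi> \<in> borel_measurable borel" and b: "\<And>x. norm (\<phi> x) \<le> c * \<omega> x" for \<phi> c
  proof -
    have 1: "\<phi> x * k x = \<phi> x / of_real (\<omega> x) * k0 x" for x by (simp add: k_def)
    have 2: "\<phi> (group_op z) / of_real (\<omega> (group_op z)) * G z = \<phi> (group_op z) * ?H z" for z
      using nonzero by (simp add: G_def)
    have m: "(\<lambda>x. \<phi> x / of_real (\<omega> x)) \<in> borel_measurable borel" using \<phi> w by measurable
    show ?thesis
      using k0(2)[OF m] fubini_group_op(1)[OF \<phi> b] unfolding 1 2 by simp
  qed
  have conv: "conv (meas M g) (meas N h) = meas Q k"
  proof
    fix A
    show "conv (meas M g) (meas N h) A = meas Q k A"
    proof (cases "A \<in> cborel")
      case A: True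
      obtain c where c: "\<And>x. indicator A x \<le> c * \<omega> x" using indicator_weight_bound[OF A] by blast
      have b: "norm (indicator A x :: complex) \<le> c * \<omega> x" for x using c[of x] by (cases "x \<in> A") auto
      have m: "(indicator A :: 'a \<Rightarrow> complex) \<in> borel_measurable borel"
      using A by (intro borel_measurable_indicator) (simp add: cborel_def)
      have "(LINT z:group_op -` A|?R. ?H z) = (\<integral>z. indicator A (group_op z) * ?H z \<partial>?R)"
        unfolding set_lebesgue_integral_def
        by (intro Bochner_Integration.integral_cong) (auto simp: indicator_def)
      also have "\<dots> = (\<integral>x. indicator A x * k x \<partial>Q)" by (rule int[OF m b, symmetric])
      also have "\<dots> = (LINT x:A|Q. k x)"
        unfolding set_lebesgue_integral_def
        by (intro Bochner_Integration.integral_cong) (auto simp: indicator_def)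
      finally show ?thesis using conv_meas(1)[OF A] A by (simp add: meas_def)
    next
      case False
      then show ?thesis by (simp add: conv_def meas_def)
    qed
  qed
  have "(\<integral>x. \<omega> x * norm (k x) \<partial>Q) = (\<integral>x. norm (k0 x) \<partial>Q)"
    using pos by (intro Bochner_Integration.integral_cong) (simp_all add: k_def norm_divide abs_of_pos nonzero)
  also have "\<dots> \<le> (\<integral>z. norm (G z) \<partial>?R)"
  proof -
    \<comment> \<open>Testing with the conjugate phase of \<open>k0\<close> carries its L1 norm back
      to the product space, where it is at most the L1 norm of \<open>G\<close>.\<close>
    define u where "u x = cnj (sgn (k0 x))" for x
    have u: "u \<in> borel_measurable borel"
      unfolding u_def by (rule measurable_cnj_sgn[OF k0(1)])
    have u1: "norm (u x) \<le> 1" for x by (simp add: u_def norm_sgn)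
    have ug: "(\<lambda>z. u (group_op z)) \<in> borel_measurable ?R" using measurable_compose[OF p u] .
    have b: "norm (u (group_op z) * G z) \<le> norm (G z)" for z
      using mult_right_mono[OF u1[of "group_op z"], of "norm (G z)"] by (simp add: norm_mult)
    have i: "integrable ?R (\<lambda>z. u (group_op z) * G z)"
      by (rule Bochner_Integration.integrable_bound[OF Gi]) (use ug Gi b in auto)
    have uk: "u x * k0 x = of_real (norm (k0 x))" for x by (simp add: u_def cnj_sgn_mult)
    have nn: "0 \<le> (\<integral>x. norm (k0 x) \<partial>Q)" by (intro Bochner_Integration.integral_nonneg) simp
    have "complex_of_real (\<integral>x. norm (k0 x) \<partial>Q) = (\<integral>z. u (group_op z) * G z \<partial>?R)"
      using k0(2)[OF u i] unfolding uk by simp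
    then have "(\<integral>x. norm (k0 x) \<partial>Q) = norm (\<integral>z. u (group_op z) * G z \<partial>?R)"
      using nn by (metis abs_of_nonneg norm_of_real)
    also have "\<dots> \<le> (\<integral>z. norm (u (group_op z) * G z) \<partial>?R)" by (rule integral_norm_bound)
    also have "\<dots> \<le> (\<integral>z. norm (G z) \<partial>?R)"
      using i Gi b by (intro integral_mono integrable_norm)
    finally show ?thesis .
  qed
  also have "\<dots> \<le> (\<integral>x. \<omega> x * norm (g x) \<partial>M) * (\<integral>x. \<omega> x * norm (h x) \<partial>N)"
  proof -
    have nn: "0 \<le> (\<integral>x. \<omega> x * norm (g x) \<partial>M) * (\<integral>x. \<omega> x * norm (h x) \<partial>N)"
      using pos by (intro mult_nonneg_nonneg Bochner_Integration.integral_nonneg) (simp_all add: less_imp_le)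
    have "norm (G z) \<le> \<omega> (fst z) * \<omega> (snd z) * norm (?H z)" for z
    proof -
      have "\<omega> (group_op z) \<le> \<omega> (fst z) * \<omega> (snd z)" using submult by (cases z) simp
      then show ?thesis using pos[of "group_op z"] by (auto simp: G_def norm_mult intro!: mult_right_mono)
    qed
    then have "(\<integral>\<^sup>+z. ennreal (norm (G z)) \<partial>?R) \<le> (\<integral>\<^sup>+z. ennreal (\<omega> (fst z) * \<omega> (snd z) * norm (?H z)) \<partial>?R)"
      by (intro nn_integral_mono ennreal_leI)
    then have "ennreal (\<integral>z. norm (G z) \<partial>?R) \<le> ennreal ((\<integral>x. \<omega> x * norm (g x) \<partial>M) * (\<integral>x. \<omega> x * norm (h x) \<partial>N))"
      unfolding nn_integral_pair_density[OF g h] using Gi by (simp add: nn_integral_eq_integral)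
    then show ?thesis using nn by (simp add: ennreal_le_iff)
  qed
  finally have "(\<integral>x. \<omega> x * norm (k x) \<partial>Q) \<le> (\<integral>x. \<omega> x * norm (g x) \<partial>M) * (\<integral>x. \<omega> x * norm (h x) \<partial>N)" .
  then show ?thesis unfolding conv_density_def using wd conv int by blast
qed

end

section \<open>Algebra laws\<close>

lemma conv_closed:
  assumes "\<mu> \<in> M_weighted \<omega>" "\<nu> \<in> M_weighted \<omega>"
  shows "conv_exists \<mu> \<nu>" "conv \<mu> \<nu> \<in> M_weighted \<omega>"
    "norm_weighted \<omega> (conv \<mu> \<nu>) \<le> norm_weighted \<omega> \<mu> * norm_weighted \<omega> \<nu>"
proof -
  obtain M g where g: "weighted_density M g" and \<mu>: "\<mu> = meas M g" using M_weighted_density[OF assms(1)] by blast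
  obtain N h where h: "weighted_density N h" and \<nu>: "\<nu> = meas N h" using M_weighted_density[OF assms(2)] by blast
  show "conv_exists \<mu> \<nu>" unfolding \<mu> \<nu> by (rule conv_exists_meas[OF g h])
  obtain Q k where "conv_density M g N h Q k" using conv_density_exists[OF g h] by blast
  note Q = conv_densityD[OF this]
  show "conv \<mu> \<nu> \<in> M_weighted \<omega>" unfolding \<mu> \<nu> Q(2) by (rule meas_in_M_weighted(1)[OF Q(1)])
  show "norm_weighted \<omega> (conv \<mu> \<nu>) \<le> norm_weighted \<omega> \<mu> * norm_weighted \<omega> \<nu>"
    unfolding \<mu> \<nu> Q(2) meas_in_M_weighted(2)[OF Q(1)] meas_in_M_weighted(2)[OF g] meas_in_M_weighted(2)[OF h]
    by (rule Q(4))
qed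

text \<open>Sums of measures need a common reference measure, so \<open>\<nu>\<close> is represented
  twice: over \<open>M\<close> together with \<open>\<mu>\<close>, and over \<open>N\<close>
  together with \<open>\<rho>\<close>. The pair density is linear in each factor.\<close>

lemma bilinear_conv: "bilinear_on (M_weighted \<omega>) conv"
  unfolding bilinear_on_def
proof (intro ballI allI)
  fix \<mu> \<nu> \<rho> c assume V: "\<mu> \<in> M_weighted \<omega>" "\<nu> \<in> M_weighted \<omega>" "\<rho> \<in> M_weighted \<omega>"
  obtain M f g where f: "weighted_density M f" and g: "weighted_density M g" and fg: "\<mu> = meas M f" "\<nu> = meas M g"
    using common_weighted_density2[OF V(1,2)] .
  obtain N k h where k: "weighted_density N k" and h: "weighted_density N h" and kh: "\<nu> = meas N k" "\<rho> = meas N h"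
    using common_weighted_density2[OF V(2,3)] .
  have "conv (\<lambda>A. \<mu> A + \<nu> A) \<rho> = (\<lambda>A. conv \<mu> \<rho> A + conv \<nu> \<rho> A)"
  proof
    fix A
    have e: "pair_density (\<lambda>x. f x + g x) h z = pair_density f h z + pair_density g h z" for z
      by (simp add: pair_density_def distrib_right)
    have "conv (meas M (\<lambda>x. f x + g x)) (meas N h) A = conv (meas M f) (meas N h) A + conv (meas M g) (meas N h) A"
    proof (cases "A \<in> cborel")
      case A: True
      show ?thesis
        unfolding conv_meas(1)[OF weighted_density_add[OF f g] h A] conv_meas(1)[OF f h A] conv_meas(1)[OF g h A] e
        by (rule set_integral_add(2)[OF conv_meas(2)[OF f h A] conv_meas(2)[OF g h A]])
    qed (simp add: conv_def)
    then show "conv (\<lambda>A. \<mu> A + \<nu> A) \<rho> A = conv \<mu> \<rho> A + conv \<nu> \<rho> A"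
      unfolding meas_add[OF f g] fg[symmetric] kh(2)[symmetric] .
  qed
  moreover have "conv \<mu> (\<lambda>A. \<nu> A + \<rho> A) = (\<lambda>A. conv \<mu> \<nu> A + conv \<mu> \<rho> A)"
  proof
    fix A
    have e: "pair_density f (\<lambda>x. k x + h x) z = pair_density f k z + pair_density f h z" for z
      by (simp add: pair_density_def distrib_left)
    have "conv (meas M f) (meas N (\<lambda>x. k x + h x)) A = conv (meas M f) (meas N k) A + conv (meas M f) (meas N h) A"
    proof (cases "A \<in> cborel")
      case A: True
      show ?thesis
        unfolding conv_meas(1)[OF f weighted_density_add[OF k h] A] conv_meas(1)[OF f k A] conv_meas(1)[OF f h A] e
        by (rule set_integral_add(2)[OF conv_meas(2)[OF f k A] conv_meas(2)[OF f h A]])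
    qed (simp add: conv_def)
    then show "conv \<mu> (\<lambda>A. \<nu> A + \<rho> A) A = conv \<mu> \<nu> A + conv \<mu> \<rho> A"
      unfolding meas_add[OF k h] fg(1)[symmetric] kh[symmetric] .
  qed
  moreover have "conv (\<lambda>A. c * \<mu> A) \<nu> = (\<lambda>A. c * conv \<mu> \<nu> A)"
  proof
    fix A
    have e: "pair_density (\<lambda>x. c * f x) k z = c * pair_density f k z" for z by (simp add: pair_density_def)
    have "conv (meas M (\<lambda>x. c * f x)) (meas N k) A = c * conv (meas M f) (meas N k) A"
    proof (cases "A \<in> cborel")
      case A: True
      show ?thesis
        unfolding conv_meas(1)[OF weighted_density_cmult[OF f] k A] conv_meas(1)[OF f k A] e by simp
    qed (simp add: conv_def)
    then show "conv (\<lambda>A. c * \<mu> A) \<nu> A = c * conv \<mu> \<nu> A"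
      unfolding meas_cmult fg(1)[symmetric] kh(1)[symmetric] .
  qed
  moreover have "conv \<mu> (\<lambda>A. c * \<nu> A) = (\<lambda>A. c * conv \<mu> \<nu> A)"
  proof
    fix A
    have e: "pair_density f (\<lambda>x. c * k x) z = c * pair_density f k z" for z by (simp add: pair_density_def)
    have "conv (meas M f) (meas N (\<lambda>x. c * k x)) A = c * conv (meas M f) (meas N k) A"
    proof (cases "A \<in> cborel")
      case A: True
      show ?thesis
        unfolding conv_meas(1)[OF f weighted_density_cmult[OF k] A] conv_meas(1)[OF f k A] e by simp
    qed (simp add: conv_def)
    then show "conv \<mu> (\<lambda>A. c * \<nu> A) A = c * conv \<mu> \<nu> A"
      unfolding meas_cmult fg(1)[symmetric] kh(1)[symmetric] .
  qed
  ultimately show "conv (\<lambda>x. \<mu> x + \<nu> x) \<rho> = (\<lambda>x. conv \<mu> \<rho> x + conv \<nu> \<rho> x) \<and>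
     conv \<mu> (\<lambda>x. \<nu> x + \<rho> x) = (\<lambda>x. conv \<mu> \<nu> x + conv \<mu> \<rho> x) \<and>
     conv (\<lambda>x. c * \<mu> x) \<nu> = (\<lambda>x. c * conv \<mu> \<nu> x) \<and>
     conv \<mu> (\<lambda>x. c * \<nu> x) = (\<lambda>x. c * conv \<mu> \<nu> x)" by blast
qed

lemma conv_assoc:
  assumes V: "\<mu> \<in> M_weighted \<omega>" "\<nu> \<in> M_weighted \<omega>" "\<rho> \<in> M_weighted \<omega>"
  shows "conv (conv \<mu> \<nu>) \<rho> = conv \<mu> (conv \<nu> \<rho>)"
proof
  fix A
  obtain M f where f: "weighted_density M f" and \<mu>: "\<mu> = meas M f" using M_weighted_density[OF V(1)] by blast
  obtain N g where g: "weighted_density N g" and \<nu>: "\<nu> = meas N g" using M_weighted_density[OF V(2)] by blast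
  obtain P h where h: "weighted_density P h" and \<rho>: "\<rho> = meas P h" using M_weighted_density[OF V(3)] by blast
  obtain Q k where d: "conv_density M f N g Q k" using conv_density_exists[OF f g] by blast
  note k = conv_densityD(1)[OF d] and mn = conv_densityD(2)[OF d] and Qk = conv_densityD(3)[OF d]
  obtain Q' k' where d': "conv_density N g P h Q' k'" using conv_density_exists[OF g h] by blast
  note k' = conv_densityD(1)[OF d'] and nr = conv_densityD(2)[OF d'] and Qk' = conv_densityD(3)[OF d']
  show "conv (conv \<mu> \<nu>) \<rho> A = conv \<mu> (conv \<nu> \<rho>) A"
  proof (cases "A \<in> cborel")
    case A: True
    obtain c where c: "\<And>x. indicator A x \<le> c * \<omega> x" using indicator_weight_bound[OF A] by blast
    have b: "norm (indicator A x :: complex) \<le> c * \<omega> x" for x using c[of x] by (cases "x \<in> A") auto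
    have m: "(indicator A :: 'a \<Rightarrow> complex) \<in> borel_measurable borel"
      using A by (intro borel_measurable_indicator) (simp add: cborel_def)
    \<comment> \<open>For fixed \<open>r\<close> the translated indicator is bounded by
      \<open>c * \<omega> r\<close> times the weight, so the integral identity of the inner
      convolution applies to it.\<close>
    have inner: "(\<integral>u. indicator A (u + r) * k u \<partial>Q) = (\<integral>t. (\<integral>s. indicator A (s + t + r) * f s \<partial>M) * g t \<partial>N)" for r
    proof -
      have m': "(\<lambda>u. indicator A (u + r) :: complex) \<in> borel_measurable borel"
        using measurable_compose[of "\<lambda>u. u + r" borel borel "indicator A :: 'a \<Rightarrow> complex" borel] m
        by (simp add: borel_measurable_continuous_onI continuous_intros)
      have b': "norm (indicator A (u + r) :: complex) \<le> (c * \<omega> r) * \<omega> u" for u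
        using bound_group_op[OF b, of u r] by (simp add: mult_ac)
      show ?thesis using Qk[OF m' b'] fubini_group_op(5)[OF f g m' b'] by simp
    qed
    have "conv (conv \<mu> \<nu>) \<rho> A = (\<integral>r. (\<integral>u. indicator A (u + r) * k u \<partial>Q) * h r \<partial>P)"
      unfolding \<mu> \<nu> \<rho> mn by (rule conv_iterated[OF k h A])
    also have "\<dots> = (\<integral>r. (\<integral>t. (\<integral>s. indicator A (s + t + r) * f s \<partial>M) * g t \<partial>N) * h r \<partial>P)"
      unfolding inner ..
    finally have 1: "conv (conv \<mu> \<nu>) \<rho> A = (\<integral>r. (\<integral>t. (\<integral>s. indicator A (s + t + r) * f s \<partial>M) * g t \<partial>N) * h r \<partial>P)" .
    \<comment> \<open>An inner integral, for which Borel measurability and a bound by a multiple of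
      the weight are all that is established; this suffices for the integral identity of the
      convolution of \<open>\<nu>\<close> and \<open>\<rho>\<close>.\<close>
    define \<phi> where "\<phi> u = (\<integral>s. indicator A (s + u) * f s \<partial>M)" for u
    have m\<phi>: "\<phi> \<in> borel_measurable borel"
      unfolding \<phi>_def by (rule fubini_group_op(3)[OF f f m b])
    have b\<phi>: "norm (\<phi> u) \<le> (c * (\<integral>s. \<omega> s * norm (f s) \<partial>M)) * \<omega> u" for u
    proof -
      have i: "integrable M (\<lambda>s. indicator A (s + u) * f s)" by (rule fubini_group_op(2)[OF f f m b])
      have "norm (\<phi> u) \<le> (\<integral>s. norm (indicator A (s + u) * f s) \<partial>M)"
        unfolding \<phi>_def by (rule integral_norm_bound)
      also have "\<dots> \<le> (\<integral>s. (c * \<omega> u) * (\<omega> s * norm (f s)) \<partial>M)"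
      proof (rule integral_mono)
        show "integrable M (\<lambda>s. norm (indicator A (s + u) * f s))" using i by (rule integrable_norm)
        show "integrable M (\<lambda>s. (c * \<omega> u) * (\<omega> s * norm (f s)))"
          by (intro integrable_mult_right weighted_norm_integrable[OF f])
        fix s
        have "norm (indicator A (s + u) :: complex) * norm (f s) \<le> (c * (\<omega> s * \<omega> u)) * norm (f s)"
          using bound_group_op[OF b] by (intro mult_right_mono) auto
        then show "norm (indicator A (s + u) * f s) \<le> (c * \<omega> u) * (\<omega> s * norm (f s))"
          by (simp add: norm_mult mult_ac)
      qed
      finally show ?thesis unfolding integral_mult_right_zero by (simp add: mult_ac)
    qed
    have "conv \<mu> (conv \<nu> \<rho>) A = (\<integral>u. \<phi> u * k' u \<partial>Q')"
      unfolding \<mu> \<nu> \<rho> nr \<phi>_def by (rule conv_iterated[OF f k' A])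
    also have "\<dots> = (\<integral>r. (\<integral>t. \<phi> (t + r) * g t \<partial>N) * h r \<partial>P)"
      using Qk'[OF m\<phi> b\<phi>] fubini_group_op(5)[OF g h m\<phi> b\<phi>] by simp
    finally show ?thesis unfolding 1 \<phi>_def by (simp add: add.assoc)
  next
    case False
    then show ?thesis by (simp add: conv_def)
  qed
qed

section \<open>Pairing with weighted functions vanishing at infinity\<close>

text \<open>The sets where the quotient by the weight has modulus at least 1 / (n + 1) are compact
  and exhaust the points where \<open>\<psi>\<close> is nonzero. They form the carrying sequence
  that \<open>L1\<close> asks for.\<close>

lemma C0_weightedD:
  assumes \<psi>: "\<psi> \<in> C0_weighted \<omega>"
  obtains c K where "\<psi> \<in> borel_measurable borel" "\<And>x. norm (\<psi> x) \<le> c * \<omega> x"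
    "incseq K" "\<And>n::nat. compact (K n)" "\<And>x. x \<notin> (\<Union>n. K n) \<Longrightarrow> \<psi> x = 0"
proof -
  define f where "f x = \<psi> x / of_real (\<omega> x)" for x
  have f: "continuous_on UNIV f" and comp: "\<And>e. 0 < e \<Longrightarrow> compact {x. e \<le> norm (f x)}"
    using \<psi> by (auto simp: C0_weighted_def C0_def f_def[abs_def])
  have \<psi>f: "\<psi> x = f x * of_real (\<omega> x)" for x using nonzero[of x] by (simp add: f_def)
  have "continuous_on UNIV \<psi>" unfolding \<psi>f[abs_def] using f cont_complex by (rule continuous_on_mult)
  then have 1: "\<psi> \<in> borel_measurable borel" by (rule borel_measurable_continuous_onI)
  obtain c where c: "0 < c" "\<And>x. x \<in> {x. 1 \<le> norm (f x)} \<Longrightarrow> norm (f x) \<le> c"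
    using bounded_on_cborel[OF f compact_in_cborel[OF comp[of 1]]] by auto
  \<comment> \<open>\<open>c\<close> bounds the modulus on the compact set where it is at least 1,
    and elsewhere it is below 1.\<close>
  have "norm (f x) \<le> max c 1" for x using c(2)[of x] by (cases "1 \<le> norm (f x)") auto
  then have "norm (f x) * \<omega> x \<le> max c 1 * \<omega> x" for x using pos[of x] by (intro mult_right_mono) auto
  then have 2: "norm (\<psi> x) \<le> max c 1 * \<omega> x" for x using pos[of x] by (simp add: \<psi>f norm_mult abs_of_pos)
  define K where "K n = {x. 1 / real (Suc n) \<le> norm (f x)}" for n
  have "incseq K"
  proof (rule incseq_SucI)
    fix n
    have "1 / real (Suc (Suc n)) \<le> 1 / real (Suc n)" by (simp add: field_simps)
    then show "K n \<le> K (Suc n)" unfolding K_def by (auto simp del: of_nat_Suc)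
  qed
  moreover have "compact (K n)" for n unfolding K_def by (rule comp) simp
  moreover have "\<psi> x = 0" if "x \<notin> (\<Union>n. K n)" for x
  proof (rule ccontr)
    assume "\<psi> x \<noteq> 0"
    then have "0 < norm (f x)" using \<psi>f[of x] by auto
    then obtain n where "1 / real (Suc n) < norm (f x)" using nat_approx_posE by blast
    then have "x \<in> K n" by (simp add: K_def)
    then show False using that by blast
  qed
  ultimately show thesis using that 1 2 by blast
qed

text \<open>Builds carrying sequences for inner integrals: \<open>op\<close> recovers the free
  variable from a point of a set carrying the measure and a point of a set carrying
  \<open>\<psi>\<close>.\<close>

lemma compact_image_pair:
  fixes op :: "'a \<times> 'a \<Rightarrow> 'a"
  assumes "continuous_on UNIV op" "\<And>n::nat. compact (C n)" "\<And>n. compact (K n)" "incseq C" "incseq K"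
  shows "incseq (\<lambda>n. op ` (C n \<times> K n))" "range (\<lambda>n. op ` (C n \<times> K n)) \<subseteq> cborel"
proof -
  show "incseq (\<lambda>n. op ` (C n \<times> K n))"
    using assms(4,5) unfolding incseq_def by (intro allI impI image_mono Sigma_mono) auto
  show "range (\<lambda>n. op ` (C n \<times> K n)) \<subseteq> cborel"
    using assms(1-3)
    by (auto intro!: compact_in_cborel compact_continuous_image compact_Times intro: continuous_on_subset)
qed

lemma carrier_point:
  assumes "x \<in> (\<Union>n. C n)" "y \<in> (\<Union>n. K n)" "incseq C" "incseq (K :: nat \<Rightarrow> 'a set)"
  shows "op (x, y) \<in> (\<Union>n. op ` (C n \<times> K n))"
proof -
  obtain i j where "x \<in> C i" "y \<in> K j" using assms by auto
  moreover have "C i \<subseteq> C (max i j)" "K j \<subseteq> K (max i j)" using assms(3,4) by (auto simp: incseq_def)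
  ultimately show ?thesis by blast
qed

lemma integral_zero_off_carrier:
  fixes M :: "'a measure"
  assumes M: "radon M" and C: "emeasure M (UNIV - (\<Union>n::nat. C n)) = 0" "\<And>n. compact (C n)"
    and z: "\<And>s. s \<in> (\<Union>n. C n) \<Longrightarrow> F s = 0"
  shows "(\<integral>s. F s \<partial>M) = (0 :: complex)"
proof (rule integral_eq_zero_AE, rule AE_I')
  have "UNIV - (\<Union>n. C n) \<in> sets borel"
    using C(2) by (intro sets.Diff sets.countable_UN) (auto simp: compact_imp_borel)
  then show "UNIV - (\<Union>n. C n) \<in> null_sets M" using C(1) radonD(1)[OF M] by (auto intro!: null_setsI)
  show "{s \<in> space M. F s \<noteq> 0} \<subseteq> UNIV - (\<Union>n. C n)" using z by auto
qed

text \<open>The pairing, the integral over the extension and both iterated integrals all reduce to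
  one integral over \<open>rprod M N\<close>. Besides integrability, each membership in
  \<open>L1\<close> requires a carrying sequence, and these are constructed one by one.\<close>

lemma pairing_conv:
  assumes V: "\<mu> \<in> M_weighted \<omega>" "\<nu> \<in> M_weighted \<omega>" and \<psi>: "\<psi> \<in> C0_weighted \<omega>"
  shows "\<psi> \<in> L1 cborel (conv \<mu> \<nu>)"
    and "(\<lambda>(s, t). \<psi> (s + t)) \<in> L1 (ext_ring (prod_meas \<mu> \<nu>)) (ext_measure (prod_meas \<mu> \<nu>))"
    and "(\<lambda>s. \<psi> (s + t)) \<in> L1 cborel \<mu>"
    and "(\<lambda>t. dr_integral cborel \<mu> (\<lambda>s. \<psi> (s + t))) \<in> L1 cborel \<nu>"
    and "(\<lambda>t. \<psi> (s + t)) \<in> L1 cborel \<nu>"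
    and "(\<lambda>s. dr_integral cborel \<nu> (\<lambda>t. \<psi> (s + t))) \<in> L1 cborel \<mu>"
    and "pairing (conv \<mu> \<nu>) \<psi>
      = dr_integral (ext_ring (prod_meas \<mu> \<nu>)) (ext_measure (prod_meas \<mu> \<nu>)) (\<lambda>(s, t). \<psi> (s + t))"
    and "pairing (conv \<mu> \<nu>) \<psi> = dr_integral cborel \<nu> (\<lambda>t. dr_integral cborel \<mu> (\<lambda>s. \<psi> (s + t)))"
    and "pairing (conv \<mu> \<nu>) \<psi> = dr_integral cborel \<mu> (\<lambda>s. dr_integral cborel \<nu> (\<lambda>t. \<psi> (s + t)))"
proof -
  obtain M g where g: "weighted_density M g" and \<mu>: "\<mu> = meas M g" using M_weighted_density[OF V(1)] by blast
  obtain N h where h: "weighted_density N h" and \<nu>: "\<nu> = meas N h" using M_weighted_density[OF V(2)] by blast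
  note rM = weighted_densityD(1)[OF g] and rN = weighted_densityD(1)[OF h]
  obtain Q k where d: "conv_density M g N h Q k" using conv_density_exists[OF g h] by blast
  note k = conv_densityD(1)[OF d] and mn = conv_densityD(2)[OF d] and Qk = conv_densityD(3)[OF d]
  obtain c K where \<psi>m: "\<psi> \<in> borel_measurable borel" and b: "\<And>x. norm (\<psi> x) \<le> c * \<omega> x"
    and K: "incseq K" "\<And>n::nat. compact (K n)" and z: "\<And>x. x \<notin> (\<Union>n. K n) \<Longrightarrow> \<psi> x = 0"
    by (rule C0_weightedD[OF \<psi>]) blast
  note F = fubini_group_op[OF g h \<psi>m b]
  have cK: "carried_by cborel K \<psi>"
    using K z by (auto simp: carried_by_def compact_in_cborel)
  have P: "pairing (conv \<mu> \<nu>) \<psi> = (\<integral>z. \<psi> (group_op z) * pair_density g h z \<partial>rprod M N)"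
    unfolding pairing_def \<mu> \<nu> mn
    using dr_integral_meas(1)[OF k \<psi>m cK integrable_weight_bound[OF k \<psi>m b]] Qk[OF \<psi>m b] by simp
  show "\<psi> \<in> L1 cborel (conv \<mu> \<nu>)"
    unfolding \<mu> \<nu> mn by (rule dr_integral_meas(2)[OF k \<psi>m cK integrable_weight_bound[OF k \<psi>m b]])
  let ?S = "meas (rprod M N) (pair_density g h)"
  note rad = radon_rprod_densities[OF g h] and li = locally_integrable_pair_density[OF g h]
  have op: "(\<lambda>(s, t). \<psi> (s + t)) = (\<lambda>z. \<psi> (group_op z))" by (auto simp: group_op_def)
  have cE: "carried_by (ext_ring ?S) (\<lambda>n. group_op -` K n) (\<lambda>z. \<psi> (group_op z))"
    unfolding carried_by_def
  proof (intro conjI allI impI)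
    show "incseq (\<lambda>n. group_op -` K n :: ('a \<times> 'a) set)"
      using K(1) by (auto simp: incseq_def)
    show "range (\<lambda>n. group_op -` K n) \<subseteq> ext_ring ?S"
      using vimage_group_op_ext_ring[OF g h] K(2) compact_in_cborel by blast
  qed (use z in auto)
  note E = L1_density[OF borel_ring_ext_ring[OF rad li] density_on_ext_measure[OF rad li] measurable_comp_group_op[OF \<psi>m] cE F(1)]
    dr_integral_density[OF borel_ring_ext_ring[OF rad li] density_on_ext_measure[OF rad li] measurable_comp_group_op[OF \<psi>m] cE F(1)]
  show "(\<lambda>(s, t). \<psi> (s + t)) \<in> L1 (ext_ring (prod_meas \<mu> \<nu>)) (ext_measure (prod_meas \<mu> \<nu>))"
    unfolding \<mu> \<nu> prod_meas_densities[OF g h] op by (rule E(1))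
  show "pairing (conv \<mu> \<nu>) \<psi> = dr_integral (ext_ring (prod_meas \<mu> \<nu>)) (ext_measure (prod_meas \<mu> \<nu>)) (\<lambda>(s, t). \<psi> (s + t))"
    unfolding P unfolding \<mu> \<nu> prod_meas_densities[OF g h] op by (rule E(2)[symmetric])
  have c_add: "continuous_on UNIV (\<lambda>s. s + t)" "continuous_on UNIV (\<lambda>s. t + s)" for t :: 'a
    by (intro continuous_intros)+
  have tr: "(\<lambda>s. \<psi> (s + t)) \<in> borel_measurable borel" "(\<lambda>s. \<psi> (t + s)) \<in> borel_measurable borel" for t
    using measurable_compose[OF borel_measurable_continuous_onI[OF c_add(1)] \<psi>m]
      measurable_compose[OF borel_measurable_continuous_onI[OF c_add(2)] \<psi>m] by simp_all
  have c1: "carried_by cborel (\<lambda>n. (\<lambda>x. x + - t) ` K n) (\<lambda>s. \<psi> (s + t))" for t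
    unfolding carried_by_def
  proof (intro conjI allI impI)
    show "incseq (\<lambda>n. (\<lambda>x. x + - t) ` K n)" using K(1) unfolding incseq_def by (intro allI impI image_mono) auto
    show "range (\<lambda>n. (\<lambda>x. x + - t) ` K n) \<subseteq> cborel"
      using K(2) by (auto intro!: compact_in_cborel compact_continuous_image continuous_intros)
    fix s assume s: "s \<notin> (\<Union>n. (\<lambda>x. x + - t) ` K n)"
    have "s + t \<notin> (\<Union>n. K n)"
    proof
      assume "s + t \<in> (\<Union>n. K n)"
      then have "(\<lambda>x. x + - t) (s + t) \<in> (\<Union>n. (\<lambda>x. x + - t) ` K n)" by blast
      then show False using s by (simp add: add.assoc)
    qed
    then show "\<psi> (s + t) = 0" by (rule z)
  qed
  have c2: "carried_by cborel (\<lambda>n. (\<lambda>x. - s + x) ` K n) (\<lambda>t. \<psi> (s + t))" for s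
    unfolding carried_by_def
  proof (intro conjI allI impI)
    show "incseq (\<lambda>n. (\<lambda>x. - s + x) ` K n)" using K(1) unfolding incseq_def by (intro allI impI image_mono) auto
    show "range (\<lambda>n. (\<lambda>x. - s + x) ` K n) \<subseteq> cborel"
      using K(2) by (auto intro!: compact_in_cborel compact_continuous_image continuous_intros)
    fix t assume t: "t \<notin> (\<Union>n. (\<lambda>x. - s + x) ` K n)"
    have "s + t \<notin> (\<Union>n. K n)"
    proof
      assume "s + t \<in> (\<Union>n. K n)"
      then have "(\<lambda>x. - s + x) (s + t) \<in> (\<Union>n. (\<lambda>x. - s + x) ` K n)" by blast
      then show False using t by (simp add: add.assoc[symmetric])
    qed
    then show "\<psi> (s + t) = 0" by (rule z)
  qed
  show "(\<lambda>s. \<psi> (s + t)) \<in> L1 cborel \<mu>" for t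
    unfolding \<mu> by (rule dr_integral_meas(2)[OF g tr(1) c1 F(2)])
  show "(\<lambda>t. \<psi> (s + t)) \<in> L1 cborel \<nu>" for s
    unfolding \<nu> by (rule dr_integral_meas(2)[OF h tr(2) c2 F(6)])
  have i1: "(\<lambda>t. dr_integral cborel \<mu> (\<lambda>s. \<psi> (s + t))) = (\<lambda>t. \<integral>s. \<psi> (s + t) * g s \<partial>M)"
    unfolding \<mu> by (rule ext) (rule dr_integral_meas(1)[OF g tr(1) c1 F(2)])
  have i2: "(\<lambda>s. dr_integral cborel \<nu> (\<lambda>t. \<psi> (s + t))) = (\<lambda>s. \<integral>t. \<psi> (s + t) * h t \<partial>N)"
    unfolding \<nu> by (rule ext) (rule dr_integral_meas(1)[OF h tr(2) c2 F(6)])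
  \<comment> \<open>The measures are concentrated on the sigma-compact unions of \<open>C\<close>
    and \<open>D\<close>. An inner integral can be nonzero only if some point of such a union is
    moved into the sigma-compact carrier of \<open>\<psi>\<close>, which confines the outer variable
    to a sigma-compact set too.\<close>
  obtain C where C: "incseq C" "\<And>n. compact (C n)" "emeasure M (UNIV - (\<Union>n. C n)) = 0"
    using radon_compacts[OF rM borel_open[OF open_UNIV]] by metis
  obtain D where D: "incseq D" "\<And>n. compact (D n)" "emeasure N (UNIV - (\<Union>n. D n)) = 0"
    using radon_compacts[OF rN borel_open[OF open_UNIV]] by metis
  \<comment> \<open>These solve for the outer variable: \<open>t = - s + (s + t)\<close> and
    \<open>s = (s + t) - t\<close>. The side on which the inverse stands matters, as the group need
    not be commutative.\<close>
  let ?l = "\<lambda>z::'a \<times> 'a. - fst z + snd z" and ?r = "\<lambda>z::'a \<times> 'a. snd z - fst z"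
  have cl: "continuous_on UNIV ?l" and cr: "continuous_on UNIV ?r" by (intro continuous_intros)+
  have c3: "carried_by cborel (\<lambda>n. ?l ` (C n \<times> K n)) (\<lambda>t. \<integral>s. \<psi> (s + t) * g s \<partial>M)"
    unfolding carried_by_def
  proof (intro conjI allI impI compact_image_pair[OF cl C(2) K(2) C(1) K(1)])
    fix t assume t: "t \<notin> (\<Union>n. ?l ` (C n \<times> K n))"
    show "(\<integral>s. \<psi> (s + t) * g s \<partial>M) = 0"
    proof (rule integral_zero_off_carrier[OF rM C(3,2)])
      fix s assume s: "s \<in> (\<Union>n. C n)"
      have "s + t \<notin> (\<Union>n. K n)"
      proof
        assume "s + t \<in> (\<Union>n. K n)"
        from carrier_point[OF s this C(1) K(1), of ?l] show False using t by (simp add: add.assoc[symmetric])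
      qed
      then show "\<psi> (s + t) * g s = 0" using z by simp
    qed
  qed
  have c4: "carried_by cborel (\<lambda>n. ?r ` (D n \<times> K n)) (\<lambda>s. \<integral>t. \<psi> (s + t) * h t \<partial>N)"
    unfolding carried_by_def
  proof (intro conjI allI impI compact_image_pair[OF cr D(2) K(2) D(1) K(1)])
    fix s assume s: "s \<notin> (\<Union>n. ?r ` (D n \<times> K n))"
    show "(\<integral>t. \<psi> (s + t) * h t \<partial>N) = 0"
    proof (rule integral_zero_off_carrier[OF rN D(3,2)])
      fix t assume t: "t \<in> (\<Union>n. D n)"
      have "s + t \<notin> (\<Union>n. K n)"
      proof
        assume "s + t \<in> (\<Union>n. K n)"
        from carrier_point[OF t this D(1) K(1), of ?r] show False using s by simp
      qed
      then show "\<psi> (s + t) * h t = 0" using z by simp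
    qed
  qed
  show "(\<lambda>t. dr_integral cborel \<mu> (\<lambda>s. \<psi> (s + t))) \<in> L1 cborel \<nu>"
    unfolding i1 unfolding \<nu> by (rule dr_integral_meas(2)[OF h F(3) c3 F(4)])
  show "(\<lambda>s. dr_integral cborel \<nu> (\<lambda>t. \<psi> (s + t))) \<in> L1 cborel \<mu>"
    unfolding i2 unfolding \<mu> by (rule dr_integral_meas(2)[OF g F(7) c4 F(8)])
  show "pairing (conv \<mu> \<nu>) \<psi> = dr_integral cborel \<nu> (\<lambda>t. dr_integral cborel \<mu> (\<lambda>s. \<psi> (s + t)))"
    unfolding P i1 unfolding \<nu> using dr_integral_meas(1)[OF h F(3) c3 F(4)] F(5) by simp
  show "pairing (conv \<mu> \<nu>) \<psi> = dr_integral cborel \<mu> (\<lambda>s. dr_integral cborel \<nu> (\<lambda>t. \<psi> (s + t)))"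
    unfolding P i2 unfolding \<mu> using dr_integral_meas(1)[OF g F(7) c4 F(8)] F(9) by simp
qed

end

theorem theorem1p5:
  fixes \<omega> :: "'a::{topological_group_add, t2_space} \<Rightarrow> real"
  assumes "locally_compact_space (euclidean :: 'a topology)"
    and "continuous_weight \<omega>"
  shows "banach_space_on (M_weighted \<omega>) (norm_weighted \<omega>)
    \<and> (\<forall>\<mu>\<in>M_weighted \<omega>. \<forall>\<nu>\<in>M_weighted \<omega>. conv_exists \<mu> \<nu> \<and> conv \<mu> \<nu> \<in> M_weighted \<omega>)
    \<and> bilinear_on (M_weighted \<omega>) conv
    \<and> (\<forall>\<mu>\<in>M_weighted \<omega>. \<forall>\<nu>\<in>M_weighted \<omega>. \<forall>\<rho>\<in>M_weighted \<omega>.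
         conv (conv \<mu> \<nu>) \<rho> = conv \<mu> (conv \<nu> \<rho>))
    \<and> (\<forall>\<mu>\<in>M_weighted \<omega>. \<forall>\<nu>\<in>M_weighted \<omega>.
         norm_weighted \<omega> (conv \<mu> \<nu>) \<le> norm_weighted \<omega> \<mu> * norm_weighted \<omega> \<nu>)
    \<and> (\<forall>\<mu>\<in>M_weighted \<omega>. \<forall>\<nu>\<in>M_weighted \<omega>. \<forall>\<psi>\<in>C0_weighted \<omega>.
         \<psi> \<in> L1 cborel (conv \<mu> \<nu>)
       \<and> (\<lambda>(s, t). \<psi> (s + t)) \<in> L1 (ext_ring (prod_meas \<mu> \<nu>)) (ext_measure (prod_meas \<mu> \<nu>))
       \<and> (\<forall>t. (\<lambda>s. \<psi> (s + t)) \<in> L1 cborel \<mu>)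
       \<and> (\<lambda>t. dr_integral cborel \<mu> (\<lambda>s. \<psi> (s + t))) \<in> L1 cborel \<nu>
       \<and> (\<forall>s. (\<lambda>t. \<psi> (s + t)) \<in> L1 cborel \<nu>)
       \<and> (\<lambda>s. dr_integral cborel \<nu> (\<lambda>t. \<psi> (s + t))) \<in> L1 cborel \<mu>
       \<and> pairing (conv \<mu> \<nu>) \<psi>
           = dr_integral (ext_ring (prod_meas \<mu> \<nu>)) (ext_measure (prod_meas \<mu> \<nu>)) (\<lambda>(s, t). \<psi> (s + t))
       \<and> pairing (conv \<mu> \<nu>) \<psi>
           = dr_integral cborel \<nu> (\<lambda>t. dr_integral cborel \<mu> (\<lambda>s. \<psi> (s + t)))
       \<and> pairing (conv \<mu> \<nu>) \<psi>
           = dr_integral cborel \<mu> (\<lambda>s. dr_integral cborel \<nu> (\<lambda>t. \<psi> (s + t))))"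
proof -
  interpret group_weight \<omega>
    using assms by unfold_locales (auto simp: continuous_weight_def)
  show ?thesis
    by (intro conjI ballI allI;
        (rule banach_M_weighted bilinear_conv conv_closed conv_assoc pairing_conv; assumption))
qed

end
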